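(* Let $H$ be a fixed connected graph. The problem of deciding, given a finite tree $T$ and a positive integer $k$, whether Maker wins the $H$-game on $T$ in at most $k$ moves, is fixed-parameter tractable parameterized by $k$; that is, it can be solved in time $f(k)\cdot |T|^{O(1)}$ for some computable function $f$ (depending on $H$).
   Context: In a Maker-Breaker game on the edge set of a graph $G$, Maker and Breaker alternately claim previously unclaimed edges of $G$, Maker first. In the $H$-game the winning sets are all $F\subseteq E(G)$ such that the edge-induced subgraph $G[F]$ (edge set $F$, vertex set the endpoints of edges of $F$) is isomorphic to $H$. Maker wins in at most $k$ moves if she has a strategy guaranteeing that, among her first $k$ claimed edges, she has claimed all edges of some winning set, whatever Breaker does. *)

theory Defs
  imports Main
begin

section \<open>Finite simple graphs\<close>

type_synonym 'a graph = "'a set \<times> 'a set set"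

abbreviation verts :: "'a graph \<Rightarrow> 'a set" where "verts G \<equiv> fst G"
abbreviation edges :: "'a graph \<Rightarrow> 'a set set" where "edges G \<equiv> snd G"

definition finite_graph :: "'a graph \<Rightarrow> bool" where
  "finite_graph G \<longleftrightarrow> finite (verts G) \<and> (\<forall>e\<in>edges G. e \<subseteq> verts G \<and> card e = 2)"

definition connected_graph :: "'a graph \<Rightarrow> bool" where
  "connected_graph G \<longleftrightarrow> finite_graph G \<and> verts G \<noteq> {} \<and>
     (\<forall>u\<in>verts G. \<forall>v\<in>verts G. (u, v) \<in> {(x, y). {x, y} \<in> edges G}\<^sup>*)"

definition cycle_in :: "'a graph \<Rightarrow> 'a list \<Rightarrow> bool" where
  "cycle_in G c \<longleftrightarrow> 3 \<le> length c \<and> distinct c \<and>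
     (\<forall>i<length c. {c ! i, c ! (Suc i mod length c)} \<in> edges G)"

definition tree_graph :: "'a graph \<Rightarrow> bool" where
  "tree_graph G \<longleftrightarrow> connected_graph G \<and> \<not> (\<exists>c. cycle_in G c)"

definition graph_iso :: "'a graph \<Rightarrow> 'b graph \<Rightarrow> bool" where
  "graph_iso G H \<longleftrightarrow>
     (\<exists>f. bij_betw f (verts G) (verts H) \<and> edges H = (\<lambda>e. f ` e) ` edges G)"

definition edge_induced :: "'a set set \<Rightarrow> 'a graph" where
  "edge_induced F = (\<Union>F, F)"


section \<open>The Maker-Breaker game\<close>

text \<open>
  A history lists the claimed elements of the board \<open>X\<close> in the order in which they
  were claimed; Maker's moves are those at the even positions 0, 2, 4, ...
\<close>

definition histories :: "'e set \<Rightarrow> 'e list set" where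
  "histories X = {h. distinct h \<and> set h \<subseteq> X}"

definition maker_strategy :: "'e set \<Rightarrow> ('e list \<Rightarrow> 'e) \<Rightarrow> bool" where
  "maker_strategy X \<sigma> \<longleftrightarrow>
     (\<forall>h\<in>histories X. even (length h) \<and> set h \<noteq> X \<longrightarrow> \<sigma> h \<in> X - set h)"

definition follows :: "('e list \<Rightarrow> 'e) \<Rightarrow> 'e list \<Rightarrow> bool" where
  "follows \<sigma> h \<longleftrightarrow> (\<forall>i<length h. even i \<longrightarrow> h ! i = \<sigma> (take i h))"

definition maker_first :: "nat \<Rightarrow> 'e list \<Rightarrow> 'e set" where
  "maker_first k h = {h ! (2 * i) | i. i < k \<and> 2 * i < length h}"

text \<open>
  Plays continue until the board is exhausted (also after a winning set has been
  completed), which makes it possible that Maker has fewer than \<open>k\<close> moves in total.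
\<close>

definition maker_wins_within :: "'e set \<Rightarrow> 'e set set \<Rightarrow> nat \<Rightarrow> bool" where
  "maker_wins_within X \<W> k \<longleftrightarrow>
     (\<exists>\<sigma>. maker_strategy X \<sigma> \<and>
       (\<forall>h\<in>histories X. set h = X \<and> follows \<sigma> h \<longrightarrow> (\<exists>W\<in>\<W>. W \<subseteq> maker_first k h)))"

definition H_game_sets :: "'b graph \<Rightarrow> 'a graph \<Rightarrow> 'a set set set" where
  "H_game_sets H G = {F. F \<subseteq> edges G \<and> graph_iso (edge_induced F) H}"

definition maker_wins_H_game :: "'b graph \<Rightarrow> 'a graph \<Rightarrow> nat \<Rightarrow> bool" where
  "maker_wins_H_game H G k \<longleftrightarrow> maker_wins_within (edges G) (H_game_sets H G) k"


section \<open>A machine model with running times\<close>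

text \<open>
  Algorithms are programs of a first-order, call-by-value functional language whose
  only data are binary trees (pure Lisp with a single atom; compare the languages F and
  WHILE in N. D. Jones, Computability and Complexity, MIT Press 1997).  Every evaluation
  step has unit cost.  This is a reasonable cost measure: with trees stored as shared
  pointer structures every step takes constant time on a random access machine, as the
  primitives only allocate a cell, follow a pointer, test for the atom, or copy the
  boundedly many arguments of a call; in particular there is no unit-cost deep comparison.
  Conversely, Turing machines are simulated with constant overhead by keeping the two
  halves of the tape as lists.  Running times are thus polynomially related to those of
  Turing machines, and neither the class of computable functions nor that of
  fixed-parameter tractable problems depends on the choice.
\<close>

datatype bintree = Leaf | Node bintree bintree

fun left :: "bintree \<Rightarrow> bintree" where
  "left Leaf = Leaf"
| "left (Node a b) = a"

fun right :: "bintree \<Rightarrow> bintree" where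
  "right Leaf = Leaf"
| "right (Node a b) = b"

datatype expr =
    Var nat
  | LeafE
  | NodeE expr expr
  | LeftE expr
  | RightE expr
  | IfE expr expr expr
  | CallE nat "expr list"

text \<open>
  A program is the list of its function bodies.  In a body, \<open>Var i\<close> is the \<open>i\<close>-th
  argument; \<open>CallE j es\<close> calls the \<open>j\<close>-th function.  In conditionals \<open>Leaf\<close> is false and
  every other tree is true.  \<open>eval P env e v t\<close> means that \<open>e\<close> evaluates to \<open>v\<close> in exactly
  \<open>t\<close> steps; expressions that diverge or refer to missing arguments or functions have
  no value.
\<close>

type_synonym program = "expr list"

inductive
  eval :: "program \<Rightarrow> bintree list \<Rightarrow> expr \<Rightarrow> bintree \<Rightarrow> nat \<Rightarrow> bool" and
  evals :: "program \<Rightarrow> bintree list \<Rightarrow> expr list \<Rightarrow> bintree list \<Rightarrow> nat \<Rightarrow> bool"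
  for P :: program
where
  eval_Var: "i < length env \<Longrightarrow> eval P env (Var i) (env ! i) 1"
| eval_Leaf: "eval P env LeafE Leaf 1"
| eval_Node: "eval P env a u s \<Longrightarrow> eval P env b v t \<Longrightarrow>
    eval P env (NodeE a b) (Node u v) (s + t + 1)"
| eval_Left: "eval P env e v t \<Longrightarrow> eval P env (LeftE e) (left v) (t + 1)"
| eval_Right: "eval P env e v t \<Longrightarrow> eval P env (RightE e) (right v) (t + 1)"
| eval_If_true: "eval P env c u s \<Longrightarrow> u \<noteq> Leaf \<Longrightarrow> eval P env a v t \<Longrightarrow>
    eval P env (IfE c a b) v (s + t + 1)"
| eval_If_false: "eval P env c Leaf s \<Longrightarrow> eval P env b v t \<Longrightarrow>
    eval P env (IfE c a b) v (s + t + 1)"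
| eval_Call: "evals P env es us s \<Longrightarrow> j < length P \<Longrightarrow> eval P us (P ! j) v t \<Longrightarrow>
    eval P env (CallE j es) v (s + t + 1)"
| evals_Nil: "evals P env [] [] 0"
| evals_Cons: "eval P env e v s \<Longrightarrow> evals P env es vs t \<Longrightarrow>
    evals P env (e # es) (v # vs) (s + t)"

inductive_cases eval_elims:
  "eval P env (Var i) v t"
  "eval P env LeafE v t"
  "eval P env (NodeE a b) v t"
  "eval P env (LeftE e) v t"
  "eval P env (RightE e) v t"
  "eval P env (IfE c a b) v t"
  "eval P env (CallE j es) v t"
  "evals P env [] vs t"
  "evals P env (e # es) vs t"

lemma eval_deterministic:
  "eval P env e v t \<Longrightarrow> eval P env e v' t' \<Longrightarrow> v' = v \<and> t' = t"
  "evals P env es vs s \<Longrightarrow> evals P env es vs' s' \<Longrightarrow> vs' = vs \<and> s' = s"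
proof (induction arbitrary: v' t' and vs' s' rule: eval_evals.inducts)
  case eval_Var
  then show ?case by (auto elim: eval_elims(1))
next
  case eval_Leaf
  then show ?case by (auto elim: eval_elims(2))
next
  case eval_Node
  from eval_Node.prems show ?case by (rule eval_elims(3)) (auto dest!: eval_Node.IH(2,4))
next
  case eval_Left
  from eval_Left.prems show ?case by (rule eval_elims(4)) (auto dest!: eval_Left.IH(2))
next
  case eval_Right
  from eval_Right.prems show ?case by (rule eval_elims(5)) (auto dest!: eval_Right.IH(2))
next
  case eval_If_true
  from eval_If_true.prems show ?case
    by (rule eval_elims(6)) (auto simp: eval_If_true.hyps dest!: eval_If_true.IH(2,4))
next
  case eval_If_false
  from eval_If_false.prems show ?case
    by (rule eval_elims(6)) (auto dest!: eval_If_false.IH(2,4))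
next
  case eval_Call
  from eval_Call.prems show ?case by (rule eval_elims(7)) (auto dest!: eval_Call.IH(2,5))
next
  case evals_Nil
  then show ?case by (auto elim: eval_elims(8))
next
  case evals_Cons
  from evals_Cons.prems show ?case by (rule eval_elims(9)) (auto dest!: evals_Cons.IH(2,4))
qed

definition runs :: "program \<Rightarrow> bintree \<Rightarrow> bintree \<Rightarrow> nat \<Rightarrow> bool" where
  "runs P x v t \<longleftrightarrow> P \<noteq> [] \<and> eval P [x] (P ! 0) v t"

fun encode_list :: "('i \<Rightarrow> bintree) \<Rightarrow> 'i list \<Rightarrow> bintree" where
  "encode_list enc [] = Leaf"
| "encode_list enc (x # xs) = Node (enc x) (encode_list enc xs)"

definition encode_nat :: "nat \<Rightarrow> bintree" where
  "encode_nat n = encode_list (\<lambda>_. Leaf) [0..<n]"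

definition encode_bool :: "bool \<Rightarrow> bintree" where
  "encode_bool b = (if b then Node Leaf Leaf else Leaf)"

definition computable :: "(nat \<Rightarrow> nat) \<Rightarrow> bool" where
  "computable f \<longleftrightarrow> (\<exists>P. \<forall>n. \<exists>t. runs P (encode_nat n) (encode_nat (f n)) t)"

text \<open>
  \<open>inst\<close> singles out the instances, i.e. the objects that an algorithm for the problem
  has to handle.
\<close>

definition fixed_parameter_tractable ::
  "('i \<Rightarrow> bintree) \<Rightarrow> ('i \<Rightarrow> nat) \<Rightarrow> ('i \<Rightarrow> nat) \<Rightarrow> ('i \<Rightarrow> bool) \<Rightarrow> ('i \<Rightarrow> bool) \<Rightarrow> bool" where
  "fixed_parameter_tractable enc sz param inst yes \<longleftrightarrow>
     (\<exists>P f c. computable f \<and>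
       (\<forall>x. inst x \<longrightarrow>
         (\<exists>t. runs P (enc x) (encode_bool (yes x)) t \<and> t \<le> f (param x) * sz x ^ c)))"


section \<open>The H-game on trees as a parameterized problem\<close>

text \<open>
  An input graph is given by its number \<open>n\<close> of vertices, which are named \<open>0, ..., n - 1\<close>,
  and by a list containing each edge exactly once, in either orientation and in any order.
  Numbers are written in unary: this changes the length of the graph description only
  polynomially, and the encoding of \<open>k\<close> is irrelevant since \<open>k\<close> is the parameter.
\<close>

type_synonym game_input = "nat \<times> (nat \<times> nat) list \<times> nat"

fun input_graph :: "game_input \<Rightarrow> nat graph" where
  "input_graph (n, es, k) = ({..<n}, {{u, v} | u v. (u, v) \<in> set es})"

fun input_moves :: "game_input \<Rightarrow> nat" where
  "input_moves (n, es, k) = k"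

fun tree_input :: "game_input \<Rightarrow> bool" where
  "tree_input (n, es, k) \<longleftrightarrow>
     tree_graph (input_graph (n, es, k)) \<and> distinct (map (\<lambda>(u, v). {u, v}) es) \<and> 1 \<le> k"

fun encode_input :: "game_input \<Rightarrow> bintree" where
  "encode_input (n, es, k) =
     Node (encode_nat n)
       (Node (encode_list (\<lambda>(u, v). Node (encode_nat u) (encode_nat v)) es) (encode_nat k))"

end

(*
  Locality: if Maker wins within k moves, she wins within k moves inside a ball of radius
  D * 2^k for some constant D depending on H, because Breaker can answer every move x inside the
  ball around x and winning sets are connected.  Hence it suffices to play on the ball around every
  vertex, a rooted tree of bounded depth.

  Kernel: if a vertex of a rooted tree has more than 2k children with isomorphic branches, one of
  them can be deleted.  Before each of Maker's moves fewer than 2k branches have been touched, so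
  a move into the deleted branch can be redirected to an untouched copy by an automorphism.  It is
  enough to compare branches as ordered trees: there are only finitely many ordered trees of a given
  height, so the size of the pruned ball is bounded in terms of k.

  On this kernel the game is solved by exhaustive search, where a copy of H is found by matching
  each of the finitely many ways to write H as an ordered rooted tree against subsequences of
  children.  Only the kernel enters the exponential part of the running time.
*)

theory Submission
  imports Defs
begin

section \<open>The value of a position\<close>

text \<open>The centre of the ball that wins after Maker's move \<open>x\<close> depends on
  Breaker's reply, and only a ball around \<open>x\<close> is common to all replies; re-centring at
  \<open>x\<close> costs a factor 2 per move, whence \<open>2 ^ k\<close>. The claim has to be
  proved for arbitrary positions, because the ball that wins after the reply may avoid
  \<open>x\<close>, in which case it was already winning before the move. Comparing branches as
  ordered trees replaces isomorphism tests by a linear scan, at the price of a larger kernel,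
  bounded by a tower of exponentials whose height grows with the radius. The order of children stems
  from the order of the edges in the input, so the occurrence test must be prepared for every order
  in which \<open>H\<close> can appear. One quantity controls the exponential part: the height of a
  position as a binary tree. It bounds the number of shapes and the number of free edges, and no
  move changes it. The exponent of the polynomial part is independent of \<open>H\<close> and
  \<open>k\<close> because a ball never has more vertices than the input.\<close>

text \<open>
  Breaker may also pass.  This never helps him, but exhausted boards need no separate treatment.
\<close>

fun win :: "'e set \<Rightarrow> 'e set set \<Rightarrow> nat \<Rightarrow> 'e set \<Rightarrow> 'e set \<Rightarrow> bool" where
  "win X W 0 M B \<longleftrightarrow> (\<exists>w\<in>W. w \<subseteq> X \<inter> M)"
| "win X W (Suc k) M B \<longleftrightarrow> (\<exists>w\<in>W. w \<subseteq> X \<inter> M) \<or>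
     (\<exists>x\<in>X - M - B. win X W k (insert x M) B \<and>
        (\<forall>y\<in>X - insert x M - B. win X W k (insert x M) (insert y B)))"

lemma win_now: "w \<in> W \<Longrightarrow> w \<subseteq> X \<inter> M \<Longrightarrow> win X W k M B"
  by (cases k) auto

lemma win_move:
  assumes "x \<in> X - M - B" "win X W k (insert x M) B"
    and "\<And>y. y \<in> X - insert x M - B \<Longrightarrow> win X W k (insert x M) (insert y B)"
  shows "win X W (Suc k) M B"
  unfolding win.simps(2) using assms by (intro disjI2 bexI[of _ x] conjI ballI)

lemma win_SucE:
  assumes "win X W (Suc k) M B"
  obtains (now) w where "w \<in> W" "w \<subseteq> X \<inter> M"
  | (move) x where "x \<in> X - M - B" "win X W k (insert x M) B"
    "\<And>y. y \<in> X - insert x M - B \<Longrightarrow> win X W k (insert x M) (insert y B)"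
  using assms by (metis win.simps(2))

lemma win_Suc: "win X W k M B \<Longrightarrow> win X W (Suc k) M B"
proof (induction k arbitrary: M B)
  case 0
  then show ?case by simp
next
  case (Suc k)
  from Suc.prems show ?case
  proof (cases rule: win_SucE)
    case (now w)
    then show ?thesis by (rule win_now)
  next
    case (move x)
    show ?thesis
      by (rule win_move[OF move(1) Suc.IH[OF move(2)] Suc.IH[OF move(3)]])
  qed
qed

text \<open>A reply in \<open>B\<close> counts as a pass in the position with the larger set
  \<open>B\<close>; every other reply is available in both positions.\<close>

lemma win_antimono: "win X W k M B \<Longrightarrow> B' \<subseteq> B \<Longrightarrow> win X W k M B'"
proof (induction k arbitrary: M B B')
  case 0
  then show ?case by simp
next
  case (Suc k)
  from Suc.prems(1) show ?case
  proof (cases rule: win_SucE)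
    case (now w)
    then show ?thesis by (rule win_now)
  next
    case (move x)
    have "win X W k (insert x M) (insert y B')" if y: "y \<in> X - insert x M - B'" for y
    proof (cases "y \<in> B")
      case True
      then show ?thesis
        using Suc.IH[OF move(2), of "insert y B'"] Suc.prems(2) by simp
    next
      case False
      then show ?thesis
        using Suc.IH[OF move(3)[of y], of "insert y B'"] Suc.prems(2) y by blast
    qed
    moreover have "win X W k (insert x M) B'"
      by (rule Suc.IH[OF move(2) Suc.prems(2)])
    moreover have "x \<in> X - M - B'" using move(1) Suc.prems(2) by blast
    ultimately show ?thesis by (metis win_move)
  qed
qed

lemma win_irrelevant_Breaker:
  "win X W k M B \<Longrightarrow> y \<notin> X \<Longrightarrow> win X W k M (insert y B)"
proof (induction k arbitrary: M B)
  case 0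
  then show ?case by simp
next
  case (Suc k)
  from Suc.prems(1) show ?case
  proof (cases rule: win_SucE)
    case (now w)
    then show ?thesis by (rule win_now)
  next
    case (move x)
    show ?thesis
    proof (rule win_move)
      show "x \<in> X - M - insert y B" using move(1) Suc.prems(2) by blast
      show "win X W k (insert x M) (insert y B)" by (rule Suc.IH[OF move(2) Suc.prems(2)])
      fix z assume "z \<in> X - insert x M - insert y B"
      then show "win X W k (insert x M) (insert z (insert y B))"
        using Suc.IH[OF move(3)[of z] Suc.prems(2)] by (simp add: insert_commute)
    qed
  qed
qed

text \<open>Winning sets have to lie in the board, so an edge of Maker outside it completes none.
  This lets a move outside a ball be forgotten when play is confined to the ball.\<close>

lemma win_irrelevant_Maker:
  "win X W k (insert z M) B \<Longrightarrow> z \<notin> X \<Longrightarrow> win X W k M B"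
proof (induction k arbitrary: M B)
  case 0
  then obtain w where "w \<in> W" "w \<subseteq> X \<inter> insert z M" by auto
  then have "w \<in> W" "w \<subseteq> X \<inter> M" using 0 by blast+
  then show ?case by (rule win_now)
next
  case (Suc k)
  from Suc.prems(1) show ?case
  proof (cases rule: win_SucE)
    case (now w)
    then have "w \<subseteq> X \<inter> M" using Suc.prems(2) by blast
    with now(1) show ?thesis by (rule win_now)
  next
    case (move x)
    show ?thesis
    proof (rule win_move)
      show "x \<in> X - M - B" using move(1) by blast
      show "win X W k (insert x M) B"
        using Suc.IH[of "insert x M" B] move(2) Suc.prems(2) by (simp add: insert_commute)
      fix y assume "y \<in> X - insert x M - B"
      then have "y \<in> X - insert x (insert z M) - B" using Suc.prems(2) by blast
      then show "win X W k (insert x M) (insert y B)"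
        using Suc.IH[of "insert x M" "insert y B"] move(3)[of y] Suc.prems(2)
        by (simp add: insert_commute)
    qed
  qed
qed

text \<open>Maker keeps her strategy for \<open>X\<close>. A reply of Breaker outside
  \<open>X\<close> is a pass as far as \<open>X\<close> is concerned, which is where the option to
  pass in \<open>win\<close> pays off.\<close>

lemma win_board_mono: "win X W k M B \<Longrightarrow> X \<subseteq> Y \<Longrightarrow> win Y W k M B"
proof (induction k arbitrary: M B)
  case 0
  then obtain w where "w \<in> W" "w \<subseteq> X \<inter> M" by auto
  then have "w \<in> W" "w \<subseteq> Y \<inter> M" using 0 by blast+
  then show ?case by (rule win_now)
next
  case (Suc k)
  from Suc.prems(1) show ?case
  proof (cases rule: win_SucE)
    case (now w)
    then have "w \<subseteq> Y \<inter> M" using Suc.prems(2) by blast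
    with now(1) show ?thesis by (rule win_now)
  next
    case (move x)
    show ?thesis
    proof (rule win_move)
      show "x \<in> Y - M - B" using move(1) Suc.prems(2) by blast
      show "win Y W k (insert x M) B" by (rule Suc.IH[OF move(2) Suc.prems(2)])
      fix y assume y: "y \<in> Y - insert x M - B"
      have "win X W k (insert x M) (insert y B)"
        using move(3)[of y] win_irrelevant_Breaker[OF move(2), of y] y by blast
      then show "win Y W k (insert x M) (insert y B)"
        by (rule Suc.IH[OF _ Suc.prems(2)])
    qed
  qed
qed

lemma win_exhausted: "win X W k M B \<Longrightarrow> X \<subseteq> M \<union> B \<Longrightarrow> \<exists>w\<in>W. w \<subseteq> X \<inter> M"
  by (cases k) auto

lemma win_cong_sets: "(\<And>w. w \<subseteq> X \<Longrightarrow> w \<in> W \<longleftrightarrow> w \<in> W') \<Longrightarrow> win X W k M B \<longleftrightarrow> win X W' k M B"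
proof (induction k arbitrary: M B)
  case 0
  then show ?case by (metis le_inf_iff win.simps(1))
next
  case (Suc k)
  then have "(\<exists>w\<in>W. w \<subseteq> X \<inter> M) \<longleftrightarrow> (\<exists>w\<in>W'. w \<subseteq> X \<inter> M)"
    by (metis le_inf_iff)
  then show ?case using Suc by simp
qed

section \<open>Plays and strategies\<close>

definition maker_set :: "'e list \<Rightarrow> 'e set" where
  "maker_set h = {h ! i | i. i < length h \<and> even i}"

definition breaker_set :: "'e list \<Rightarrow> 'e set" where
  "breaker_set h = {h ! i | i. i < length h \<and> odd i}"

lemma move_sets_Nil [simp]: "maker_set [] = {}" "breaker_set [] = {}"
  by (auto simp: maker_set_def breaker_set_def)

lemma indexed_subset_snoc:
  "{(h @ [x]) ! i | i. i < length (h @ [x]) \<and> P i} =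
     (if P (length h) then insert x else id) {h ! i | i. i < length h \<and> P i}"
proof -
  have "{(h @ [x]) ! i | i. i < length (h @ [x]) \<and> P i} =
      (!) (h @ [x]) ` {i. i < length h \<and> P i} \<union> (!) (h @ [x]) ` {i. i = length h \<and> P i}"
    unfolding setcompr_eq_image image_Un[symmetric]
    by (intro arg_cong[where f = "(`) ((!) (h @ [x]))"]) (auto simp: less_Suc_eq)
  also have "(!) (h @ [x]) ` {i. i < length h \<and> P i} = (!) h ` {i. i < length h \<and> P i}"
    by (intro image_cong) (auto simp: nth_append)
  also have "(!) (h @ [x]) ` {i. i = length h \<and> P i} = (if P (length h) then {x} else {})"
    by auto
  finally show ?thesis by auto
qed

lemma maker_set_snoc:
  "maker_set (h @ [x]) = (if even (length h) then insert x (maker_set h) else maker_set h)"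
  unfolding maker_set_def indexed_subset_snoc by simp

lemma breaker_set_snoc:
  "breaker_set (h @ [x]) = (if even (length h) then breaker_set h else insert x (breaker_set h))"
  unfolding breaker_set_def indexed_subset_snoc by simp

lemma move_sets_Un: "maker_set h \<union> breaker_set h = set h"
  by (auto simp: maker_set_def breaker_set_def set_conv_nth)

lemma maker_first_take: "maker_first k h = maker_set (take (2 * k) h)"
proof
  show "maker_first k h \<subseteq> maker_set (take (2 * k) h)"
  proof
    fix x assume "x \<in> maker_first k h"
    then obtain i where "x = h ! (2 * i)" "i < k" "2 * i < length h"
      by (auto simp: maker_first_def)
    then show "x \<in> maker_set (take (2 * k) h)"
      unfolding maker_set_def by (intro CollectI exI[of _ "2 * i"]) simp
  qed
  show "maker_set (take (2 * k) h) \<subseteq> maker_first k h"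
  proof
    fix x assume "x \<in> maker_set (take (2 * k) h)"
    then obtain i where "x = h ! i" "i < 2 * k" "i < length h" "even i"
      by (auto simp: maker_set_def)
    moreover from \<open>even i\<close> obtain j where "i = 2 * j" by (elim evenE)
    ultimately show "x \<in> maker_first k h" by (auto simp: maker_first_def)
  qed
qed

lemma follows_snoc:
  "follows \<sigma> (h @ [x]) \<longleftrightarrow> follows \<sigma> h \<and> (even (length h) \<longrightarrow> x = \<sigma> h)"
  by (auto simp: follows_def nth_append less_Suc_eq)

lemma maker_first_eq: "length h \<le> 2 * k \<Longrightarrow> maker_first k h = maker_set h"
  by (simp add: maker_first_take)

lemma maker_first_append: "length h = 2 * k \<Longrightarrow> maker_first k (h @ h') = maker_set h"
  by (simp add: maker_first_take)

text \<open>Wins are judged on exhausted boards only, so every partial history must be completable;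
  the missing moves of Breaker are arbitrary.\<close>

lemma extend_play:
  assumes "finite X" "maker_strategy X \<sigma>" "h \<in> histories X" "follows \<sigma> h"
  shows "\<exists>h'. h @ h' \<in> histories X \<and> set (h @ h') = X \<and> follows \<sigma> (h @ h')"
  using assms(3,4)
proof (induction "card (X - set h)" arbitrary: h rule: less_induct)
  case less
  show ?case
  proof (cases "set h = X")
    case True
    then show ?thesis using less.prems by (intro exI[of _ "[]"]) simp
  next
    case False
    have "\<exists>x. x \<in> X - set h \<and> follows \<sigma> (h @ [x])"
    proof (cases "even (length h)")
      case True
      then show ?thesis
        using assms(2) less.prems False by (auto simp: maker_strategy_def follows_snoc)
    next
      case odd: False
      then show ?thesis
        using less.prems False by (auto simp: histories_def follows_snoc)
    qed
    then obtain x where x: "x \<in> X - set h" "follows \<sigma> (h @ [x])" by blast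
    have "h @ [x] \<in> histories X"
      using x less.prems by (auto simp: histories_def)
    moreover have "card (X - set (h @ [x])) < card (X - set h)"
      using x assms(1) by (intro psubset_card_mono) auto
    ultimately obtain h' where "(h @ [x]) @ h' \<in> histories X" "set ((h @ [x]) @ h') = X"
      "follows \<sigma> ((h @ [x]) @ h')"
      using less.hyps x(2) by blast
    then show ?thesis by (intro exI[of _ "x # h'"]) simp
  qed
qed

text \<open>Breaker follows the refutations in the recursion of \<open>win\<close>. The board may be
  exhausted before Maker has used all her moves, possibly by a move of her own; then
  \<open>maker_first\<close> comprises all her moves.\<close>

lemma lost_position_lost_play:
  assumes "finite X" "maker_strategy X \<sigma>"
    and "h \<in> histories X" "follows \<sigma> h" "length h = 2 * i"
    and "\<not> win X W j (maker_set h) (breaker_set h)" "\<forall>w\<in>W. w \<subseteq> X"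
  shows "\<exists>h'\<in>histories X. set h' = X \<and> follows \<sigma> h' \<and> \<not> (\<exists>w\<in>W. w \<subseteq> maker_first (i + j) h')"
  using assms(3-6)
proof (induction j arbitrary: h i)
  case 0
  obtain h' where "h @ h' \<in> histories X" "set (h @ h') = X" "follows \<sigma> (h @ h')"
    using extend_play[OF assms(1,2) 0(1,2)] by blast
  moreover have "\<not> (\<exists>w\<in>W. w \<subseteq> maker_first i (h @ h'))"
    using maker_first_append[OF 0(3)] 0(4) assms(7) by auto
  ultimately show ?case by (metis add_0_right)
next
  case (Suc j)
  have noW: "\<not> (\<exists>w\<in>W. w \<subseteq> maker_set h)"
    using Suc.prems(4) assms(7) by auto
  show ?case
  proof (cases "set h = X")
    case True
    then show ?thesis
      using Suc.prems noW maker_first_eq[of h "i + Suc j"] by (intro bexI[of _ h]) auto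
  next
    case False
    define x where "x = \<sigma> h"
    have x: "x \<in> X - set h"
      using assms(2) Suc.prems False by (auto simp: maker_strategy_def x_def)
    have hx: "h @ [x] \<in> histories X" "follows \<sigma> (h @ [x])"
      using x Suc.prems by (auto simp: histories_def follows_snoc x_def)
    let ?M = "insert x (maker_set h)" and ?B = "breaker_set h"
    have free: "X - ?M - ?B = X - set (h @ [x])" "x \<in> X - maker_set h - ?B"
      using x move_sets_Un[of h] by auto
    have lost: "\<not> win X W j ?M ?B \<or> (\<exists>y\<in>X - ?M - ?B. \<not> win X W j ?M (insert y ?B))"
      using Suc.prems(4) free(2) by auto
    have Mx: "maker_set (h @ [x]) = ?M" "breaker_set (h @ [x]) = ?B"
      using Suc.prems(3) by (simp_all add: maker_set_snoc breaker_set_snoc)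
    show ?thesis
    proof (cases "set (h @ [x]) = X")
      case True
      have "\<not> win X W j ?M ?B" using lost True free(1) by auto
      then have "\<not> (\<exists>w\<in>W. w \<subseteq> ?M)"
        using assms(7) by (meson le_inf_iff win_now)
      then show ?thesis
        using True hx Suc.prems(3) maker_first_eq[of "h @ [x]" "i + Suc j"] Mx
        by (intro bexI[of _ "h @ [x]"]) auto
    next
      case False
      then have "X - ?M - ?B \<noteq> {}"
        using hx(1) free(1) by (auto simp: histories_def)
      \<comment> \<open>If the refutation is a pass, any free edge refutes as well, since further
        edges of Breaker do not help Maker. A free edge exists because the board is not
        exhausted.\<close>
      then obtain y where y: "y \<in> X - ?M - ?B" "\<not> win X W j ?M (insert y ?B)"
        using lost win_antimono[of X W j ?M _ ?B] by (metis all_not_in_conv subset_insertI)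
      have "y \<in> X - set (h @ [x])" using y(1) free(1) by simp
      then have "(h @ [x]) @ [y] \<in> histories X"
        using hx(1) by (auto simp: histories_def)
      moreover have "follows \<sigma> ((h @ [x]) @ [y])"
        using hx(2) Suc.prems(3) by (subst follows_snoc) simp
      moreover have "maker_set ((h @ [x]) @ [y]) = ?M" "breaker_set ((h @ [x]) @ [y]) = insert y ?B"
        using Mx Suc.prems(3) by (subst maker_set_snoc breaker_set_snoc, simp)+
      ultimately show ?thesis
        using Suc.IH[of "(h @ [x]) @ [y]" "Suc i"] Suc.prems(3) y(2) by simp
    qed
  qed
qed

text \<open>Maker always moves to a position that is still won with the moves she has left. In a
  play in which she completes nothing, all \<open>k\<close> moves would be of this kind and lead to
  a position won with no move left, which is a contradiction.\<close>

lemma winning_strategy: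
  assumes "win X W k {} {}" "\<forall>w\<in>W. w \<subseteq> X"
  shows "\<exists>\<sigma>. maker_strategy X \<sigma> \<and>
    (\<forall>h\<in>histories X. set h = X \<and> follows \<sigma> h \<longrightarrow> (\<exists>w\<in>W. w \<subseteq> maker_first k h))"
proof -
  \<comment> \<open>\<open>j\<close> is the number of Maker's moves left after \<open>x\<close>: she
    has already made \<open>length h div 2\<close>.\<close>
  define good where "good h x \<longleftrightarrow> x \<in> X - set h \<and>
     (let j = k - Suc (length h div 2); M = insert x (maker_set h); B = breaker_set h in
       win X W j M B \<and> (\<forall>y\<in>X - M - B. win X W j M (insert y B)))" for h x
  \<comment> \<open>The second choice makes \<open>\<sigma>\<close> legal at histories without a
    good move.\<close>
  define \<sigma> where "\<sigma> h = (if \<exists>x. good h x then SOME x. good h x else SOME x. x \<in> X - set h)" for h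
  have strat: "maker_strategy X \<sigma>"
  proof (unfold maker_strategy_def, intro ballI impI)
    fix h assume h: "h \<in> histories X" "even (length h) \<and> set h \<noteq> X"
    show "\<sigma> h \<in> X - set h"
    proof (cases "\<exists>x. good h x")
      case True
      then have "good h (\<sigma> h)" unfolding \<sigma>_def by (simp add: someI_ex)
      then show ?thesis by (simp add: good_def)
    next
      case False
      have "\<exists>x. x \<in> X - set h" using h by (auto simp: histories_def)
      then have "(SOME x. x \<in> X - set h) \<in> X - set h" by (rule someI_ex)
      then show ?thesis using False by (simp only: \<sigma>_def if_False)
    qed
  qed
  have "\<exists>w\<in>W. w \<subseteq> maker_first k h"
    if h: "h \<in> histories X" "set h = X" "follows \<sigma> h" for h
  proof (rule ccontr)
    assume no: "\<not> (\<exists>w\<in>W. w \<subseteq> maker_first k h)"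
    have sub: "maker_set (take i h) \<subseteq> maker_first k h" if "i \<le> 2 * k" for i
      using that unfolding maker_first_take by (force simp: maker_set_def)
    have no': "\<not> (\<exists>w\<in>W. w \<subseteq> X \<inter> maker_set (take i h))" if "i \<le> 2 * k" for i
      using no sub[OF that] by blast
    \<comment> \<open>The invariant includes that the play lasts long enough: on an exhausted board,
      a won position already contains a winning set.\<close>
    have step: "win X W (k - i) (maker_set (take (2 * i) h)) (breaker_set (take (2 * i) h)) \<and>
      2 * i \<le> length h" if "i \<le> k" for i
      using that
    proof (induction i)
      case 0
      then show ?case using assms(1) by simp
    next
      case (Suc i)
      let ?h = "take (2 * i) h"
      let ?M = "maker_set ?h" and ?B = "breaker_set ?h"
      have IH: "win X W (Suc (k - Suc i)) ?M ?B" "2 * i \<le> length h"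
        using Suc by (auto simp: Suc_diff_Suc)
      have no1: "\<not> (\<exists>w\<in>W. w \<subseteq> X \<inter> ?M)"
        using no'[of "2 * i"] Suc.prems by simp
      have len: "length ?h = 2 * i" using IH(2) by simp
      obtain x where "x \<in> X - ?M - ?B" "win X W (k - Suc i) (insert x ?M) ?B"
        "\<forall>y\<in>X - insert x ?M - ?B. win X W (k - Suc i) (insert x ?M) (insert y ?B)"
        using IH(1) no1 by auto
      then have "good ?h x"
        using move_sets_Un[of ?h] len by (auto simp: good_def Let_def)
      then have g: "good ?h (\<sigma> ?h)" unfolding \<sigma>_def by (auto intro: someI)
      then have "2 * i < length h"
        using IH(2) h(2) by (auto simp: good_def intro: ccontr)
      then have "h ! (2 * i) = \<sigma> ?h" using h(3) by (simp add: follows_def)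
      then have t1: "take (Suc (2 * i)) h = ?h @ [\<sigma> ?h]"
        using \<open>2 * i < length h\<close> by (simp add: take_Suc_conv_app_nth)
      let ?M1 = "insert (\<sigma> ?h) ?M"
      have M1: "maker_set (take (Suc (2 * i)) h) = ?M1"
        "breaker_set (take (Suc (2 * i)) h) = ?B"
        using t1 len by (simp_all add: maker_set_snoc breaker_set_snoc)
      have no2: "\<not> (\<exists>w\<in>W. w \<subseteq> X \<inter> ?M1)"
        using no'[of "Suc (2 * i)"] Suc.prems M1 by simp
      have w1: "win X W (k - Suc i) ?M1 ?B"
        "\<forall>y\<in>X - ?M1 - ?B. win X W (k - Suc i) ?M1 (insert y ?B)"
        using g len by (auto simp: good_def Let_def)
      have "\<not> X \<subseteq> ?M1 \<union> ?B" using win_exhausted[OF w1(1)] no2 by blast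
      then have ne: "set (take (Suc (2 * i)) h) \<noteq> X"
        using M1 move_sets_Un[of "take (Suc (2 * i)) h"] by auto
      then have l2: "Suc (2 * i) < length h"
        using h(2) by (metis linorder_not_le take_all)
      define y where "y = h ! Suc (2 * i)"
      have t2: "take (2 * Suc i) h = take (Suc (2 * i)) h @ [y]"
        using l2 by (simp add: take_Suc_conv_app_nth y_def)
      have "y \<notin> set (take (Suc (2 * i)) h)"
        using h(1) t2 distinct_take[of h "2 * Suc i"] by (auto simp: histories_def simp del: take_Suc)
      moreover have "y \<in> X" using l2 h(2) y_def nth_mem by blast
      ultimately have "y \<in> X - ?M1 - ?B"
        using M1 move_sets_Un[of "take (Suc (2 * i)) h"] by auto
      moreover have "maker_set (take (2 * Suc i) h) = ?M1"
        "breaker_set (take (2 * Suc i) h) = insert y ?B"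
        unfolding t2 using M1 l2 by (simp_all add: maker_set_snoc breaker_set_snoc)
      ultimately show ?case using w1(2) l2 by simp
    qed
    from step[of k] have "\<exists>w\<in>W. w \<subseteq> X \<inter> maker_set (take (2 * k) h)" by simp
    then show False using no' by blast
  qed
  then show ?thesis using strat by blast
qed

theorem maker_wins_within_iff_win:
  assumes "finite X" "\<forall>w\<in>W. w \<subseteq> X"
  shows "maker_wins_within X W k \<longleftrightarrow> win X W k {} {}"
proof
  assume "maker_wins_within X W k"
  then obtain \<sigma> where \<sigma>: "maker_strategy X \<sigma>"
    "\<forall>h\<in>histories X. set h = X \<and> follows \<sigma> h \<longrightarrow> (\<exists>w\<in>W. w \<subseteq> maker_first k h)"
    by (auto simp: maker_wins_within_def)
  show "win X W k {} {}"
  proof (rule ccontr)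
    assume "\<not> win X W k {} {}"
    then show False
      using lost_position_lost_play[OF assms(1) \<sigma>(1), of "[]" 0 W k] \<sigma>(2) assms(2)
      by (auto simp: histories_def[of X] follows_def[of _ "[]"])
  qed
next
  assume "win X W k {} {}"
  then show "maker_wins_within X W k"
    using winning_strategy assms(2) by (auto simp: maker_wins_within_def)
qed

section \<open>Locality\<close>

definition adj :: "'v set set \<Rightarrow> ('v \<times> 'v) set" where
  "adj E = {(x, y). {x, y} \<in> E}"

lemma adj_relpow_sym: "(x, y) \<in> adj E ^^ i \<Longrightarrow> (y, x) \<in> adj E ^^ i"
proof (induction i arbitrary: y)
  case (Suc i)
  then obtain z where "(x, z) \<in> adj E ^^ i" "(z, y) \<in> adj E" by auto
  then have "(z, x) \<in> adj E ^^ i" "(y, z) \<in> adj E"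
    using Suc.IH by (auto simp: adj_def insert_commute)
  then show ?case by (meson relpow_Suc_I2)
qed simp

lemma relpow_mono_subset: "R \<subseteq> S \<Longrightarrow> R ^^ i \<subseteq> S ^^ i" for R S :: "('v \<times> 'v) set"
  by (induction i) auto

lemma relpow_trans: "(x, y) \<in> R ^^ i \<Longrightarrow> (y, z) \<in> R ^^ j \<Longrightarrow> (x, z) \<in> R ^^ (i + j)"
  by (auto simp: relpow_add)

definition edge_ball :: "'v set set \<Rightarrow> 'v \<Rightarrow> nat \<Rightarrow> 'v set set" where
  "edge_ball E v r = {{a, b} | a b. \<exists>i<r. (v, a) \<in> adj E ^^ i \<and> {a, b} \<in> E}"

lemma edge_ballI: "(v, a) \<in> adj E ^^ i \<Longrightarrow> i < r \<Longrightarrow> {a, b} \<in> E \<Longrightarrow> {a, b} \<in> edge_ball E v r"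
  unfolding edge_ball_def by (intro CollectI exI conjI) (rule refl)

lemma edge_ball_subset: "edge_ball E v r \<subseteq> E"
  by (auto simp: edge_ball_def)

lemma edge_ball_mono: "r \<le> r' \<Longrightarrow> edge_ball E v r \<subseteq> edge_ball E v r'"
  unfolding edge_ball_def by (smt (verit) Collect_mono order_less_le_trans)

text \<open>The walk back from \<open>a\<close> to \<open>v\<close> has at most \<open>r\<close>
  steps, even if \<open>a\<close> is the far endpoint of its edge, and every edge of the ball is
  reached from \<open>v\<close> in fewer than \<open>r\<close> steps.\<close>

lemma edge_ball_recentre:
  assumes "{a, b} \<in> edge_ball E v r"
  shows "edge_ball E v r \<subseteq> edge_ball E a (2 * r)"
proof
  from assms obtain a' b' i where i: "{a, b} = {a', b'}" "i < r" "(v, a') \<in> adj E ^^ i" "{a', b'} \<in> E"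
    by (auto simp: edge_ball_def)
  have "\<exists>j\<le>r. (v, a) \<in> adj E ^^ j"
  proof (cases "a = a'")
    case True
    then show ?thesis using i by (intro exI[of _ i]) simp
  next
    case False
    then have "(a', a) \<in> adj E" using i by (auto simp: adj_def doubleton_eq_iff)
    then show ?thesis using i by (intro exI[of _ "Suc i"]) auto
  qed
  then obtain j where j': "j \<le> r" "(v, a) \<in> adj E ^^ j" by auto
  then have j: "j \<le> r" "(a, v) \<in> adj E ^^ j" by (auto intro: adj_relpow_sym)
  fix e assume "e \<in> edge_ball E v r"
  then obtain c d l where l: "e = {c, d}" "l < r" "(v, c) \<in> adj E ^^ l" "{c, d} \<in> E"
    by (auto simp: edge_ball_def)
  have "(a, c) \<in> adj E ^^ (j + l)" using relpow_trans[OF j(2) l(3)] .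
  moreover have "j + l < 2 * r" using j l by simp
  ultimately show "e \<in> edge_ball E a (2 * r)"
    unfolding l(1) by (rule edge_ballI[OF _ _ l(4)])
qed

text \<open>
  If Maker's next move \<open>x\<close> lies outside the relevant ball of the remaining game, it can be dropped
  there; otherwise that ball is contained in a ball of twice the radius around \<open>x\<close>.
\<close>

lemma win_edge_ball:
  assumes pairs: "\<And>e. e \<in> E \<Longrightarrow> \<exists>a b. e = {a, b}"
    and local: "\<And>w. w \<in> W \<Longrightarrow> w \<subseteq> E \<Longrightarrow> \<exists>v. w \<subseteq> edge_ball E v D"
    and "win E W k M B" "1 \<le> D"
  shows "\<exists>v. win (edge_ball E v (D * 2 ^ k)) W k M B"
  using assms(3)
proof (induction k arbitrary: M B)
  case 0
  then obtain w where w: "w \<in> W" "w \<subseteq> E" "w \<subseteq> M" by auto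
  then obtain v where "w \<subseteq> edge_ball E v D" using local by blast
  then show ?case using w by auto
next
  case (Suc k)
  let ?r = "D * 2 ^ k"
  have r2: "D * 2 ^ Suc k = 2 * ?r" by simp
  from Suc.prems show ?case
  proof (cases rule: win_SucE)
    case (now w)
    then obtain v where v: "w \<subseteq> edge_ball E v D" using local by blast
    have "D \<le> D * 2 ^ Suc k" by simp
    then have "w \<subseteq> edge_ball E v (D * 2 ^ Suc k) \<inter> M"
      using v now(2) edge_ball_mono[of D "D * 2 ^ Suc k" E v] by blast
    then show ?thesis using win_now[OF now(1)] by blast
  next
    case (move x)
    then obtain a b where x: "x = {a, b}" using pairs by blast
    let ?N = "edge_ball E a (2 * ?r)"
    have "\<exists>i<2 * ?r. (a, a) \<in> adj E ^^ i \<and> {a, b} \<in> E"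
      using \<open>1 \<le> D\<close> move(1) x by (intro exI[of _ 0]) simp
    then have "x \<in> ?N" unfolding edge_ball_def x by blast
    then have xN: "x \<in> ?N - M - B" using move(1) by blast
    show ?thesis
    proof (rule ccontr)
      assume "\<not> ?thesis"
      then have lost: "\<not> win (edge_ball E v (2 * ?r)) W (Suc k) M B" for v
        unfolding r2 by blast
      \<comment> \<open>\<open>B1\<close> is \<open>B\<close> together with a reply of Breaker that
        refutes \<open>?N\<close>, or \<open>B\<close> itself if a pass refutes it. Maker still wins
        on the whole board, so the induction hypothesis yields a small ball for this
        position.\<close>
      have "\<exists>B1. B \<subseteq> B1 \<and> \<not> win ?N W k (insert x M) B1 \<and> win E W k (insert x M) B1"
      proof (cases "win ?N W k (insert x M) B")
        case True
        then obtain y where "y \<in> ?N - insert x M - B" "\<not> win ?N W k (insert x M) (insert y B)"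
          using lost[of a] win_move[OF xN] by blast
        then show ?thesis
          using move(3)[of y] edge_ball_subset[of E a "2 * ?r"] by blast
      next
        case False
        then show ?thesis using move(2) by blast
      qed
      then obtain B1 where B1: "B \<subseteq> B1" "\<not> win ?N W k (insert x M) B1"
        "win E W k (insert x M) B1" by blast
      then obtain v where v: "win (edge_ball E v ?r) W k (insert x M) B1"
        using Suc.IH by blast
      show False
      proof (cases "x \<in> edge_ball E v ?r")
        case True
        then show False
          using win_board_mono[OF v] edge_ball_recentre B1(2) x by metis
      next
        case False
        have "win (edge_ball E v ?r) W (Suc k) M B"
          by (rule win_Suc win_antimono[OF win_irrelevant_Maker[OF v False] B1(1)])+
        then have "win (edge_ball E v (2 * ?r)) W (Suc k) M B"
          by (rule win_board_mono) (simp add: edge_ball_mono)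
        then show False using lost by blast
      qed
    qed
  qed
qed

section \<open>Copies of \<open>H\<close> and their diameter\<close>

definition copies :: "'b graph \<Rightarrow> 'v set set set" where
  "copies H = {F. graph_iso (edge_induced F) H}"

text \<open>A crude bound on the diameter of \<open>H\<close>, by the number of ordered pairs of
  adjacent vertices. It is the source of the constant radius of a winning set.\<close>

lemma relpow_card_bound:
  assumes "connected_graph H" "u \<in> verts H" "v \<in> verts H"
  shows "\<exists>i\<le>card (adj (edges H)). (u, v) \<in> adj (edges H) ^^ i"
proof -
  have "finite (verts H)" "adj (edges H) \<subseteq> verts H \<times> verts H"
    using assms(1) by (auto simp: connected_graph_def finite_graph_def adj_def)
  then have "finite (adj (edges H))" by (meson finite_SigmaI finite_subset)
  moreover have "(u, v) \<in> (adj (edges H))\<^sup>*"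
    using assms by (auto simp: connected_graph_def adj_def)
  ultimately show ?thesis by (auto simp: rtrancl_finite_eq_relpow)
qed

text \<open>Walks in \<open>H\<close> are pulled back along the isomorphism. Injectivity on vertices
  shows that an edge of \<open>H\<close> between the images of \<open>x\<close> and \<open>y\<close>
  comes from the edge \<open>{x, y}\<close> itself.\<close>

lemma copy_connected:
  assumes H: "connected_graph H" and F: "F \<in> copies H" and uv: "u \<in> \<Union>F" "v \<in> \<Union>F"
  shows "\<exists>i\<le>card (adj (edges H)). (u, v) \<in> adj F ^^ i"
proof -
  obtain f where f: "bij_betw f (\<Union>F) (verts H)" "edges H = (`) f ` F"
    using F by (auto simp: copies_def graph_iso_def edge_induced_def)
  have inj: "inj_on f (\<Union>F)" using f(1) by (rule bij_betw_imp_inj_on)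
  have edge: "{x, y} \<in> F" if "{f x, f y} \<in> edges H" "x \<in> \<Union>F" "y \<in> \<Union>F" for x y
  proof -
    have "f ` {x, y} \<in> (`) f ` F" using that f(2) by simp
    then obtain e where e: "e \<in> F" "f ` e = f ` {x, y}" by (metis imageE)
    then have "e = {x, y}"
      using inj_on_image_eq_iff[OF inj, of e "{x, y}"] that by blast
    then show ?thesis using e by simp
  qed
  have "(u, v) \<in> adj F ^^ i" if "(f u, f v) \<in> adj (edges H) ^^ i" "v \<in> \<Union>F" for i v
    using that
  proof (induction i arbitrary: v)
    case 0
    then show ?case using inj uv by (auto dest: inj_onD)
  next
    case (Suc i)
    then obtain z where z: "(f u, z) \<in> adj (edges H) ^^ i" "{z, f v} \<in> edges H"
      by (auto simp: adj_def)
    then have "z \<in> verts H" using H by (auto simp: connected_graph_def finite_graph_def)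
    then obtain z' where z': "z' \<in> \<Union>F" "z = f z'"
      using f(1) by (metis bij_betw_imp_surj_on imageE)
    then have "(z', v) \<in> adj F" using edge z(2) Suc.prems(2) by (simp add: adj_def)
    then show ?case using Suc.IH z z' by auto
  qed
  moreover have "f u \<in> verts H" "f v \<in> verts H"
    using f(1) uv by (auto dest: bij_betwE)
  ultimately show ?thesis using relpow_card_bound[OF H] uv(2) by blast
qed

text \<open>The endpoints of \<open>F\<close> are in bijection with the nonempty vertex set of
  \<open>H\<close>. In particular a single vertex has no copy, as edge-induced graphs have no
  isolated vertices.\<close>

lemma copy_nonempty: "connected_graph H \<Longrightarrow> F \<in> copies H \<Longrightarrow> \<Union>F \<noteq> {}"
proof
  assume "connected_graph H" "F \<in> copies H" "\<Union>F = {}"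
  then obtain f :: "'b \<Rightarrow> 'a" where "bij_betw f {} (verts H)"
    by (auto simp only: copies_def graph_iso_def edge_induced_def fst_conv mem_Collect_eq)
  then have "verts H = {}" by (auto simp: bij_betw_def)
  then show False using \<open>connected_graph H\<close> by (simp add: connected_graph_def)
qed

text \<open>Any vertex of the copy serves as centre; \<open>Suc\<close> turns the bound on walks
  into the strict inequality of \<open>edge_ball\<close>.\<close>

lemma copy_in_edge_ball:
  assumes "connected_graph H" "F \<in> copies H" "F \<subseteq> E" "\<And>e. e \<in> E \<Longrightarrow> card e = 2"
  shows "\<exists>v\<in>\<Union>F. F \<subseteq> edge_ball E v (Suc (card (adj (edges H))))"
proof -
  obtain v where v: "v \<in> \<Union>F" using copy_nonempty[OF assms(1,2)] by blast
  have "F \<subseteq> edge_ball E v (Suc (card (adj (edges H))))"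
  proof
    fix e assume e: "e \<in> F"
    then obtain a b where ab: "e = {a, b}" using assms(3,4) by (meson card_2_iff subsetD)
    then obtain i where i: "i \<le> card (adj (edges H))" "(v, a) \<in> adj F ^^ i"
      using copy_connected[OF assms(1,2) v, of a] e by blast
    have "adj F \<subseteq> adj E" using assms(3) by (auto simp: adj_def)
    then have "(v, a) \<in> adj E ^^ i" using i(2) relpow_mono_subset by blast
    then show "e \<in> edge_ball E v (Suc (card (adj (edges H))))"
      using i(1) ab e assms(3) by (auto intro!: edge_ballI)
  qed
  then show ?thesis using v by blast
qed

section \<open>Deleting redundant branches\<close>

text \<open>For an automorphism that fixes all claimed edges this says that a move and its image are
  equally good.\<close>

lemma win_automorphism:
  assumes "inj \<pi>" "\<pi> ` X = X" "\<And>w. w \<in> W \<Longrightarrow> \<pi> ` w \<in> W" "win X W k M B"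
  shows "win X W k (\<pi> ` M) (\<pi> ` B)"
  using assms(4)
proof (induction k arbitrary: M B)
  case 0
  then obtain w where "w \<in> W" "w \<subseteq> X \<inter> M" by auto
  then have "\<pi> ` w \<in> W" "\<pi> ` w \<subseteq> X \<inter> \<pi> ` M" using assms(2,3) by blast+
  then show ?case by (rule win_now)
next
  case (Suc k)
  from Suc.prems show ?case
  proof (cases rule: win_SucE)
    case (now w)
    then have "\<pi> ` w \<in> W" "\<pi> ` w \<subseteq> X \<inter> \<pi> ` M" using assms(2,3) by blast+
    then show ?thesis by (rule win_now)
  next
    case (move x)
    show ?thesis
    proof (rule win_move)
      have "\<pi> x \<notin> \<pi> ` M" "\<pi> x \<notin> \<pi> ` B"
        using move(1) assms(1) by (auto dest: injD)
      then show "\<pi> x \<in> X - \<pi> ` M - \<pi> ` B" using move(1) assms(2) by blast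
      show "win X W k (insert (\<pi> x) (\<pi> ` M)) (\<pi> ` B)"
        using Suc.IH[OF move(2)] by simp
      fix y assume y: "y \<in> X - insert (\<pi> x) (\<pi> ` M) - \<pi> ` B"
      then obtain z where "z \<in> X" "y = \<pi> z" using assms(2) by blast
      then show "win X W k (insert (\<pi> x) (\<pi> ` M)) (insert y (\<pi> ` B))"
        using Suc.IH[OF move(3)[of z]] y by auto
    qed
  qed
qed

text \<open>The last assumption is a potential: touched copies plus two for every remaining move of
  Maker. A round touches at most two more copies, as the copies are disjoint, so an untouched one
  exists whenever Maker is to move.\<close>

lemma win_delete_branch:
  assumes "finite I" "C \<subseteq> X"
    and aut: "\<And>i. i \<in> I \<Longrightarrow> inj (\<pi> i) \<and> \<pi> i ` X = X \<and> (\<forall>w\<in>W. \<pi> i ` w \<in> W)"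
    and swap: "\<And>i. i \<in> I \<Longrightarrow> \<pi> i ` C = A i \<and> (\<forall>e\<in>X - C - A i. \<pi> i e = e)"
    and disj: "\<And>i. i \<in> I \<Longrightarrow> A i \<inter> C = {}" "\<And>i j. i \<in> I \<Longrightarrow> j \<in> I \<Longrightarrow> i \<noteq> j \<Longrightarrow> A i \<inter> A j = {}"
    and "win X W k M B" "M \<subseteq> X - C" "B \<subseteq> X - C"
    and "card {i \<in> I. (M \<union> B) \<inter> A i \<noteq> {}} + 2 * k \<le> card I"
  shows "win (X - C) W k M B"
  using assms(7-)
proof (induction k arbitrary: M B)
  case 0
  then obtain w where "w \<in> W" "w \<subseteq> X \<inter> M" by auto
  then have "w \<in> W" "w \<subseteq> (X - C) \<inter> M" using 0 by blast+
  then show ?case by (rule win_now)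
next
  case (Suc k)
  let ?T = "\<lambda>S. {i \<in> I. S \<inter> A i \<noteq> {}}"
  have touch: "card (?T (insert x S)) \<le> Suc (card (?T S))" for x S
  proof (cases "\<exists>i\<in>I. x \<in> A i")
    case True
    then obtain i where "i \<in> I" "x \<in> A i" by blast
    then have "?T (insert x S) \<subseteq> insert i (?T S)" using disj(2) by blast
    then have "card (?T (insert x S)) \<le> card (insert i (?T S))"
      using assms(1) by (intro card_mono) auto
    also have "\<dots> \<le> Suc (card (?T S))" by (rule card_insert_le_m1) simp_all
    finally show ?thesis .
  next
    case False
    then have "?T (insert x S) = ?T S" by blast
    then show ?thesis by simp
  qed
  have go: ?case
    if x: "x \<in> X - C - M - B" "win X W k (insert x M) B"
      "\<And>y. y \<in> X - insert x M - B \<Longrightarrow> win X W k (insert x M) (insert y B)" for x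
  proof (rule win_move)
    show "x \<in> X - C - M - B" by (rule x(1))
    have 1: "card (?T (insert x M \<union> B)) + 2 * k \<le> card I"
      using touch[of x "M \<union> B"] Suc.prems(4) by simp
    then show "win (X - C) W k (insert x M) B"
      using x Suc.prems by (intro Suc.IH) auto
    fix y assume y: "y \<in> X - C - insert x M - B"
    have "card (?T (insert x M \<union> insert y B)) + 2 * k \<le> card I"
      using touch[of x "M \<union> B"] touch[of y "insert x M \<union> B"] Suc.prems(4) by simp
    then show "win (X - C) W k (insert x M) (insert y B)"
      using x y Suc.prems by (intro Suc.IH) auto
  qed
  from Suc.prems(1) show ?case
  proof (cases rule: win_SucE)
    case (now w)
    then have "w \<subseteq> (X - C) \<inter> M" using Suc.prems(2) by blast
    with now(1) show ?thesis by (rule win_now)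
  next
    case (move x)
    show ?thesis
    proof (cases "x \<in> C")
      case False
      then show ?thesis using go[of x] move by blast
    next
      case True
      have "?T (M \<union> B) \<noteq> I" using Suc.prems(4) by auto
      then obtain i where i: "i \<in> I" "(M \<union> B) \<inter> A i = {}" by blast
      define p where "p = \<pi> i"
      have p: "inj p" "p ` X = X" "\<And>w. w \<in> W \<Longrightarrow> p ` w \<in> W"
        using aut[OF i(1)] by (auto simp: p_def)
      \<comment> \<open>Claimed edges lie outside \<open>C\<close> and outside the untouched copy.
        Hence the position is its own image and only the move is redirected.\<close>
      have fix_p: "p e = e" if "e \<in> M \<union> B" for e
        using swap[OF i(1)] that Suc.prems(2,3) i(2) unfolding p_def by blast
      then have MB: "p ` M = M" "p ` B = B" by force+
      have px: "p x \<in> A i" using swap[OF i(1)] True by (auto simp: p_def)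
      show ?thesis
      proof (rule go)
        show "p x \<in> X - C - M - B"
          using px disj(1)[OF i(1)] i(2) p(2) move(1) by blast
        show "win X W k (insert (p x) M) B"
          using win_automorphism[OF p move(2)] MB by simp
        fix y assume y: "y \<in> X - insert (p x) M - B"
        then obtain z where z: "z \<in> X" "y = p z" using p(2) by blast
        then have "z \<in> X - insert x M - B" using y fix_p by auto
        then show "win X W k (insert (p x) M) (insert y B)"
          using win_automorphism[OF p move(3)[of z]] MB z by simp
      qed
    qed
  qed
qed

section \<open>Ordered rooted trees\<close>

text \<open>
  \<open>LN v c s\<close> lists the children of a fixed root: a first child \<open>v\<close>, whose own children are given
  by \<open>c\<close>, followed by the remaining children \<open>s\<close>.  Forgetting the labels yields a binary tree,
  whose inner nodes correspond to the edges.
\<close>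

datatype 'v ltree = LL | LN 'v "'v ltree" "'v ltree"

fun shape :: "'v ltree \<Rightarrow> bintree" where
  "shape LL = Leaf"
| "shape (LN v c s) = Node (shape c) (shape s)"

fun labels :: "'v ltree \<Rightarrow> 'v list" where
  "labels LL = []"
| "labels (LN v c s) = v # labels c @ labels s"

fun tedges :: "'v \<Rightarrow> 'v ltree \<Rightarrow> 'v set set" where
  "tedges r LL = {}"
| "tedges r (LN v c s) = insert {r, v} (tedges v c \<union> tedges r s)"

lemma tedges_subset: "e \<in> tedges r t \<Longrightarrow> e \<subseteq> insert r (set (labels t))"
  by (induction r t rule: tedges.induct) auto

lemma tedges_nonroot: "e \<in> tedges r t \<Longrightarrow> r \<notin> set (labels t) \<Longrightarrow> distinct (labels t) \<Longrightarrow> e \<inter> set (labels t) \<noteq> {}"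
  by (induction r t rule: tedges.induct) auto

lemma tedges_card2: "e \<in> tedges r t \<Longrightarrow> distinct (r # labels t) \<Longrightarrow> card e = 2"
  by (induction r t rule: tedges.induct) auto

lemma tedges_Union: "t \<noteq> LL \<Longrightarrow> \<Union>(tedges r t) = insert r (set (labels t))"
proof (induction r t rule: tedges.induct)
  case (2 r v c s)
  have "\<Union>(tedges v c) \<union> {v} = insert v (set (labels c))"
    using 2 by (cases "c = LL") auto
  moreover have "\<Union>(tedges r s) \<union> {r} = insert r (set (labels s))"
    using 2 by (cases "s = LL") auto
  moreover have "\<Union>(tedges r (LN v c s)) = (\<Union>(tedges v c) \<union> {v}) \<union> (\<Union>(tedges r s) \<union> {r})"
    by auto
  ultimately show ?case by auto
qed simp

section \<open>Relabelling and isomorphism of ordered trees\<close>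

lemma tedges_map: "tedges (f r) (map_ltree f t) = (`) f ` tedges r t"
  by (induction r t rule: tedges.induct) auto

lemma labels_map: "labels (map_ltree f t) = map f (labels t)"
  by (induction t) auto

lemma length_labels: "length (labels t) = size (shape t)"
  by (induction t) auto

text \<open>Shape and preorder list of labels determine a labelled tree. Isomorphisms between trees
  of equal shape can therefore be built from lists of labels.\<close>

lemma map_ltree_labels:
  "shape s = shape t \<Longrightarrow> map f (labels s) = labels t \<Longrightarrow> map_ltree f s = t"
proof (induction s arbitrary: t)
  case LL
  then show ?case by (cases t) auto
next
  case (LN v c s)
  from LN.prems(1) obtain w d u where t: "t = LN w d u" "shape c = shape d" "shape s = shape u"
    by (cases t) auto
  have "length (map f (labels c)) = length (labels d)"
    using t(2) by (simp add: length_labels)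
  then show ?case using LN t by simp
qed

lemma shape_map: "shape (map_ltree f t) = shape t"
  by (induction t) auto

text \<open>The lists are exchanged position by position. As an involution the map is its own
  inverse, so it readily gives an automorphism of the board.\<close>

lemma exists_swap:
  assumes "distinct (xs @ ys)" "length xs = length ys"
  shows "\<exists>f. f \<circ> f = id \<and> map f xs = ys \<and> (\<forall>a. a \<notin> set xs \<union> set ys \<longrightarrow> f a = a)"
  using assms(2,1)
proof (induction xs ys rule: list_induct2)
  case Nil
  then show ?case by (intro exI[of _ id]) simp
next
  case (Cons x xs y ys)
  have "distinct (xs @ ys)" using Cons.prems by simp
  then obtain f where f: "f \<circ> f = id" "map f xs = ys" "\<forall>a. a \<notin> set xs \<union> set ys \<longrightarrow> f a = a"
    using Cons.IH by blast
  have ff: "f (f a) = a" for a using f(1) by (metis comp_apply id_apply)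
  have xy: "f x = x" "f y = y" "x \<noteq> y" "x \<notin> set xs" "y \<notin> set xs" "x \<notin> set ys" "y \<notin> set ys"
    using f(3) Cons.prems by auto
  let ?g = "\<lambda>a. if a = x then y else if a = y then x else f a"
  have "map ?g xs = map f xs" using xy by (intro map_cong) auto
  moreover have "?g \<circ> ?g = id"
  proof
    fix a
    show "(?g \<circ> ?g) a = id a"
    proof (cases "a = x \<or> a = y")
      case False
      then have "f a \<noteq> x" "f a \<noteq> y" using ff[of a] xy by auto
      then show ?thesis using ff False by simp
    qed auto
  qed
  ultimately show ?case using f(2,3) xy by (intro exI[of _ ?g]) auto
qed

text \<open>Labels at equal preorder positions are paired. Injectivity follows by counting: the
  image of the labels has as many elements as there are labels.\<close>

lemma same_shape_iso:
  assumes "shape s = shape t" "distinct (r # labels s)" "distinct (r' # labels t)"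
  shows "\<exists>f. bij_betw f (insert r (set (labels s))) (insert r' (set (labels t))) \<and>
    tedges r' t = (`) f ` tedges r s"
proof -
  let ?xs = "r # labels s" and ?ys = "r' # labels t"
  have len: "length ?xs = length ?ys" using assms(1) by (simp add: length_labels)
  define f where "f = the \<circ> map_of (zip ?xs ?ys)"
  have map: "map f ?xs = ?ys"
  proof (rule nth_equalityI)
    fix i assume "i < length (map f ?xs)"
    then have i: "i < length ?xs" "i < length ?ys" using len by simp_all
    have "map f ?xs ! i = f (?xs ! i)" using i(1) by (rule nth_map)
    then show "map f ?xs ! i = ?ys ! i"
      using map_of_zip_nth[OF len assms(2) i(2)] by (simp only: f_def comp_apply option.sel)
  qed (use len in simp)
  then have fr: "f r = r'" "map f (labels s) = labels t" by simp_all
  have im: "f ` set ?xs = set ?ys" using map by (metis list.set_map)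
  have "card (f ` set ?xs) = card (set ?xs)"
    unfolding im using len assms by (metis distinct_card)
  then have "inj_on f (set ?xs)" by (rule eq_card_imp_inj_on[OF finite_set])
  moreover have "tedges r' t = (`) f ` tedges r s"
    using tedges_map[of f r s] map_ltree_labels[OF assms(1) fr(2)] fr(1) by simp
  ultimately show ?thesis using im by (intro exI[of _ f]) (simp add: bij_betw_def)
qed

lemma copies_bij:
  assumes "bij_betw f (\<Union>F) (\<Union>F')" "F' = (`) f ` F" "F' \<in> copies H"
  shows "F \<in> copies H"
proof -
  obtain g where "bij_betw g (\<Union>F') (verts H)" "edges H = (`) g ` F'"
    using assms(3) by (auto simp: copies_def graph_iso_def edge_induced_def)
  then have "bij_betw (g \<circ> f) (\<Union>F) (verts H)" "edges H = (`) (g \<circ> f) ` F"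
    using assms(1,2) by (auto intro: bij_betw_trans simp: image_image image_comp)
  then show ?thesis by (auto simp: copies_def graph_iso_def edge_induced_def)
qed

lemma copies_swap:
  assumes "f \<circ> f = id" "F \<in> copies H"
  shows "(`) f ` F \<in> copies H"
proof (rule copies_bij[OF _ _ assms(2)])
  have ff: "f (f a) = a" for a using assms(1) by (metis comp_apply id_apply)
  have "f ` \<Union>((`) f ` F) = \<Union>F" by (auto simp: ff image_iff)
  then show "bij_betw f (\<Union>((`) f ` F)) (\<Union>F)"
    unfolding bij_betw_def by (metis ff inj_onI)
  show "F = (`) f ` (`) f ` F"
    using assms(1) by (simp add: image_image ff image_comp)
qed

section \<open>Branches at the root and pruning\<close>

fun branches :: "'v ltree \<Rightarrow> ('v \<times> 'v ltree) list" where
  "branches LL = []"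
| "branches (LN v c s) = (v, c) # branches s"

fun children :: "bintree \<Rightarrow> bintree list" where
  "children Leaf = []"
| "children (Node a b) = a # children b"

lemma children_shape: "children (shape t) = map (shape \<circ> snd) (branches t)"
  by (induction t) auto

lemma branches_tedges:
  "(v, c) \<in> set (branches t) \<Longrightarrow> tedges r (LN v c LL) \<subseteq> tedges r t"
  by (induction t) auto

lemma branches_labels:
  "(v, c) \<in> set (branches t) \<Longrightarrow> insert v (set (labels c)) \<subseteq> set (labels t)"
  by (induction t) auto

lemma branches_distinct:
  "(v, c) \<in> set (branches t) \<Longrightarrow> distinct (labels t) \<Longrightarrow> distinct (v # labels c)"
  by (induction t) auto

lemma distinct_branches: "distinct (labels t) \<Longrightarrow> distinct (branches t)"
  by (induction t) (auto dest: branches_labels)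

lemma branches_disjoint:
  assumes "(v, c) \<in> set (branches t)" "(w, d) \<in> set (branches t)" "(v, c) \<noteq> (w, d)" "distinct (labels t)"
  shows "insert v (set (labels c)) \<inter> insert w (set (labels d)) = {}"
  using assms
proof (induction t)
  case (LN x a s)
  then show ?case using branches_labels[of v c s] branches_labels[of w d s] by auto
qed simp

lemma branch_meets:
  assumes "e \<in> tedges r t" "distinct (r # labels t)" "(v, c) \<in> set (branches t)"
    "e \<inter> insert v (set (labels c)) \<noteq> {}"
  shows "e \<in> tedges r (LN v c LL)"
  using assms
proof (induction t)
  case (LN x a s)
  show ?case
  proof (cases "(v, c) = (x, a)")
    case True
    then show ?thesis using LN.prems tedges_subset[of e r s] by auto
  next
    case False
    then have vc: "(v, c) \<in> set (branches s)" using LN.prems(3) by auto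
    have "e \<noteq> {r, x}" "e \<notin> tedges x a"
      using LN.prems branches_labels[OF vc] tedges_subset[of e x a] by auto
    then show ?thesis using LN vc by auto
  qed
qed simp

text \<open>A branch and its later siblings are pruned before they are compared. Branches with equal
  kernels thus count as equal even if they differed originally, and the number of children that
  survive is bounded by counting kernels of smaller depth.\<close>

fun prune :: "nat \<Rightarrow> 'v ltree \<Rightarrow> 'v ltree" where
  "prune q LL = LL"
| "prune q (LN v c s) =
    (if q \<le> count_list (children (shape (prune q s))) (shape (prune q c))
     then prune q s else LN v (prune q c) (prune q s))"

lemma labels_prune: "set (labels (prune q t)) \<subseteq> set (labels t)"
  by (induction q t rule: prune.induct) auto

lemma distinct_prune: "distinct (labels t) \<Longrightarrow> distinct (labels (prune q t))"
proof (induction q t rule: prune.induct)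
  case (2 q v c s)
  then show ?case using labels_prune[of q c] labels_prune[of q s] by auto
qed simp

text \<open>\<open>E\<close> is the part of the board outside the subtree, so that the statement
  applies anywhere in a larger tree. The interchangeable copies are the sibling branches of equal
  shape, each with its edge to \<open>r\<close>; exchanging the labels of two of them fixes
  \<open>r\<close> and all of \<open>E\<close>.\<close>

lemma win_drop_first_branch:
  fixes E :: "'v set set"
  assumes dist: "distinct (r # labels (LN v c s))"
    and E: "\<And>e. e \<in> E \<Longrightarrow> e \<inter> set (labels (LN v c s)) = {}"
    and many: "2 * k \<le> count_list (children (shape s)) (shape c)"
    and win: "win (E \<union> tedges r (LN v c s)) (copies H) k {} {}"
  shows "win (E \<union> tedges r s) (copies H) k {} {}"
proof -
  define I where "I = {b \<in> set (branches s). shape (snd b) = shape c}"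
  define A where "A b = tedges r (LN (fst b) (snd b) LL)" for b :: "'v \<times> 'v ltree"
  let ?X = "E \<union> tedges r (LN v c s)" and ?C = "tedges r (LN v c LL)"
  let ?L = "\<lambda>b. insert (fst b) (set (labels (snd b)))"
  have cardI: "2 * k \<le> card I"
  proof -
    have "count_list (children (shape s)) (shape c) =
        length (filter (\<lambda>b. shape (snd b) = shape c) (branches s))"
      by (simp add: children_shape count_list_eq_length_filter filter_map comp_def eq_commute)
    also have "\<dots> = card I"
      unfolding I_def using dist distinct_branches[of s]
      by (simp add: distinct_card[symmetric] distinct_filter)
    finally show ?thesis using many by simp
  qed
  have "\<exists>f. f \<circ> f = id \<and> map f (v # labels c) = fst b # labels (snd b) \<and>
      (\<forall>a. a \<notin> set (v # labels c) \<union> set (fst b # labels (snd b)) \<longrightarrow> f a = a)" if "b \<in> I" for b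
  proof (rule exists_swap)
    have b: "(fst b, snd b) \<in> set (branches s)" "shape (snd b) = shape c"
      using that by (simp_all add: I_def)
    show "distinct ((v # labels c) @ fst b # labels (snd b))"
      using dist branches_labels[OF b(1)] branches_distinct[OF b(1)] by auto
    show "length (v # labels c) = length (fst b # labels (snd b))"
      using b(2) by (simp add: length_labels)
  qed
  then obtain f where f: "\<And>b. b \<in> I \<Longrightarrow> f b \<circ> f b = id \<and>
      map (f b) (v # labels c) = fst b # labels (snd b) \<and>
      (\<forall>a. a \<notin> set (v # labels c) \<union> set (fst b # labels (snd b)) \<longrightarrow> f b a = a)"
    by metis
  have b_in: "(fst b, snd b) \<in> set (branches s)" if "b \<in> I" for b using that by (simp add: I_def)
  have Lb: "?L b \<subseteq> set (labels s)" if "b \<in> I" for b using branches_labels[OF b_in[OF that]] .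
  have Xr: "tedges r (LN v c s) = ?C \<union> tedges r s" by auto
  have A_sub: "A b \<subseteq> tedges r s" if "b \<in> I" for b
    unfolding A_def using branches_tedges[OF b_in[OF that]] .
  \<comment> \<open>Every edge of a branch has an endpoint other than \<open>r\<close>, and this
    endpoint identifies the branch. All disjointness claims below rest on this.\<close>
  have meetsA: "e \<inter> ?L b \<noteq> {}" if "e \<in> A b" "b \<in> I" for e b
    using that tedges_nonroot[of e r "LN (fst b) (snd b) LL"] dist Lb[OF that(2)]
      branches_distinct[OF b_in[OF that(2)]] by (auto simp: A_def)
  have Csub: "e \<subseteq> insert r (insert v (set (labels c)))" if "e \<in> ?C" for e
    using tedges_subset[OF that] by simp
  have swapC: "(`) (f b) ` ?C = A b" and swapA: "(`) (f b) ` A b = ?C" if "b \<in> I" for b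
  proof -
    have "r \<notin> set (v # labels c) \<union> set (fst b # labels (snd b))"
      using dist Lb[OF that] by auto
    then have "f b r = r" using f[OF that] by blast
    moreover have "map_ltree (f b) (LN v c LL) = LN (fst b) (snd b) LL"
      using f[OF that] that by (intro map_ltree_labels) (auto simp: I_def)
    ultimately show *: "(`) (f b) ` ?C = A b"
      unfolding A_def by (metis tedges_map)
    have "f b (f b a) = a" for a using f[OF that] by (metis comp_apply id_apply)
    then show "(`) (f b) ` A b = ?C"
      unfolding *[symmetric] by (simp add: image_image)
  qed
  have fixed: "f b ` e = e" if "b \<in> I" "e \<in> ?X" "e \<notin> ?C" "e \<notin> A b" for b e
  proof -
    have "e \<inter> (insert v (set (labels c)) \<union> ?L b) = {}"
    proof (cases "e \<in> E")
      case True
      then show ?thesis using E[OF True] Lb[OF that(1)] by auto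
    next
      case False
      then have es: "e \<in> tedges r s" using that(2,3) Xr by blast
      have "e \<inter> ?L b = {}"
        using branch_meets[OF es _ b_in[OF that(1)]] that(4) dist by (auto simp: A_def)
      then show ?thesis using tedges_subset[OF es] dist by auto
    qed
    then have "a \<notin> set (v # labels c) \<union> set (fst b # labels (snd b))" if "a \<in> e" for a
      using that by auto
    then have "\<forall>a\<in>e. f b a = a" using f[OF that(1)] by blast
    then show ?thesis by force
  qed
  have "win (?X - ?C) (copies H) k {} {}"
  proof (rule win_delete_branch[where I = I and A = A and \<pi> = "\<lambda>b. (`) (f b)"])
    show "finite I" by (simp add: I_def)
    show "?C \<subseteq> ?X" by auto
    fix b assume b: "b \<in> I"
    have ff: "f b \<circ> f b = id" using f[OF b] by blast
    then have "inj (f b)" by (metis inj_on_id inj_on_imageI2)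
    have AX: "A b \<subseteq> ?X" using A_sub[OF b] Xr by blast
    define S where "S = ?X - ?C - A b"
    have "(`) (f b) ` S = (\<lambda>e. e) ` S"
      by (rule image_cong) (use fixed[OF b] in \<open>auto simp: S_def\<close>)
    then have S: "(`) (f b) ` S = S" by simp
    have XS: "?X = S \<union> (?C \<union> A b)" using AX Xr unfolding S_def by blast
    have "(`) (f b) ` ?X = ?X"
      unfolding XS image_Un S swapA[OF b] swapC[OF b] by (simp only: Un_commute)
    then show "inj ((`) (f b)) \<and> (`) (f b) ` ?X = ?X \<and> (\<forall>w\<in>copies H. (`) (f b) ` w \<in> copies H)"
      using copies_swap[OF ff, of _ H] inj_image_eq_iff[OF \<open>inj (f b)\<close>]
      by (intro conjI ballI) (auto intro!: injI)
    show "(`) (f b) ` ?C = A b \<and> (\<forall>e\<in>?X - ?C - A b. f b ` e = e)"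
      using swapC[OF b] fixed[OF b] by blast
    show "A b \<inter> ?C = {}"
      using meetsA[OF _ b] Csub Lb[OF b] dist by fastforce
    fix b' assume b': "b' \<in> I" "b \<noteq> b'"
    have "?L b \<inter> ?L b' = {}"
      using branches_disjoint[OF b_in[OF b] b_in[OF b'(1)]] b'(2) dist by (simp add: prod_eq_iff)
    moreover have "e \<subseteq> insert r (?L b')" if "e \<in> A b'" for e
      using tedges_subset[of e r "LN (fst b') (snd b') LL"] that by (auto simp: A_def)
    moreover have "r \<notin> ?L b" using Lb[OF b] dist by auto
    ultimately show "A b \<inter> A b' = {}" using meetsA[OF _ b] by blast
  qed (use win cardI in auto)
  moreover have "?X - ?C \<subseteq> E \<union> tedges r s" using Xr by blast
  ultimately show ?thesis by (rule win_board_mono)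
qed

lemma tedges_prune: "tedges r (prune q t) \<subseteq> tedges r t"
proof (induction q t arbitrary: r rule: prune.induct)
  case (2 q v c s)
  then show ?case by (auto; blast)
qed simp

text \<open>While one part of the tree is pruned, the rest of the board stays in play and is carried
  along as \<open>E\<close>. The branch below \<open>v\<close> and the siblings of \<open>v\<close>
  are treated in turn, each belonging to \<open>E\<close> while the other is pruned.\<close>

lemma win_prune_forward:
  assumes "distinct (r # labels t)" "\<And>e. e \<in> E \<Longrightarrow> e \<inter> set (labels t) = {}"
    and "2 * k \<le> q" "win (E \<union> tedges r t) (copies H) k {} {}"
  shows "win (E \<union> tedges r (prune q t)) (copies H) k {} {}"
  using assms
proof (induction t arbitrary: r E)
  case (LN v c s)
  let ?c = "prune q c" and ?s = "prune q s"
  have "win ((E \<union> insert {r, v} (tedges r s)) \<union> tedges v c) (copies H) k {} {}"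
    using LN.prems(4) by (simp add: Un_ac)
  then have 1: "win ((E \<union> insert {r, v} (tedges r s)) \<union> tedges v ?c) (copies H) k {} {}"
  proof (rule LN.IH(1)[rotated 3])
    fix e assume "e \<in> E \<union> insert {r, v} (tedges r s)"
    then show "e \<inter> set (labels c) = {}"
      using LN.prems(1,2) tedges_subset[of e r s] by auto
  qed (use LN.prems in auto)
  have "win ((E \<union> insert {r, v} (tedges v ?c)) \<union> tedges r s) (copies H) k {} {}"
    using 1 by (simp add: Un_ac)
  then have "win ((E \<union> insert {r, v} (tedges v ?c)) \<union> tedges r ?s) (copies H) k {} {}"
  proof (rule LN.IH(2)[rotated 3])
    fix e assume "e \<in> E \<union> insert {r, v} (tedges v ?c)"
    then show "e \<inter> set (labels s) = {}"
      using LN.prems(1,2) tedges_subset[of e v ?c] labels_prune[of q c] by auto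
  qed (use LN.prems in auto)
  then have 2: "win (E \<union> tedges r (LN v ?c ?s)) (copies H) k {} {}"
    by (simp add: Un_ac)
  have sub: "set (labels (LN v ?c ?s)) \<subseteq> set (labels (LN v c s))"
    using labels_prune[of q c] labels_prune[of q s] by auto
  show ?case
  proof (cases "q \<le> count_list (children (shape ?s)) (shape ?c)")
    case True
    have "win (E \<union> tedges r ?s) (copies H) k {} {}"
    proof (rule win_drop_first_branch[OF _ _ _ 2])
      show "distinct (r # labels (LN v ?c ?s))"
        using LN.prems(1) labels_prune[of q c] labels_prune[of q s] distinct_prune[of c q]
          distinct_prune[of s q] by auto
      show "e \<inter> set (labels (LN v ?c ?s)) = {}" if "e \<in> E" for e
        using LN.prems(2)[OF that] sub by blast
      show "2 * k \<le> count_list (children (shape ?s)) (shape ?c)"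
        using True LN.prems(3) by simp
    qed
    then show ?thesis using True by simp
  next
    case False
    then show ?thesis using 2 by simp
  qed
qed simp

theorem win_prune:
  assumes "distinct (r # labels t)" "2 * k \<le> q"
  shows "win (tedges r (prune q t)) (copies H) k {} {} \<longleftrightarrow> win (tedges r t) (copies H) k {} {}"
  using win_prune_forward[OF assms(1) _ assms(2), of "{}" H] win_board_mono tedges_prune
  by (metis empty_iff sup_bot_left)

section \<open>Counting binary trees of bounded height\<close>

fun bheight :: "bintree \<Rightarrow> nat" where
  "bheight Leaf = 0"
| "bheight (Node a b) = Suc (max (bheight a) (bheight b))"

lemma bheight_le_size: "bheight t \<le> size t"
  by (induction t) auto

lemma trees_bheight_Suc:
  "{t. bheight t \<le> Suc s} = insert Leaf ((\<lambda>(a, b). Node a b) ` ({t. bheight t \<le> s} \<times> {t. bheight t \<le> s}))"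
  (is "_ = ?R")
proof
  show "{t. bheight t \<le> Suc s} \<subseteq> ?R"
  proof
    fix t assume "t \<in> {t. bheight t \<le> Suc s}"
    then show "t \<in> ?R" by (cases t) auto
  qed
qed auto

text \<open>If there are \<open>m\<close> trees of height at most \<open>s\<close>, there are at
  most \<open>m * m + 1\<close> of height at most \<open>s + 1\<close>. The strict inequality
  absorbs the extra tree, as \<open>m * m + 1 < (m + 1) * (m + 1)\<close> for positive
  \<open>m\<close>.\<close>

lemma card_trees_bheight: "finite {t. bheight t \<le> s} \<and> card {t. bheight t \<le> s} < 2 ^ 2 ^ s"
proof (induction s)
  case 0
  have "{t. bheight t \<le> 0} = {Leaf}"
  proof -
    have "t = Leaf" if "bheight t = 0" for t using that by (cases t) auto
    then show ?thesis by auto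
  qed
  then show ?case by simp
next
  case (Suc s)
  let ?S = "{t. bheight t \<le> s}"
  define m where "m = card ?S"
  have "card {t. bheight t \<le> Suc s} \<le> Suc (card ((\<lambda>(a, b). Node a b) ` (?S \<times> ?S)))"
    unfolding trees_bheight_Suc by (rule card_insert_le_m1) simp_all
  also have "card ((\<lambda>(a, b). Node a b) ` (?S \<times> ?S)) \<le> card (?S \<times> ?S)"
    by (rule card_image_le) (use Suc in simp)
  also have "card (?S \<times> ?S) = m * m" by (simp add: m_def card_cartesian_product)
  finally have 1: "card {t. bheight t \<le> Suc s} \<le> Suc (m * m)" by simp
  have "m > 0" unfolding m_def using Suc by (auto simp: card_gt_0_iff intro!: exI[of _ Leaf])
  have "Suc m \<le> 2 ^ 2 ^ s" using Suc by (simp add: m_def)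
  then have "Suc m * Suc m \<le> 2 ^ 2 ^ s * 2 ^ 2 ^ s" by (rule mult_le_mono) fact
  also have "\<dots> = (2::nat) ^ 2 ^ Suc s" by (simp add: power_add[symmetric] mult_2)
  finally have "Suc (m * m) < 2 ^ 2 ^ Suc s" using \<open>m > 0\<close> by simp
  moreover have "finite {t. bheight t \<le> Suc s}"
    unfolding trees_bheight_Suc using Suc by simp
  ultimately show ?case using 1 by linarith
qed

section \<open>Positions and occurrences of \<open>H\<close>\<close>

text \<open>
  In a position the mark of an edge is stored together with the branch below it; \<open>Leaf\<close> marks a
  free edge.
\<close>

definition maker_mark :: bintree where "maker_mark = Node Leaf Leaf"
definition breaker_mark :: bintree where "breaker_mark = Node (Node Leaf Leaf) Leaf"

definition is_maker :: "bintree \<Rightarrow> bool" where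
  "is_maker l \<longleftrightarrow> l \<noteq> Leaf \<and> left l = Leaf"

fun pos :: "'v \<Rightarrow> 'v ltree \<Rightarrow> ('v set \<Rightarrow> bintree) \<Rightarrow> bintree" where
  "pos r LL g = Leaf"
| "pos r (LN v c s) g = Node (Node (g {r, v}) (pos v c g)) (pos r s g)"

definition mark :: "'e set \<Rightarrow> 'e set \<Rightarrow> 'e \<Rightarrow> bintree" where
  "mark M B e = (if e \<in> M then maker_mark else if e \<in> B then breaker_mark else Leaf)"

lemma mark_upd:
  "mark (insert e M) B = (mark M B)(e := maker_mark)"
  "e \<notin> M \<Longrightarrow> mark M (insert e B) = (mark M B)(e := breaker_mark)"
  by (auto simp: mark_def fun_eq_iff)

lemma mark_simps [simp]:
  "mark M B e = Leaf \<longleftrightarrow> e \<notin> M \<and> e \<notin> B"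
  "is_maker (mark M B e) \<longleftrightarrow> e \<in> M"
  by (auto simp: mark_def is_maker_def maker_mark_def breaker_mark_def)

lemma size_left_right [termination_simp]: "size (left x) \<le> size x" "size (right x) \<le> size x"
  by (cases x; simp)+

text \<open>
  \<open>h\<close> is matched with a subsequence of the children, recursively.  As all orderings of \<open>H\<close> are
  tried for \<open>h\<close>, no permutation of the children has to be considered.
\<close>

fun emb :: "bintree \<Rightarrow> bintree \<Rightarrow> bool" where
  "emb Leaf t \<longleftrightarrow> True"
| "emb (Node a b) Leaf \<longleftrightarrow> False"
| "emb (Node a b) (Node x r) \<longleftrightarrow>
    is_maker (left x) \<and> emb a (right x) \<and> emb b r \<or> emb (Node a b) r"

text \<open>The recursion visits all nodes of the binary tree, so \<open>emb\<close> is also tried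
  on suffixes of a list of children. This finds nothing new, since \<open>emb\<close> may skip
  children anyway.\<close>

fun occ :: "bintree \<Rightarrow> bintree \<Rightarrow> bool" where
  "occ h Leaf \<longleftrightarrow> False"
| "occ h (Node x r) \<longleftrightarrow> emb h (Node x r) \<or> occ h (right x) \<or> occ h r"

text \<open>All ways of writing \<open>H\<close> as an ordered rooted tree; the set is empty if
  \<open>H\<close> contains a cycle. Labels are natural numbers because the definition has to commit
  to one type.\<close>

definition shapes :: "'b graph \<Rightarrow> bintree set" where
  "shapes H = {shape t | (t :: nat ltree) r. t \<noteq> LL \<and> distinct (r # labels t) \<and> tedges r t \<in> copies H}"

lemma shape_in_shapes:
  fixes t :: "'v ltree"
  assumes "t \<noteq> LL" "distinct (r # labels t)" "tedges r t \<in> copies H"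
  shows "shape t \<in> shapes H"
proof -
  obtain f :: "'v \<Rightarrow> nat" where f: "inj_on f (set (r # labels t))"
    using finite_imp_inj_to_nat_seg[OF finite_set] by metis
  let ?t = "map_ltree f t"
  have "?t \<noteq> LL" using assms(1) by (cases t) auto
  moreover have d: "distinct (f r # labels ?t)"
    using f assms(2) distinct_map[of f "r # labels t"] by (simp add: labels_map)
  moreover have "tedges (f r) ?t \<in> copies H"
  proof -
    obtain g where g: "bij_betw g (insert (f r) (set (labels ?t))) (insert r (set (labels t)))"
      "tedges r t = (`) g ` tedges (f r) ?t"
      using same_shape_iso[of ?t t, OF shape_map d assms(2)] by blast
    show ?thesis
      by (rule copies_bij[OF _ g(2) assms(3)]) (use g(1) assms(1) \<open>?t \<noteq> LL\<close> in \<open>simp add: tedges_Union\<close>)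
  qed
  ultimately show ?thesis
    unfolding shapes_def mem_Collect_eq by (metis shape_map)
qed

lemma copies_of_shape:
  assumes "shape t \<in> shapes H" "distinct (r # labels t)"
  shows "tedges r t \<in> copies H"
proof -
  obtain t0 :: "nat ltree" and r0 where t0: "shape t = shape t0" "t0 \<noteq> LL"
    "distinct (r0 # labels t0)" "tedges r0 t0 \<in> copies H"
    using assms(1) by (auto simp: shapes_def)
  have "t \<noteq> LL" using t0(1,2) by (cases t; cases t0) auto
  obtain g where g: "bij_betw g (insert r (set (labels t))) (insert r0 (set (labels t0)))"
    "tedges r0 t0 = (`) g ` tedges r t"
    using same_shape_iso[OF t0(1) assms(2) t0(3)] by blast
  show ?thesis
    by (rule copies_bij[OF _ g(2) t0(4)]) (use g(1) t0(2) \<open>t \<noteq> LL\<close> in \<open>simp add: tedges_Union\<close>)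
qed

text \<open>An ordering of \<open>H\<close> has one inner node for every vertex other than the root,
  so its height is at most the number of vertices of \<open>H\<close>.\<close>

lemma finite_shapes:
  assumes "connected_graph H"
  shows "finite (shapes H)"
proof (rule finite_subset)
  show "shapes H \<subseteq> {t. bheight t \<le> card (verts H)}"
  proof
    fix h assume "h \<in> shapes H"
    then obtain t :: "nat ltree" and r where t: "h = shape t" "t \<noteq> LL" "distinct (r # labels t)"
      "tedges r t \<in> copies H" by (auto simp: shapes_def)
    obtain f where "bij_betw f (\<Union>(tedges r t)) (verts H)"
      using t(4) by (auto simp: copies_def graph_iso_def edge_induced_def)
    then have "card (verts H) = card (set (r # labels t))"
      using t(2) by (metis bij_betw_same_card list.simps(15) tedges_Union)
    also have "\<dots> = Suc (size h)"
      using t(1,3) by (metis distinct_card length_Cons length_labels)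
    finally show "h \<in> {t. bheight t \<le> card (verts H)}"
      using bheight_le_size[of h] by simp
  qed
qed (use card_trees_bheight in blast)

section \<open>Occurrences and copies correspond\<close>

fun restr :: "'v \<Rightarrow> 'v set set \<Rightarrow> 'v ltree \<Rightarrow> 'v ltree" where
  "restr r F LL = LL"
| "restr r F (LN v c s) = (if {r, v} \<in> F then LN v (restr v F c) (restr r F s) else restr r F s)"

lemma labels_restr: "set (labels (restr r F t)) \<subseteq> set (labels t)"
  by (induction r F t rule: restr.induct) auto

lemma distinct_restr: "distinct (labels t) \<Longrightarrow> distinct (labels (restr r F t))"
proof (induction r F t rule: restr.induct)
  case (2 r F v c s)
  then show ?case using labels_restr[of v F c] labels_restr[of r F s] by auto
qed simp

lemma tedges_restr: "tedges r (restr r F t) \<subseteq> F"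
  by (induction r F t rule: restr.induct) auto

text \<open>As labels are distinct, \<open>a\<close> determines in which subtree the edge lies; the
  recursion has retained \<open>a\<close> there and therefore meets the edge.\<close>

lemma restr_closed:
  assumes "distinct (r # labels t)" "{a, b} \<in> F" "{a, b} \<in> tedges r t"
    "a \<in> insert r (set (labels (restr r F t)))"
  shows "{a, b} \<in> tedges r (restr r F t)"
  using assms
proof (induction r F t rule: restr.induct)
  case (2 r F v c s)
  consider "{a, b} = {r, v}" | "{a, b} \<in> tedges v c" | "{a, b} \<in> tedges r s" "{a, b} \<noteq> {r, v}"
    using "2.prems"(3) by auto
  then show ?case
  proof cases
    case 1
    then show ?thesis using "2.prems"(2) by auto
  next
    case 2
    then have a: "a \<in> insert v (set (labels c))" using tedges_subset[of "{a, b}" v c] by auto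
    then have "a \<notin> insert r (set (labels (restr r F s)))"
      using "2.prems"(1) labels_restr[of r F s] by auto
    then have "{r, v} \<in> F" "a \<in> insert v (set (labels (restr v F c)))"
      using "2.prems"(4) by (auto split: if_splits)
    then show ?thesis using "2.IH"(1) "2.prems"(1,2) 2 by simp
  next
    case 3
    then have "a \<in> insert r (set (labels s))" using tedges_subset[of "{a, b}" r s] by auto
    then have "a \<notin> insert v (set (labels c))" using "2.prems"(1) by auto
    then have "a \<in> insert r (set (labels (restr r F s)))"
      using "2.prems"(4) labels_restr[of v F c] by (auto split: if_splits)
    then show ?thesis using "2.IH"(2,3) "2.prems"(1,2) 3 by simp
  qed
qed simp

text \<open>\<open>restr\<close> cuts off everything below an edge outside \<open>F\<close>, so it
  retains the component of \<open>F\<close> at the root, which is all of \<open>F\<close> if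
  \<open>F\<close> is connected and contains the root.\<close>

lemma tedges_restr_connected:
  assumes "distinct (r # labels t)" "F \<subseteq> tedges r t" "r \<in> \<Union>F"
    and conn: "\<And>u v. u \<in> \<Union>F \<Longrightarrow> v \<in> \<Union>F \<Longrightarrow> \<exists>i. (u, v) \<in> adj F ^^ i"
  shows "tedges r (restr r F t) = F"
proof
  show "F \<subseteq> tedges r (restr r F t)"
  proof
    have reach: "a \<in> insert r (set (labels (restr r F t)))" if "(r, a) \<in> adj F ^^ i" for a i
      using that
    proof (induction i arbitrary: a)
      case (Suc i)
      then obtain b where b: "(r, b) \<in> adj F ^^ i" "{b, a} \<in> F" by (auto simp: adj_def)
      then have "{b, a} \<in> tedges r (restr r F t)"
        using restr_closed[OF assms(1)] assms(2) Suc.IH by blast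
      then show ?case using tedges_subset by fastforce
    qed simp
    fix e assume e: "e \<in> F"
    then have "e \<in> tedges r t" using assms(2) by blast
    then have "card e = 2" using tedges_card2[OF _ assms(1)] by simp
    then obtain a b where ab: "e = {a, b}" by (meson card_2_iff)
    then have "a \<in> insert r (set (labels (restr r F t)))"
      using reach conn[OF assms(3), of a] e by blast
    then show "e \<in> tedges r (restr r F t)"
      using restr_closed[OF assms(1)] assms(2) e ab by blast
  qed
qed (rule tedges_restr)

lemma emb_skip: "emb h r \<Longrightarrow> emb h (Node x r)"
  by (cases h) auto

lemma emb_restr:
  "F \<subseteq> M \<Longrightarrow> emb (shape (restr r F t)) (pos r t (mark M B))"
  by (induction r F t rule: restr.induct) (auto intro: emb_skip)

lemma emb_imp_subtree:
  assumes "emb h (pos r t (mark M B))" "distinct (labels t)"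
  shows "\<exists>t'. shape t' = h \<and> set (labels t') \<subseteq> set (labels t) \<and> distinct (labels t') \<and>
    tedges r t' \<subseteq> tedges r t \<inter> M"
  using assms
proof (induction t arbitrary: h r)
  case LL
  then have "h = Leaf" by (cases h) auto
  then show ?case by (intro exI[of _ LL]) simp
next
  case (LN v c s)
  show ?case
  proof (cases "emb h (pos r s (mark M B))")
    case True
    moreover have "distinct (labels s)" using LN.prems(2) by simp
    ultimately obtain t' where "shape t' = h" "set (labels t') \<subseteq> set (labels s)" "distinct (labels t')"
      "tedges r t' \<subseteq> tedges r s \<inter> M" using LN.IH(2) by blast
    then show ?thesis by (intro exI[of _ t']) auto
  next
    case False
    then obtain a b where ab: "h = Node a b" by (cases h) auto
    then have h: "h = Node a b" "{r, v} \<in> M" "emb a (pos v c (mark M B))"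
      "emb b (pos r s (mark M B))"
      using LN.prems(1) False by auto
    obtain t1 where t1: "shape t1 = a" "set (labels t1) \<subseteq> set (labels c)" "distinct (labels t1)"
      "tedges v t1 \<subseteq> tedges v c \<inter> M" using LN.IH(1)[OF h(3)] LN.prems(2) by auto
    obtain t2 where t2: "shape t2 = b" "set (labels t2) \<subseteq> set (labels s)" "distinct (labels t2)"
      "tedges r t2 \<subseteq> tedges r s \<inter> M" using LN.IH(2)[OF h(4)] LN.prems(2) by auto
    show ?thesis
      using t1 t2 h(1,2) LN.prems(2) by (intro exI[of _ "LN v t1 t2"]) auto
  qed
qed

lemma occ_imp_copy:
  assumes "occ h (pos r t (mark M B))" "h \<in> shapes H" "distinct (r # labels t)"
  shows "\<exists>F\<in>copies H. F \<subseteq> tedges r t \<inter> M"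
  using assms(1,3)
proof (induction t arbitrary: r)
  case (LN v c s)
  consider "emb h (pos r (LN v c s) (mark M B))" | "occ h (pos v c (mark M B))"
    | "occ h (pos r s (mark M B))" using LN.prems(1) by auto
  then show ?case
  proof cases
    case 1
    obtain t' where t': "shape t' = h" "set (labels t') \<subseteq> set (labels (LN v c s))"
      "distinct (labels t')" "tedges r t' \<subseteq> tedges r (LN v c s) \<inter> M"
      using emb_imp_subtree[OF 1] LN.prems(2) by auto
    have "tedges r t' \<in> copies H"
      by (rule copies_of_shape) (use t' assms(2) LN.prems(2) in auto)
    then show ?thesis using t'(4) by blast
  next
    case 2
    then obtain F where "F \<in> copies H" "F \<subseteq> tedges v c \<inter> M"
      using LN.IH(1)[OF 2] LN.prems(2) by auto
    then show ?thesis by (intro bexI[of _ F]) auto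
  next
    case 3
    then obtain F where "F \<in> copies H" "F \<subseteq> tedges r s \<inter> M"
      using LN.IH(2)[OF 3] LN.prems(2) by auto
    then show ?thesis by (intro bexI[of _ F]) auto
  qed
qed simp

text \<open>A copy through the root is an ordered subtree at the root, and its own shape is the
  required pattern. A copy that avoids the root is connected, so it lies entirely within the branch
  below \<open>v\<close> or entirely within the remaining branches.\<close>

lemma copy_imp_occ:
  assumes H: "connected_graph H" and F: "F \<in> copies H" and "F \<subseteq> tedges r t" "F \<subseteq> M"
    "distinct (r # labels t)"
  shows "\<exists>h\<in>shapes H. occ h (pos r t (mark M B))"
  using assms(3-)
proof (induction t arbitrary: r)
  case LL
  then show ?case using copy_nonempty[OF H F] by simp
next
  case (LN v c s)
  let ?t = "LN v c s"
  have conn: "\<exists>i. (u, v) \<in> adj F ^^ i" if "u \<in> \<Union>F" "v \<in> \<Union>F" for u v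
    using copy_connected[OF H F that] by blast
  have e2: "\<exists>a b. e = {a, b}" if "e \<in> F" for e
    using tedges_card2[of e r ?t] that LN.prems(1,3) by (meson card_2_iff subsetD)
  show ?case
  proof (cases "r \<in> \<Union>F")
    case True
    have eq: "tedges r (restr r F ?t) = F"
      by (rule tedges_restr_connected[OF LN.prems(3,1) True conn])
    have "shape (restr r F ?t) \<in> shapes H"
    proof (rule shape_in_shapes)
      show "restr r F ?t \<noteq> LL" using eq True by fastforce
      show "distinct (r # labels (restr r F ?t))"
        using LN.prems(3) distinct_restr[of ?t r F] labels_restr[of r F ?t] by auto
      show "tedges r (restr r F ?t) \<in> copies H" using eq F by simp
    qed
    moreover have "emb (shape (restr r F ?t)) (pos r ?t (mark M B))"
      by (rule emb_restr[OF LN.prems(2)])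
    ultimately show ?thesis by (intro bexI[of _ "shape (restr r F ?t)"]) simp_all
  next
    case False
    then have split: "F \<subseteq> tedges v c \<union> tedges r s" using LN.prems(1) by auto
    show ?thesis
    proof (cases "F \<subseteq> tedges r s")
      case True
      then obtain h where "h \<in> shapes H" "occ h (pos r s (mark M B))"
        using LN.IH(2)[OF True] LN.prems by auto
      then show ?thesis by (intro bexI[of _ h]) simp_all
    next
      case notS: False
      then obtain e where e: "e \<in> F" "e \<in> tedges v c" using split by blast
      then obtain a b where ab: "e = {a, b}" using e2 by blast
      let ?V = "insert v (set (labels c))"
      have a: "a \<in> \<Union>F" "a \<in> ?V" using e ab tedges_subset[of e v c] by auto
      \<comment> \<open>Labels of the branch do not occur elsewhere, so no edge of \<open>F\<close>
        leaves the branch.\<close>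
      have stay: "{x, y} \<in> tedges v c" if "{x, y} \<in> F" "x \<in> ?V" for x y
        using split that tedges_subset[of "{x, y}" r s] LN.prems(3) by auto
      have "x \<in> ?V" if "(a, x) \<in> adj F ^^ i" for x i
        using that
      proof (induction i arbitrary: x)
        case (Suc i)
        then obtain z where "(a, z) \<in> adj F ^^ i" "{z, x} \<in> F" by (auto simp: adj_def)
        then show ?case using stay[of z x] Suc.IH[of z] tedges_subset[of "{z, x}" v c] by auto
      qed (use a in simp)
      then have V: "x \<in> ?V" if "x \<in> \<Union>F" for x using conn[OF a(1) that] by blast
      have Fc: "F \<subseteq> tedges v c"
      proof
        fix e' assume e': "e' \<in> F"
        then obtain x y where "e' = {x, y}" using e2 by blast
        then show "e' \<in> tedges v c" using stay V e' by blast
      qed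
      obtain h where "h \<in> shapes H" "occ h (pos v c (mark M B))"
        using LN.IH(1)[OF Fc] LN.prems by auto
      then show ?thesis by (intro bexI[of _ h]) simp_all
    qed
  qed
qed

section \<open>Listing moves and searching the game tree\<close>

fun moves :: "bintree \<Rightarrow> bintree \<Rightarrow> bintree list" where
  "moves l Leaf = []"
| "moves l (Node x r) = (if left x = Leaf then [Node (Node l (right x)) r] else []) @
     map (\<lambda>c. Node (Node (left x) c) r) (moves l (right x)) @ map (Node x) (moves l r)"

lemma pos_cong: "(\<And>e. e \<in> tedges r t \<Longrightarrow> g e = g' e) \<Longrightarrow> pos r t g = pos r t g'"
  by (induction r t g rule: pos.induct) auto

text \<open>The edge to the first child, the edges below it and the remaining edges are pairwise
  disjoint, so marking an edge changes exactly one of the three components of the position.\<close>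

lemma set_moves_pos:
  assumes "distinct (r # labels t)"
  shows "set (moves l (pos r t g)) = (\<lambda>e. pos r t (g(e := l))) ` {e \<in> tedges r t. g e = Leaf}"
  using assms
proof (induction t arbitrary: r)
  case (LN v c s)
  let ?P = "\<lambda>e. pos r (LN v c s) (g(e := l))"
  have "{r, v} \<notin> tedges v c" "{r, v} \<notin> tedges r s"
    using LN.prems tedges_subset[of "{r, v}" v c] tedges_subset[of "{r, v}" r s] by auto
  moreover have "tedges v c \<inter> tedges r s = {}"
  proof -
    have "e \<notin> tedges r s" if "e \<in> tedges v c" for e
      using LN.prems tedges_subset[OF that] tedges_nonroot[of e r s] by auto
    then show ?thesis by blast
  qed
  ultimately have ve: "{r, v} \<notin> tedges v c" "{r, v} \<notin> tedges r s" "tedges v c \<inter> tedges r s = {}" .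
  have 1: "?P {r, v} = Node (Node l (pos v c g)) (pos r s g)"
    using ve by (auto intro!: pos_cong)
  have 2: "?P e = Node (Node (g {r, v}) (pos v c (g(e := l)))) (pos r s g)" if "e \<in> tedges v c" for e
  proof -
    have "pos r s (g(e := l)) = pos r s g" by (rule pos_cong) (use ve that in auto)
    then show ?thesis using ve that by auto
  qed
  have 3: "?P e = Node (Node (g {r, v}) (pos v c g)) (pos r s (g(e := l)))" if "e \<in> tedges r s" for e
  proof -
    have "pos v c (g(e := l)) = pos v c g" by (rule pos_cong) (use ve that in auto)
    then show ?thesis using ve that by auto
  qed
  have "{e \<in> tedges r (LN v c s). g e = Leaf} = (if g {r, v} = Leaf then {{r, v}} else {}) \<union>
      ({e \<in> tedges v c. g e = Leaf} \<union> {e \<in> tedges r s. g e = Leaf})" by auto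
  then have "?P ` {e \<in> tedges r (LN v c s). g e = Leaf} =
      ?P ` (if g {r, v} = Leaf then {{r, v}} else {}) \<union>
      (?P ` {e \<in> tedges v c. g e = Leaf} \<union> ?P ` {e \<in> tedges r s. g e = Leaf})"
    by (simp only: image_Un)
  also have "?P ` (if g {r, v} = Leaf then {{r, v}} else {}) =
      (if g {r, v} = Leaf then {Node (Node l (pos v c g)) (pos r s g)} else {})"
    using 1 by simp
  also have "?P ` {e \<in> tedges v c. g e = Leaf} =
      (\<lambda>p. Node (Node (g {r, v}) p) (pos r s g)) ` set (moves l (pos v c g))"
    using LN.prems by (subst image_cong[OF refl 2]) (simp_all add: LN.IH(1) image_image fun_upd_def)
  also have "?P ` {e \<in> tedges r s. g e = Leaf} =
      Node (Node (g {r, v}) (pos v c g)) ` set (moves l (pos r s g))"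
    using LN.prems by (subst image_cong[OF refl 3]) (simp_all add: LN.IH(2) image_image fun_upd_def)
  finally show ?case by simp
qed simp

text \<open>The head \<open>p'\<close> of the list of replies is Breaker's pass.\<close>

fun bwin :: "bintree set \<Rightarrow> nat \<Rightarrow> bintree \<Rightarrow> bool" where
  "bwin S 0 p \<longleftrightarrow> (\<exists>h\<in>S. occ h p)"
| "bwin S (Suc j) p \<longleftrightarrow> (\<exists>h\<in>S. occ h p) \<or>
    (\<exists>p'\<in>set (moves maker_mark p). \<forall>p''\<in>set (p' # moves breaker_mark p'). bwin S j p'')"

theorem bwin_iff_win:
  assumes H: "connected_graph H" and d: "distinct (r # labels t)"
  shows "bwin (shapes H) k (pos r t (mark M B)) \<longleftrightarrow> win (tedges r t) (copies H) k M B"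
proof (induction k arbitrary: M B)
  have occ: "(\<exists>h\<in>shapes H. occ h (pos r t (mark M B))) \<longleftrightarrow> (\<exists>F\<in>copies H. F \<subseteq> tedges r t \<inter> M)" for M B
    using occ_imp_copy[OF _ _ d] copy_imp_occ[OF H _ _ _ d] by (metis le_inf_iff)
  {
    case 0
    show ?case using occ by simp
  next
    case (Suc k)
    have m: "set (moves maker_mark (pos r t (mark M B))) =
        (\<lambda>x. pos r t (mark (insert x M) B)) ` (tedges r t - M - B)" for M B
      unfolding set_moves_pos[OF d] mark_upd(1) by (rule image_cong) auto
    have b: "set (moves breaker_mark (pos r t (mark M B))) =
        (\<lambda>x. pos r t (mark M (insert x B))) ` (tedges r t - M - B)" for M B
      unfolding set_moves_pos[OF d] by (rule image_cong) (auto simp: mark_upd(2))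
    show ?case
      unfolding bwin.simps(2) win.simps(2) occ by (simp add: m b Suc.IH)
  }
qed

section \<open>Non-backtracking walks and the balls of a tree\<close>

fun nbw :: "'v set set \<Rightarrow> 'v list \<Rightarrow> bool" where
  "nbw E (x # y # z # xs) \<longleftrightarrow> {x, y} \<in> E \<and> x \<noteq> z \<and> nbw E (y # z # xs)"
| "nbw E [x, y] \<longleftrightarrow> {x, y} \<in> E"
| "nbw E _ \<longleftrightarrow> True"

lemma nbw_Cons: "nbw E (x # xs) \<Longrightarrow> nbw E xs"
  by (cases xs; cases "tl xs") auto

lemma nbw_prefix: "nbw E (xs @ ys) \<Longrightarrow> nbw E xs"
proof (induction E xs rule: nbw.induct)
  case (2 E x y)
  then show ?case by (cases ys) auto
qed auto

text \<open>With an overlap of two vertices every triple of consecutive vertices lies in one of the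
  two walks, so no backtracking arises at the seam.\<close>

lemma nbw_append: "nbw E (xs @ [a, b]) \<Longrightarrow> nbw E (a # b # ys) \<Longrightarrow> nbw E (xs @ a # b # ys)"
  by (induction E xs rule: nbw.induct) auto

lemma nbw_rev: "nbw E xs \<Longrightarrow> nbw E (rev xs)"
proof (induction E xs rule: nbw.induct)
  case (1 E x y z xs)
  then have "nbw E (rev xs @ [z, y])" by simp
  moreover have "{y, z} \<in> E" using 1 by (cases xs) auto
  then have "nbw E [z, y, x]" using 1 by (auto simp: insert_commute)
  ultimately show ?case using nbw_append by fastforce
qed (auto simp: insert_commute)

lemma nbw_nth: "nbw E xs \<Longrightarrow> Suc i < length xs \<Longrightarrow> {xs ! i, xs ! Suc i} \<in> E"
proof (induction E xs arbitrary: i rule: nbw.induct)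
  case (1 E x y z xs)
  then show ?case by (cases i) auto
next
  case (2 E x y)
  then show ?case by (cases i) auto
qed auto

text \<open>In a shortest counterexample both the walk without its last vertex and the walk without
  its first vertex are distinct. Hence only the two ends coincide, and the walk closes up to a
  cycle; shorter closures would be a loop or an immediate return.\<close>

lemma nbw_distinct:
  assumes "\<And>e. e \<in> E \<Longrightarrow> card e = 2" "\<nexists>c. cycle_in (V, E) c" "nbw E xs"
  shows "distinct xs"
  using assms(3)
proof (induction "length xs" arbitrary: xs rule: less_induct)
  case less
  show ?case
  proof (rule ccontr)
    assume nd: "\<not> distinct xs"
    then obtain x xs' where xs': "xs = x # xs'" by (cases xs) auto
    with nd have "xs' \<noteq> []" by auto
    then obtain ys z where ys: "xs = x # ys @ [z]" using xs' by (metis append_butlast_last_id)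
    have d1: "distinct (x # ys)"
      using less.hyps[of "x # ys"] less.prems nbw_prefix[of E "x # ys" "[z]"] ys by simp
    have "distinct (ys @ [z])"
      using less.hyps[of "ys @ [z]"] less.prems nbw_Cons[of E x "ys @ [z]"] ys by simp
    with d1 nd ys have zx: "z = x" by auto
    have "length ys \<ge> 2"
    proof (rule ccontr)
      assume "\<not> 2 \<le> length ys"
      then consider "ys = []" | y where "ys = [y]"
        by (cases ys; cases "tl ys") auto
      then show False
        using less.prems ys zx assms(1)[of "{x}"] by cases auto
    qed
    have "cycle_in (V, E) (x # ys)"
      unfolding cycle_in_def
    proof (intro conjI allI impI)
      show "3 \<le> length (x # ys)" using \<open>length ys \<ge> 2\<close> by simp
      show "distinct (x # ys)" by (rule d1)
      fix i assume i: "i < length (x # ys)"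
      have e: "{xs ! i, xs ! Suc i} \<in> E" using nbw_nth[OF less.prems, of i] i ys by simp
      have "xs = (x # ys) @ [x]" using ys zx by simp
      then have "xs ! i = (x # ys) ! i" "xs ! Suc i = (x # ys) ! (Suc i mod length (x # ys))"
        using i by (auto simp only: nth_append) (auto simp: less_Suc_eq)
      then show "{(x # ys) ! i, (x # ys) ! (Suc i mod length (x # ys))} \<in> edges (V, E)"
        using e by simp
    qed
    then show False using assms(2) by blast
  qed
qed

text \<open>The reversed first walk followed by the second does not backtrack at \<open>u\<close>,
  because \<open>x \<noteq> y\<close>. So it repeats no vertex.\<close>

lemma nbw_endpoints:
  assumes "\<And>e. e \<in> E \<Longrightarrow> card e = 2" "\<nexists>c. cycle_in (V, E) c"
    and "nbw E (u # x # xs)" "nbw E (u # y # ys)" "x \<noteq> y"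
  shows "last (x # xs) \<noteq> last (y # ys)"
proof
  assume eq: "last (x # xs) = last (y # ys)"
  have "nbw E (rev xs @ [x, u])" using nbw_rev[OF assms(3)] by simp
  moreover have "nbw E (x # u # y # ys)"
    using assms(3-5) nbw_prefix[of E "[u, x]" xs] by (simp add: insert_commute)
  ultimately have "nbw E (rev (x # xs) @ u # y # ys)" using nbw_append by fastforce
  then have "distinct (rev (x # xs) @ u # y # ys)"
    by (intro nbw_distinct[where E = E and V = V]) (use assms(1,2) in blast)+
  moreover have "last (x # xs) \<in> set (x # xs)" "last (y # ys) \<in> set (y # ys)" by simp_all
  ultimately show False using eq by (metis UnI2 disjoint_iff distinct_append list.set_intros(2) set_rev)
qed

section \<open>Unfolding a tree around a centre\<close>

text \<open>
  The ball of radius \<open>d\<close> around \<open>u\<close> without the branch towards \<open>p\<close>; \<open>E\<close> lists the edges of the whole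
  tree and \<open>L\<close> those that remain to be scanned for neighbours of \<open>u\<close>.  At the centre of the ball,
  \<open>p\<close> is a number that is not a vertex.
\<close>

fun ball_tree :: "nat \<Rightarrow> 'v \<Rightarrow> 'v \<Rightarrow> ('v \<times> 'v) list \<Rightarrow> ('v \<times> 'v) list \<Rightarrow> 'v ltree" where
  "ball_tree 0 u p E L = LL"
| "ball_tree (Suc d) u p E [] = LL"
| "ball_tree (Suc d) u p E ((a, b) # L) =
    (if a = u then
       if b = p then ball_tree (Suc d) u p E L
       else LN b (ball_tree d b u E E) (ball_tree (Suc d) u p E L)
     else if b = u then
       if a = p then ball_tree (Suc d) u p E L
       else LN a (ball_tree d a u E E) (ball_tree (Suc d) u p E L)
     else ball_tree (Suc d) u p E L)"

definition edge_set :: "('v \<times> 'v) list \<Rightarrow> 'v set set" where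
  "edge_set L = {{u, v} | u v. (u, v) \<in> set L}"

lemma edge_set_simps [simp]:
  "edge_set [] = {}" "edge_set ((a, b) # L) = insert {a, b} (edge_set L)"
  by (auto simp: edge_set_def)

text \<open>Edges come in either orientation; this elimination rule reduces the branching of
  \<open>ball_tree\<close> to the question whether the edge yields a child.\<close>

lemma ball_tree_ConsE:
  assumes "card {a, b} = 2"
  obtains (skip) "ball_tree (Suc d) u p E ((a, b) # L) = ball_tree (Suc d) u p E L"
      "\<And>x. {u, x} = {a, b} \<Longrightarrow> x = p"
  | (child) x where "x \<noteq> p" "{u, x} = {a, b}"
      "ball_tree (Suc d) u p E ((a, b) # L) =
        LN x (ball_tree d x u E E) (ball_tree (Suc d) u p E L)"
proof -
  have ab: "a \<noteq> b" using assms by auto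
  then consider "a = u" "b = p" | "a = u" "b \<noteq> p" | "b = u" "a \<noteq> u" "a = p" | "b = u" "a \<noteq> u" "a \<noteq> p"
    | "a \<noteq> u" "b \<noteq> u" by blast
  then show ?thesis
  proof cases
    case 1
    with ab have "ball_tree (Suc d) u p E ((a, b) # L) = ball_tree (Suc d) u p E L"
      "\<And>x. {u, x} = {a, b} \<Longrightarrow> x = p" by (auto simp: doubleton_eq_iff)
    then show ?thesis by (rule skip)
  next
    case 2
    then show ?thesis by (intro child[of b]) auto
  next
    case 3
    then have "ball_tree (Suc d) u p E ((a, b) # L) = ball_tree (Suc d) u p E L"
      "\<And>x. {u, x} = {a, b} \<Longrightarrow> x = p" by (auto simp: doubleton_eq_iff)
    then show ?thesis by (rule skip)
  next
    case 4
    then show ?thesis by (intro child[of a]) auto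
  next
    case 5
    then have "ball_tree (Suc d) u p E ((a, b) # L) = ball_tree (Suc d) u p E L"
      "\<And>x. {u, x} = {a, b} \<Longrightarrow> x = p" by (auto simp: doubleton_eq_iff)
    then show ?thesis by (rule skip)
  qed
qed

text \<open>The neighbour forbidden at a child is its parent, so prefixing the parent to a walk from
  the child creates no backtracking. Recording that the initial edge lies in \<open>L\<close>
  separates children obtained from different edges.\<close>

lemma ball_tree_walk:
  assumes card2: "\<And>e. e \<in> edge_set E \<Longrightarrow> card e = 2"
  shows "v \<in> set (labels (ball_tree d u p E L)) \<Longrightarrow> edge_set L \<subseteq> edge_set E \<Longrightarrow>
    \<exists>x xs. nbw (edge_set E) (u # x # xs) \<and> last (x # xs) = v \<and> x \<noteq> p \<and> {u, x} \<in> edge_set L"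
proof (induction d arbitrary: u p L)
  case (Suc d)
  from Suc.prems show ?case
  proof (induction L)
    case (Cons e L)
    obtain a b where e: "e = (a, b)" by fastforce
    have sub: "{a, b} \<in> edge_set E" "edge_set L \<subseteq> edge_set E" using Cons.prems(2) e by auto
    have rest: ?case if v: "v \<in> set (labels (ball_tree (Suc d) u p E L))"
    proof -
      obtain x xs where "nbw (edge_set E) (u # x # xs)" "last (x # xs) = v" "x \<noteq> p" "{u, x} \<in> edge_set L"
        using Cons.IH[OF v sub(2)] by blast
      then show ?thesis unfolding e by (intro exI[of _ x] exI[of _ xs]) simp
    qed
    from card2[OF sub(1)] show ?case
    proof (cases rule: ball_tree_ConsE[where d = d and u = u and p = p and E = E and L = L])
      case skip
      then show ?thesis using rest Cons.prems(1) e by simp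
    next
      case (child x)
      consider "v = x" | "v \<in> set (labels (ball_tree d x u E E))"
        | "v \<in> set (labels (ball_tree (Suc d) u p E L))"
        using Cons.prems(1) e child(3) by auto
      then show ?thesis
      proof cases
        case 1
        then show ?thesis using child sub e by (intro exI[of _ x] exI[of _ "[]"]) auto
      next
        case 2
        then obtain y ys where "nbw (edge_set E) (x # y # ys)" "last (y # ys) = v" "y \<noteq> u"
          using Suc.IH by blast
        then show ?thesis using child sub e by (intro exI[of _ x] exI[of _ "y # ys"]) auto
      qed (rule rest)
    qed
  qed simp
qed simp

text \<open>A label common to two sibling branches would be the end of two non-backtracking walks
  with different initial steps. They differ because every edge is listed only once.\<close>

lemma distinct_ball_tree:
  assumes card2: "\<And>e. e \<in> edge_set E \<Longrightarrow> card e = 2"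
    and acyclic: "\<nexists>c. cycle_in (V, edge_set E) c"
    and dist: "distinct (map (\<lambda>(u, v). {u, v}) E)"
  shows "distinct (map (\<lambda>(u, v). {u, v}) L) \<Longrightarrow> edge_set L \<subseteq> edge_set E \<Longrightarrow>
    distinct (u # labels (ball_tree d u p E L))"
proof (induction d arbitrary: u p L)
  case (Suc d)
  from Suc.prems show ?case
  proof (induction L)
    case (Cons e L)
    obtain a b where e: "e = (a, b)" by fastforce
    have sub: "{a, b} \<in> edge_set E" "edge_set L \<subseteq> edge_set E" using Cons.prems(2) e by auto
    have IH: "distinct (u # labels (ball_tree (Suc d) u p E L))" using Cons sub by simp
    have notin: "{a, b} \<notin> edge_set L" using Cons.prems(1) e by (auto simp: edge_set_def)
    from card2[OF sub(1)] show ?case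
    proof (cases rule: ball_tree_ConsE[where d = d and u = u and p = p and E = E and L = L])
      case skip
      then show ?thesis using IH e by simp
    next
      case (child x)
      let ?c = "ball_tree d x u E E" and ?s = "ball_tree (Suc d) u p E L"
      have c: "distinct (x # labels ?c)" using Suc.IH[OF dist] by simp
      have ux: "{u, x} \<in> edge_set E" using child(2) sub(1) by simp
      then have "u \<noteq> x" using card2 by fastforce
      have walk: "\<exists>xs. nbw (edge_set E) (u # x # xs) \<and> last (x # xs) = v"
        if v: "v \<in> set (x # labels ?c)" for v
      proof (cases "v = x")
        case True
        then show ?thesis using ux by (intro exI[of _ "[]"]) simp
      next
        case False
        then have "v \<in> set (labels ?c)" using v by simp
        from ball_tree_walk[OF card2 this subset_refl] obtain y ys
          where "nbw (edge_set E) (x # y # ys)" "last (y # ys) = v" "y \<noteq> u" by blast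
        then show ?thesis using ux by (intro exI[of _ "y # ys"]) auto
      qed
      have "u \<notin> set (labels ?c)"
      proof
        assume "u \<in> set (labels ?c)"
        then obtain xs where xs: "nbw (edge_set E) (u # x # xs)" "last (x # xs) = u"
          using walk by (metis list.set_intros(2))
        then have "distinct (u # x # xs)"
          by (intro nbw_distinct[where E = "edge_set E" and V = V]) (use card2 acyclic in blast)+
        then show False using xs(2) by (metis distinct.simps(2) last_in_set list.discI)
      qed
      moreover have "set (x # labels ?c) \<inter> set (labels ?s) = {}"
      proof (rule ccontr)
        assume "set (x # labels ?c) \<inter> set (labels ?s) \<noteq> {}"
        then obtain v where v: "v \<in> set (x # labels ?c)" "v \<in> set (labels ?s)" by blast
        obtain xs where xs: "nbw (edge_set E) (u # x # xs)" "last (x # xs) = v"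
          using walk[OF v(1)] by blast
        from ball_tree_walk[OF card2 v(2) sub(2)] obtain y ys
          where ys: "nbw (edge_set E) (u # y # ys)" "last (y # ys) = v" "{u, y} \<in> edge_set L"
          by blast
        have "x \<noteq> y" using ys(3) notin child(2) by auto
        then show False using nbw_endpoints[OF card2 acyclic xs(1) ys(1)] xs(2) ys(2) by simp
      qed
      ultimately show ?thesis using c IH \<open>u \<noteq> x\<close> child(3) e by auto
    qed
  qed simp
qed simp

lemma tedges_ball_tree:
  assumes card2: "\<And>e. e \<in> edge_set E \<Longrightarrow> card e = 2"
  shows "edge_set L \<subseteq> edge_set E \<Longrightarrow> e \<in> tedges u (ball_tree (Suc d) u p E L) \<longleftrightarrow>
    (\<exists>x. {u, x} \<in> edge_set L \<and> x \<noteq> p \<and> (e = {u, x} \<or> e \<in> tedges x (ball_tree d x u E E)))"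
proof (induction L)
  case (Cons e' L)
  obtain a b where e': "e' = (a, b)" by fastforce
  have sub: "{a, b} \<in> edge_set E" "edge_set L \<subseteq> edge_set E" using Cons.prems e' by auto
  have IH: "e \<in> tedges u (ball_tree (Suc d) u p E L) \<longleftrightarrow>
    (\<exists>x. {u, x} \<in> edge_set L \<and> x \<noteq> p \<and> (e = {u, x} \<or> e \<in> tedges x (ball_tree d x u E E)))"
    using Cons.IH sub by blast
  from card2[OF sub(1)] show ?case
  proof (cases rule: ball_tree_ConsE[where d = d and u = u and p = p and E = E and L = L])
    case skip
    then show ?thesis unfolding e' skip(1) IH by auto
  next
    case (child x)
    have "y = x" if "{u, y} = {a, b}" for y
      using that child(2) by (auto simp: doubleton_eq_iff)
    then have "(\<exists>y. {u, y} \<in> edge_set ((a, b) # L) \<and> y \<noteq> p \<and> P y) \<longleftrightarrow>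
        P x \<or> (\<exists>y. {u, y} \<in> edge_set L \<and> y \<noteq> p \<and> P y)" for P
      unfolding edge_set_simps using child(1,2) by blast
    note cons = this
    show ?thesis
      unfolding e' child(3) tedges.simps insert_iff Un_iff IH cons disj_assoc ..
  qed
qed simp

text \<open>The unfolding follows only walks that never turn back, whereas \<open>edge_ball\<close>
  admits all walks. A walk that enters a child and returns to \<open>v\<close> is shortened by
  strong induction; a walk that leaves through \<open>p\<close> leads to the second
  alternative.\<close>

lemma walk_in_ball_tree:
  assumes card2: "\<And>e. e \<in> edge_set E \<Longrightarrow> card e = 2"
  shows "(v, a) \<in> adj (edge_set E) ^^ i \<Longrightarrow> {a, b} \<in> edge_set E \<Longrightarrow> i < d \<Longrightarrow>
    {a, b} \<in> tedges v (ball_tree d v p E E) \<or>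
    {v, p} \<in> edge_set E \<and> ({a, b} = {v, p} \<or> (\<exists>j<i. (p, a) \<in> adj (edge_set E) ^^ j))"
proof (induction i arbitrary: v p d rule: less_induct)
  case (less i)
  obtain d' where d: "d = Suc d'" using less.prems(3) by (cases d) auto
  have T: "e \<in> tedges v (ball_tree d v p E E) \<longleftrightarrow>
    (\<exists>x. {v, x} \<in> edge_set E \<and> x \<noteq> p \<and> (e = {v, x} \<or> e \<in> tedges x (ball_tree d' x v E E)))" for e
    unfolding d using tedges_ball_tree[OF card2] by blast
  show ?case
  proof (cases i)
    case 0
    then have "v = a" using less.prems by simp
    then show ?thesis using T less.prems(2) by blast
  next
    case (Suc i')
    then obtain x where x: "{v, x} \<in> edge_set E" "(x, a) \<in> adj (edge_set E) ^^ i'"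
      using less.prems(1) relpow_Suc_D2[of v a i'] by (auto simp: adj_def)
    show ?thesis
    proof (cases "x = p")
      case True
      then show ?thesis using x Suc by blast
    next
      case False
      have "{a, b} \<in> tedges x (ball_tree d' x v E E) \<or>
          {x, v} \<in> edge_set E \<and> ({a, b} = {x, v} \<or> (\<exists>j<i'. (v, a) \<in> adj (edge_set E) ^^ j))"
        using less.IH[of i' x d' v] x(2) less.prems(2,3) Suc d by simp
      then consider "{a, b} \<in> tedges v (ball_tree d v p E E)"
        | j where "j < i'" "(v, a) \<in> adj (edge_set E) ^^ j"
      proof -
        have "{a, b} \<in> tedges v (ball_tree d v p E E)"
          if "{a, b} \<in> tedges x (ball_tree d' x v E E) \<or> {a, b} = {x, v}"
        proof -
          have "{a, b} = {v, x} \<or> {a, b} \<in> tedges x (ball_tree d' x v E E)"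
            using that by (simp only: insert_commute[of x v] disj_commute)
          then show ?thesis using T x(1) False by blast
        qed
        then show thesis
          using \<open>{a, b} \<in> tedges x (ball_tree d' x v E E) \<or> _\<close> that by blast
      qed
      then show ?thesis
      proof cases
        case 2
        then have "{a, b} \<in> tedges v (ball_tree d v p E E) \<or>
          {v, p} \<in> edge_set E \<and> ({a, b} = {v, p} \<or> (\<exists>l<j. (p, a) \<in> adj (edge_set E) ^^ l))"
          using less.IH[of j v d p] less.prems(2,3) Suc by simp
        then show ?thesis using 2(1) Suc by (meson less_SucI less_trans)
      qed blast
    qed
  qed
qed

lemma tedges_ball_tree_subset:
  assumes card2: "\<And>e. e \<in> edge_set E \<Longrightarrow> card e = 2"
  shows "tedges u (ball_tree d u p E E) \<subseteq> edge_set E"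
proof (induction d arbitrary: u p)
  case (Suc d)
  show ?case
  proof
    fix e assume "e \<in> tedges u (ball_tree (Suc d) u p E E)"
    then obtain x where "{u, x} \<in> edge_set E" "e = {u, x} \<or> e \<in> tedges x (ball_tree d x u E E)"
      using tedges_ball_tree[OF card2 subset_refl] by blast
    then show "e \<in> edge_set E" using Suc.IH[of x u] by blast
  qed
qed simp

lemma edge_ball_subset_ball_tree:
  assumes card2: "\<And>e. e \<in> edge_set E \<Longrightarrow> card e = 2" and "{v, p} \<notin> edge_set E"
  shows "edge_ball (edge_set E) v d \<subseteq> tedges v (ball_tree d v p E E)"
proof
  fix e assume "e \<in> edge_ball (edge_set E) v d"
  then obtain a b i where "e = {a, b}" "i < d" "(v, a) \<in> adj (edge_set E) ^^ i" "{a, b} \<in> edge_set E"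
    by (auto simp: edge_ball_def)
  then show "e \<in> tedges v (ball_tree d v p E E)"
    using walk_in_ball_tree[OF card2, where d = d and p = p and v = v and a = a and i = i and b = b] assms(2) by blast
qed

lemma set_labels_ball_tree:
  assumes "\<And>e. e \<in> edge_set E \<Longrightarrow> card e = 2"
  shows "set (labels (ball_tree d u p E E)) \<subseteq> \<Union>(edge_set E)"
proof (cases "ball_tree d u p E E = LL")
  case False
  then show ?thesis using tedges_Union[OF False, of u] tedges_ball_tree_subset[OF assms, where u = u and d = d and p = p] by blast
qed simp

section \<open>Instances of the problem\<close>

lemma tree_inputD:
  assumes "tree_input (n, es, k)"
  shows "edges (input_graph (n, es, k)) = edge_set es" "\<And>e. e \<in> edge_set es \<Longrightarrow> card e = 2"
    "\<Union>(edge_set es) \<subseteq> {..<n}" "\<nexists>c. cycle_in ({..<n}, edge_set es) c"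
    "distinct (map (\<lambda>(u, v). {u, v}) es)" "1 \<le> n" "finite (edge_set es)"
proof -
  show 1: "edges (input_graph (n, es, k)) = edge_set es" by (simp add: edge_set_def)
  have g: "input_graph (n, es, k) = ({..<n}, edge_set es)" by (simp add: edge_set_def)
  have t: "tree_graph ({..<n}, edge_set es)" "distinct (map (\<lambda>(u, v). {u, v}) es)"
    using assms g by auto
  then show "\<And>e. e \<in> edge_set es \<Longrightarrow> card e = 2" "\<Union>(edge_set es) \<subseteq> {..<n}"
    "\<nexists>c. cycle_in ({..<n}, edge_set es) c" "1 \<le> n"
    by (auto simp: tree_graph_def connected_graph_def finite_graph_def lessThan_empty_iff
        Suc_le_eq intro: gr0I)
  show "distinct (map (\<lambda>(u, v). {u, v}) es)" by (rule t)
  have "edge_set es = (\<lambda>(u, v). {u, v}) ` set es" by (auto simp: edge_set_def)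
  then show "finite (edge_set es)" by simp
qed

lemma distinct_ball_tree_input:
  assumes "tree_input (n, es, k)"
  shows "distinct (x # labels (ball_tree d x p es es))"
  using distinct_ball_tree[of es "{..<n}" es] tree_inputD[OF assms] by blast

text \<open>The labels are distinct vertices of the input. So a ball is small however large the
  radius, which keeps its construction polynomial.\<close>

lemma size_ball_tree_input:
  assumes "tree_input (n, es, k)"
  shows "size (shape (ball_tree d x p es es)) \<le> n"
proof -
  have "size (shape (ball_tree d x p es es)) = card (set (labels (ball_tree d x p es es)))"
    using distinct_ball_tree_input[OF assms, of x d p] by (simp add: distinct_card length_labels)
  also have "\<dots> \<le> card {..<n}"
    using set_labels_ball_tree[of es d x p] tree_inputD(2,3)[OF assms]
    by (intro card_mono) auto
  finally show ?thesis by simp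
qed

theorem maker_wins_iff_bwin:
  assumes H: "connected_graph H" and t: "tree_input (n, es, k)"
  defines "R \<equiv> Suc (card (adj (edges H))) * 2 ^ k"
  shows "maker_wins_H_game H (input_graph (n, es, k)) k \<longleftrightarrow>
    (\<exists>x<n. bwin (shapes H) k (pos x (prune (2 * k) (ball_tree R x n es es)) (\<lambda>_. Leaf)))"
proof -
  note D = tree_inputD[OF t]
  let ?G = "edge_set es"
  let ?B = "\<lambda>x. ball_tree R x n es es"
  have pairs: "\<exists>a b. e = {a, b}" if "e \<in> ?G" for e
    using D(2)[OF that] by (meson card_2_iff)
  have "maker_wins_H_game H (input_graph (n, es, k)) k \<longleftrightarrow>
      win ?G (H_game_sets H (input_graph (n, es, k))) k {} {}"
    unfolding maker_wins_H_game_def D(1)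
    by (rule maker_wins_within_iff_win[OF D(7)]) (use D(1) in \<open>auto simp: H_game_sets_def\<close>)
  \<comment> \<open>\<open>copies H\<close> does not mention a board, so one family of winning sets
    serves the tree, its balls and the kernels; \<open>win\<close> itself restricts it to the
    board.\<close>
  also have "\<dots> \<longleftrightarrow> win ?G (copies H) k {} {}"
    by (rule win_cong_sets) (use D(1) in \<open>auto simp: H_game_sets_def copies_def\<close>)
  also have "\<dots> \<longleftrightarrow> (\<exists>x<n. win (tedges x (?B x)) (copies H) k {} {})"
  proof
    assume "win ?G (copies H) k {} {}"
    then obtain v where v: "win (edge_ball ?G v R) (copies H) k {} {}"
      unfolding R_def using win_edge_ball[OF pairs, where W = "copies H" and D = "Suc (card (adj (edges H)))"]
        copy_in_edge_ball[OF H _ _ D(2)] by (metis One_nat_def Suc_le_mono le0)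
    have np: "{x, n} \<notin> ?G" for x using D(3) by auto
    show "\<exists>x<n. win (tedges x (?B x)) (copies H) k {} {}"
    proof (cases "v < n")
      case True
      then show ?thesis
        using win_board_mono[OF v edge_ball_subset_ball_tree[OF D(2) np]] by blast
    next
      case False
      \<comment> \<open>The centre supplied by the locality argument may be any number. Outside the
        vertices its ball is empty, so vertex 0 can take its place.\<close>
      have "edge_ball ?G v R = {}"
      proof (rule ccontr)
        assume "edge_ball ?G v R \<noteq> {}"
        then obtain a b i where i: "(v, a) \<in> adj ?G ^^ i" "{a, b} \<in> ?G"
          by (auto simp: edge_ball_def)
        then have "v \<in> \<Union>?G"
        proof (cases i)
          case (Suc i')
          then obtain y where "(v, y) \<in> adj ?G" using i(1) relpow_Suc_D2 by metis
          then show ?thesis by (auto simp: adj_def)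
        qed auto
        then show False using False D(3) by auto
      qed
      then have "win (tedges 0 (?B 0)) (copies H) k {} {}"
        using win_board_mono[OF v] by simp
      then show ?thesis using D(6) by (intro exI[of _ 0]) simp
    qed
  next
    assume "\<exists>x<n. win (tedges x (?B x)) (copies H) k {} {}"
    then obtain x where "win (tedges x (?B x)) (copies H) k {} {}" by blast
    then show "win ?G (copies H) k {} {}"
      by (rule win_board_mono[OF _ tedges_ball_tree_subset[OF D(2)]])
  qed
  also have "\<dots> \<longleftrightarrow> (\<exists>x<n. bwin (shapes H) k (pos x (prune (2 * k) (?B x)) (\<lambda>_. Leaf)))"
  proof -
    have "bwin (shapes H) k (pos x (prune (2 * k) (?B x)) (\<lambda>_. Leaf)) \<longleftrightarrow>
        win (tedges x (?B x)) (copies H) k {} {}" for x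
    proof -
      have d: "distinct (x # labels (?B x))" by (rule distinct_ball_tree_input[OF t])
      then have d': "distinct (x # labels (prune (2 * k) (?B x)))"
        using labels_prune[of "2 * k" "?B x"] distinct_prune[of "?B x" "2 * k"] by auto
      have "(\<lambda>_. Leaf) = mark {} ({} :: nat set set)" by (simp add: mark_def fun_eq_iff)
      then show ?thesis
        using bwin_iff_win[OF H d', of k "{}" "{}"] win_prune[OF d, of k "2 * k" H] by simp
    qed
    then show ?thesis by simp
  qed
  finally show ?thesis .
qed

section \<open>Symbolic evaluation of programs\<close>

definition runs_within :: "program \<Rightarrow> bintree list \<Rightarrow> expr \<Rightarrow> bintree \<Rightarrow> nat \<Rightarrow> bool" where
  "runs_within P env e v t \<longleftrightarrow> (\<exists>t'\<le>t. eval P env e v t')"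

text \<open>
  \<open>\<Phi> j\<close> and \<open>\<tau> j\<close> stand for the value and the running time of the \<open>j\<close>-th function; \<open>safe\<close> demands
  that they are correct for all calls that are actually reached.
\<close>

fun den :: "(nat \<Rightarrow> bintree list \<Rightarrow> bintree) \<Rightarrow> bintree list \<Rightarrow> expr \<Rightarrow> bintree" where
  "den \<Phi> env (Var i) = env ! i"
| "den \<Phi> env LeafE = Leaf"
| "den \<Phi> env (NodeE a b) = Node (den \<Phi> env a) (den \<Phi> env b)"
| "den \<Phi> env (LeftE e) = left (den \<Phi> env e)"
| "den \<Phi> env (RightE e) = right (den \<Phi> env e)"
| "den \<Phi> env (IfE c a b) = (if den \<Phi> env c \<noteq> Leaf then den \<Phi> env a else den \<Phi> env b)"
| "den \<Phi> env (CallE j es) = \<Phi> j (map (den \<Phi> env) es)"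

fun cost :: "(nat \<Rightarrow> bintree list \<Rightarrow> bintree) \<Rightarrow> (nat \<Rightarrow> bintree list \<Rightarrow> nat) \<Rightarrow> bintree list \<Rightarrow> expr \<Rightarrow> nat" where
  "cost \<Phi> \<tau> env (Var i) = 1"
| "cost \<Phi> \<tau> env LeafE = 1"
| "cost \<Phi> \<tau> env (NodeE a b) = cost \<Phi> \<tau> env a + cost \<Phi> \<tau> env b + 1"
| "cost \<Phi> \<tau> env (LeftE e) = cost \<Phi> \<tau> env e + 1"
| "cost \<Phi> \<tau> env (RightE e) = cost \<Phi> \<tau> env e + 1"
| "cost \<Phi> \<tau> env (IfE c a b) = cost \<Phi> \<tau> env c +
     (if den \<Phi> env c \<noteq> Leaf then cost \<Phi> \<tau> env a else cost \<Phi> \<tau> env b) + 1"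
| "cost \<Phi> \<tau> env (CallE j es) =
     sum_list (map (cost \<Phi> \<tau> env) es) + \<tau> j (map (den \<Phi> env) es) + 1"

fun safe :: "program \<Rightarrow> (nat \<Rightarrow> bintree list \<Rightarrow> bintree) \<Rightarrow> (nat \<Rightarrow> bintree list \<Rightarrow> nat) \<Rightarrow> bintree list \<Rightarrow> expr \<Rightarrow> bool" where
  "safe P \<Phi> \<tau> env (Var i) \<longleftrightarrow> i < length env"
| "safe P \<Phi> \<tau> env LeafE \<longleftrightarrow> True"
| "safe P \<Phi> \<tau> env (NodeE a b) \<longleftrightarrow> safe P \<Phi> \<tau> env a \<and> safe P \<Phi> \<tau> env b"
| "safe P \<Phi> \<tau> env (LeftE e) \<longleftrightarrow> safe P \<Phi> \<tau> env e"
| "safe P \<Phi> \<tau> env (RightE e) \<longleftrightarrow> safe P \<Phi> \<tau> env e"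
| "safe P \<Phi> \<tau> env (IfE c a b) \<longleftrightarrow> safe P \<Phi> \<tau> env c \<and>
     (if den \<Phi> env c \<noteq> Leaf then safe P \<Phi> \<tau> env a else safe P \<Phi> \<tau> env b)"
| "safe P \<Phi> \<tau> env (CallE j es) \<longleftrightarrow> (\<forall>e\<in>set es. safe P \<Phi> \<tau> env e) \<and> j < length P \<and>
     runs_within P (map (den \<Phi> env) es) (P ! j) (\<Phi> j (map (den \<Phi> env) es)) (\<tau> j (map (den \<Phi> env) es))"

lemma evals_within:
  assumes "\<And>e. e \<in> set es \<Longrightarrow> \<exists>t\<le>c e. eval P env e (d e) t"
  shows "\<exists>t\<le>sum_list (map c es). evals P env es (map d es) t"
  using assms
proof (induction es)
  case Nil
  then show ?case by (auto intro: evals_Nil)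
next
  case (Cons e es)
  obtain t where t: "t \<le> c e" "eval P env e (d e) t" using Cons.prems by auto
  obtain s where "s \<le> sum_list (map c es)" "evals P env es (map d es) s"
    using Cons by auto
  with t show ?case by (auto intro!: exI[of _ "t + s"] evals_Cons)
qed

lemma safe_runs_within: "safe P \<Phi> \<tau> env e \<Longrightarrow> runs_within P env e (den \<Phi> env e) (cost \<Phi> \<tau> env e)"
  unfolding runs_within_def
proof (induction P \<Phi> \<tau> env e rule: safe.induct)
  case (3 P \<Phi> \<tau> env a b)
  then obtain s t where "s \<le> cost \<Phi> \<tau> env a" "t \<le> cost \<Phi> \<tau> env b"
    "eval P env a (den \<Phi> env a) s" "eval P env b (den \<Phi> env b) t" by auto
  then show ?case by (intro exI[of _ "s + t + 1"]) (auto intro: eval_Node[simplified])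
next
  case (4 P \<Phi> \<tau> env e)
  then obtain s where "s \<le> cost \<Phi> \<tau> env e" "eval P env e (den \<Phi> env e) s" by auto
  then show ?case by (intro exI[of _ "s + 1"]) (auto intro: eval_Left[simplified])
next
  case (5 P \<Phi> \<tau> env e)
  then obtain s where "s \<le> cost \<Phi> \<tau> env e" "eval P env e (den \<Phi> env e) s" by auto
  then show ?case by (intro exI[of _ "s + 1"]) (auto intro: eval_Right[simplified])
next
  case (6 P \<Phi> \<tau> env c a b)
  then obtain s where s: "s \<le> cost \<Phi> \<tau> env c" "eval P env c (den \<Phi> env c) s" by auto
  show ?case
  proof (cases "den \<Phi> env c = Leaf")
    case True
    then obtain t where "t \<le> cost \<Phi> \<tau> env b" "eval P env b (den \<Phi> env b) t" using 6 by auto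
    then show ?thesis
      using s True eval_If_false[of P env c s b _ t a] by (intro exI[of _ "s + t + 1"]) auto
  next
    case False
    then obtain t where "t \<le> cost \<Phi> \<tau> env a" "eval P env a (den \<Phi> env a) t" using 6 by auto
    then show ?thesis
      using s False eval_If_true[of P env c _ s a _ t b] by (intro exI[of _ "s + t + 1"]) auto
  qed
next
  case (7 P \<Phi> \<tau> env j es)
  let ?us = "map (den \<Phi> env) es"
  obtain s where s: "s \<le> sum_list (map (cost \<Phi> \<tau> env) es)" "evals P env es ?us s"
    using evals_within[of es "cost \<Phi> \<tau> env" P env "den \<Phi> env"] 7 by auto
  obtain t where t: "t \<le> \<tau> j ?us" "eval P ?us (P ! j) (\<Phi> j ?us) t"
    using 7 by (auto simp: runs_within_def)
  have "eval P env (CallE j es) (\<Phi> j ?us) (s + t + 1)"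
    using eval_Call[OF s(2) _ t(2)] 7 by simp
  then show ?case using s(1) t(1) by (intro exI[of _ "s + t + 1"]) auto
next
  case (1 P \<Phi> \<tau> env i)
  then show ?case using eval_Var[of i env P] by (intro exI[of _ 1]) simp
next
  case (2 P \<Phi> \<tau> env)
  show ?case using eval_Leaf[of P env] by (intro exI[of _ 1]) simp
qed

text \<open>The equation \<open>b = e\<close> receives the defining equation of a function body, so
  that bodies stay folded elsewhere.\<close>

lemma runs_withinI:
  assumes "b = e" "safe P \<Phi> \<tau> env e" "den \<Phi> env e = v" "cost \<Phi> \<tau> env e \<le> t"
  shows "runs_within P env b v t"
  using safe_runs_within[OF assms(2)] assms(1,3,4) unfolding runs_within_def
  by (meson le_trans)

lemma runs_within_mono:
  "runs_within P env e v t \<Longrightarrow> v = v' \<Longrightarrow> t \<le> t' \<Longrightarrow> runs_within P env e v' t'"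
  unfolding runs_within_def by (meson le_trans)

fun quote :: "bintree \<Rightarrow> expr" where
  "quote Leaf = LeafE"
| "quote (Node a b) = NodeE (quote a) (quote b)"

lemma quote [simp]:
  "den \<Phi> env (quote t) = t" "cost \<Phi> \<tau> env (quote t) = 2 * size t + 1" "safe P \<Phi> \<tau> env (quote t)"
  by (induction t) auto

section \<open>The algorithm\<close>

abbreviation mklist :: "bintree list \<Rightarrow> bintree" where "mklist \<equiv> encode_list (\<lambda>x. x)"

definition blen :: "bintree \<Rightarrow> nat" where "blen t = length (children t)"

lemma blen_simps [simp]: "blen Leaf = 0" "blen (Node a b) = Suc (blen b)"
  by (simp_all add: blen_def)

lemma children_encode_list [simp]: "children (encode_list f xs) = map f xs"
  by (induction xs) auto

lemma mklist_children [simp]: "mklist (children t) = t"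
  by (induction t) auto

lemma blen_encode_list [simp]: "blen (encode_list f xs) = length xs"
  by (simp add: blen_def)

lemma encode_nat_simps [simp]: "encode_nat 0 = Leaf" "encode_nat (Suc n) = Node Leaf (encode_nat n)"
proof -
  have "encode_list (\<lambda>_. Leaf) xs = encode_list (\<lambda>_. Leaf) ys" if "length xs = length ys" for xs ys :: "nat list"
    using that by (induction xs ys rule: list_induct2) auto
  then show "encode_nat (Suc n) = Node Leaf (encode_nat n)"
    unfolding encode_nat_def by (simp add: upt_rec[of 0 "Suc n"] del: upt_Suc)
qed (simp add: encode_nat_def)

lemma blen_encode_nat [simp]: "blen (encode_nat n) = n"
  by (induction n) auto

lemma size_encode_nat [simp]: "size (encode_nat n) = n"
  by (induction n) auto

lemma encode_nat_inject [simp]: "encode_nat m = encode_nat n \<longleftrightarrow> m = n"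
  by (metis blen_encode_nat)

lemma encode_bool_eq_Leaf [simp]: "encode_bool b = Leaf \<longleftrightarrow> \<not> b"
  by (simp add: encode_bool_def)

lemma encode_bool_simps [simp]:
  "encode_bool True = Node Leaf Leaf" "encode_bool False = Leaf"
  "Leaf = encode_bool b \<longleftrightarrow> \<not> b" "encode_bool b = Node Leaf Leaf \<longleftrightarrow> b"
  "Node Leaf Leaf = encode_bool b \<longleftrightarrow> b" "encode_bool b = encode_bool c \<longleftrightarrow> b = c"
  by (simp_all add: encode_bool_def)

fun kern :: "nat \<Rightarrow> bintree \<Rightarrow> bintree" where
  "kern q Leaf = Leaf"
| "kern q (Node a b) =
    (if q \<le> count_list (children (kern q b)) (kern q a) then kern q b else Node (kern q a) (kern q b))"

lemma shape_prune: "shape (prune q t) = kern q (shape t)"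
  by (induction t) auto

fun bball :: "bintree \<Rightarrow> bintree \<Rightarrow> bintree \<Rightarrow> bintree \<Rightarrow> bintree \<Rightarrow> bintree" where
  "bball Leaf u p E L = Leaf"
| "bball (Node x d) u p E Leaf = Leaf"
| "bball (Node x d) u p E (Node e L) =
    (if left e = u then
       if right e = p then bball (Node x d) u p E L
       else Node (bball d (right e) u E E) (bball (Node x d) u p E L)
     else if right e = u then
       if left e = p then bball (Node x d) u p E L
       else Node (bball d (left e) u E E) (bball (Node x d) u p E L)
     else bball (Node x d) u p E L)"

definition encode_edges :: "(nat \<times> nat) list \<Rightarrow> bintree" where
  "encode_edges = encode_list (\<lambda>(u, v). Node (encode_nat u) (encode_nat v))"

lemma encode_edges_simps [simp]:
  "encode_edges [] = Leaf"
  "encode_edges ((a, b) # L) = Node (Node (encode_nat a) (encode_nat b)) (encode_edges L)"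
  by (simp_all add: encode_edges_def)

lemma bball_encode:
  "bball (encode_nat d) (encode_nat u) (encode_nat p) (encode_edges E) (encode_edges L) =
     shape (ball_tree d u p E L)"
  by (induction d u p E L rule: ball_tree.induct) auto

fun binit :: "bintree \<Rightarrow> bintree" where
  "binit Leaf = Leaf"
| "binit (Node a b) = Node (Node Leaf (binit a)) (binit b)"

lemma pos_free: "pos r t (\<lambda>_. Leaf) = binit (shape t)"
  by (induction t arbitrary: r) auto

text \<open>Unlike \<open>bheight\<close>, this does not depend on the marks and is invariant under moves.\<close>

fun pheight :: "bintree \<Rightarrow> nat" where
  "pheight Leaf = 0"
| "pheight (Node x r) = Suc (max (pheight (right x)) (pheight r))"

lemma pheight_binit: "pheight (binit t) = bheight t"
  by (induction t) auto

text \<open>Counting the pass as well, the number at a node is at most the sum of the numbers for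
  its two subtrees, because the one additional move replaces the second pass.\<close>

lemma length_moves: "Suc (length (moves l p)) \<le> 2 ^ pheight p"
proof (induction l p rule: moves.induct)
  case (2 l x r)
  let ?m = "max (pheight (right x)) (pheight r)"
  have "(2::nat) ^ pheight (right x) \<le> 2 ^ ?m" "(2::nat) ^ pheight r \<le> 2 ^ ?m" by simp_all
  then have "Suc (length (moves l (right x))) \<le> 2 ^ ?m" "Suc (length (moves l r)) \<le> 2 ^ ?m"
    using 2 by (meson le_trans)+
  then show ?case by auto
qed simp

lemma pheight_moves: "p' \<in> set (moves l p) \<Longrightarrow> pheight p' = pheight p"
  by (induction l p arbitrary: p' rule: moves.induct) (auto split: if_splits)

section \<open>The function bodies and their values\<close>

text \<open>
  \<open>CallE j\<close> refers to the \<open>j\<close>-th body in \<open>prog\<close> below, and \<open>Phi\<close> lists the values that are computed.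
\<close>

abbreviation "v0 \<equiv> Var 0"
abbreviation "v1 \<equiv> Var 1"
abbreviation "v2 \<equiv> Var 2"
abbreviation "v3 \<equiv> Var 3"
abbreviation "v4 \<equiv> Var 4"
abbreviation "v5 \<equiv> Var 5"
abbreviation "trueE \<equiv> NodeE LeafE LeafE"

definition "dblE = IfE v0 (NodeE LeafE (NodeE LeafE (CallE 3 [RightE v0]))) LeafE"

definition "eqE =
  IfE v0 (IfE v1 (IfE (CallE 4 [LeftE v0, LeftE v1]) (CallE 4 [RightE v0, RightE v1]) LeafE) LeafE)
    (IfE v1 LeafE trueE)"

definition "ballE =
  (let a = LeftE (LeftE v4); b = RightE (LeftE v4);
       rest = CallE 5 [v0, v1, v2, v3, RightE v4];
       child = (\<lambda>x. NodeE (CallE 5 [RightE v0, x, v1, v3, v3]) rest)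
   in IfE v0 (IfE v4
        (IfE (CallE 4 [a, v1]) (IfE (CallE 4 [b, v2]) rest (child b))
          (IfE (CallE 4 [b, v1]) (IfE (CallE 4 [a, v2]) rest (child a)) rest)) LeafE) LeafE)"

text \<open>Counts \<open>q\<close> down while scanning the children and stops when it reaches zero,
  so no number is ever built up or compared.\<close>

definition "countE =
  IfE v2 (IfE v1 (IfE (CallE 4 [v0, LeftE v1]) (CallE 6 [v0, RightE v1, RightE v2])
    (CallE 6 [v0, RightE v1, v2])) LeafE) trueE"

definition "kernE = IfE v0 (CallE 8 [CallE 7 [LeftE v0, v1], CallE 7 [RightE v0, v1], v1]) LeafE"

text \<open>The language has no local bindings. Passing the two pruned parts as arguments ensures
  that \<open>kernE\<close> computes each of them only once.\<close>

definition "addE = IfE (CallE 6 [v0, v1, v2]) v1 (NodeE v0 v1)"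

definition "initE = IfE v0 (NodeE (NodeE LeafE (CallE 9 [LeftE v0])) (CallE 9 [RightE v0])) LeafE"

definition "appendE = IfE v0 (NodeE (LeftE v0) (CallE 10 [RightE v0, v1])) v1"

definition "map_childE =
  IfE v2 (NodeE (NodeE (NodeE v0 (LeftE v2)) v1) (CallE 11 [v0, v1, RightE v2])) LeafE"

definition "map_restE = IfE v1 (NodeE (NodeE v0 (LeftE v1)) (CallE 12 [v0, RightE v1])) LeafE"

definition "movesE =
  (let l = LeftE (LeftE v1); c = RightE (LeftE v1); r = RightE v1 in
   IfE v1 (CallE 10 [IfE l LeafE (NodeE (NodeE (NodeE v0 c) r) LeafE),
     CallE 10 [CallE 11 [l, r, CallE 13 [v0, c]], CallE 12 [LeftE v1, CallE 13 [v0, r]]]]) LeafE)"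

definition "embE =
  (let l = LeftE (LeftE v1); skip = CallE 14 [v0, RightE v1] in
   IfE v0 (IfE v1
     (IfE l (IfE (LeftE l) skip
       (IfE (CallE 14 [LeftE v0, RightE (LeftE v1)])
         (IfE (CallE 14 [RightE v0, RightE v1]) trueE skip) skip)) skip) LeafE) trueE)"

definition "occE =
  IfE v1 (IfE (CallE 14 [v0, v1]) trueE
    (IfE (CallE 15 [v0, RightE (LeftE v1)]) trueE (CallE 15 [v0, RightE v1]))) LeafE"

definition "occ_anyE =
  IfE v0 (IfE (CallE 15 [LeftE v0, v1]) trueE (CallE 16 [RightE v0, v1])) LeafE"

text \<open>The orderings of \<open>H\<close> are a constant inside the program, as \<open>H\<close>
  is fixed.\<close>

definition "winE hs =
  IfE (CallE 16 [quote (mklist hs), v1]) trueE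
    (IfE v0 (CallE 18 [CallE 13 [quote maker_mark, v1], RightE v0]) LeafE)"

definition "exE =
  IfE v0 (IfE (CallE 19 [NodeE (LeftE v0) (CallE 13 [quote breaker_mark, LeftE v0]), v1]) trueE
    (CallE 18 [RightE v0, v1])) LeafE"

definition "allE' = IfE v0 (IfE (CallE 17 [v1, LeftE v0]) (CallE 19 [RightE v0, v1]) LeafE) trueE"

definition "radiusE D = IfE v0 (CallE 3 [CallE 2 [RightE v0]]) (quote (encode_nat D))"

text \<open>The counter starts at \<open>n\<close>, and its predecessor is the centre under test.
  The number \<open>n\<close> itself is passed as the parent of the centre.\<close>

definition "loopE =
  IfE v0 (IfE (CallE 17 [v5, CallE 9 [CallE 7 [CallE 5 [v3, RightE v0, v1, v2, v2], v4]]]) trueE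
    (CallE 1 [RightE v0, v1, v2, v3, v4, v5])) LeafE"

definition "mainE =
  (let E = LeftE (RightE v0); k = RightE (RightE v0) in
   CallE 1 [LeftE v0, LeftE v0, E, CallE 2 [k], CallE 3 [k], k])"

definition prog :: "bintree list \<Rightarrow> nat \<Rightarrow> program" where
  "prog hs D = [mainE, loopE, radiusE D, dblE, eqE, ballE, countE, kernE, addE, initE, appendE,
     map_childE, map_restE, movesE, embE, occE, occ_anyE, winE hs, exE, allE']"

lemma prog_nth [simp]:
  "length (prog hs D) = 20"
  "prog hs D ! 0 = mainE" "prog hs D ! Suc 0 = loopE" "prog hs D ! 2 = radiusE D" "prog hs D ! 3 = dblE"
  "prog hs D ! 4 = eqE" "prog hs D ! 5 = ballE" "prog hs D ! 6 = countE" "prog hs D ! 7 = kernE"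
  "prog hs D ! 8 = addE" "prog hs D ! 9 = initE" "prog hs D ! 10 = appendE"
  "prog hs D ! 11 = map_childE" "prog hs D ! 12 = map_restE" "prog hs D ! 13 = movesE"
  "prog hs D ! 14 = embE" "prog hs D ! 15 = occE" "prog hs D ! 16 = occ_anyE"
  "prog hs D ! 17 = winE hs" "prog hs D ! 18 = exE" "prog hs D ! 19 = allE'"
  by (simp_all add: prog_def)

definition check :: "bintree list \<Rightarrow> bintree \<Rightarrow> bintree \<Rightarrow> bintree \<Rightarrow> bintree \<Rightarrow> bintree \<Rightarrow> bintree \<Rightarrow> bool" where
  "check hs x n E d q k \<longleftrightarrow>
     bwin (set hs) (blen k) (binit (kern (blen q) (bball d x n E E)))"

fun bloop :: "bintree list \<Rightarrow> bintree \<Rightarrow> bintree \<Rightarrow> bintree \<Rightarrow> bintree \<Rightarrow> bintree \<Rightarrow> bintree \<Rightarrow> bool" where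
  "bloop hs Leaf n E d q k \<longleftrightarrow> False"
| "bloop hs (Node a i) n E d q k \<longleftrightarrow> check hs i n E d q k \<or> bloop hs i n E d q k"

definition radius :: "nat \<Rightarrow> bintree \<Rightarrow> bintree" where
  "radius D k = encode_nat (D * 2 ^ blen k)"

definition dbl :: "bintree \<Rightarrow> bintree" where
  "dbl k = encode_nat (2 * blen k)"

definition Phi :: "bintree list \<Rightarrow> nat \<Rightarrow> nat \<Rightarrow> bintree list \<Rightarrow> bintree" where
  "Phi hs D j xs = [
     (let n = left (xs ! 0); E = left (right (xs ! 0)); k = right (right (xs ! 0)) in
       encode_bool (bloop hs n n E (radius D k) (dbl k) k)),
     encode_bool (bloop hs (xs ! 0) (xs ! 1) (xs ! 2) (xs ! 3) (xs ! 4) (xs ! 5)),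
     radius D (xs ! 0),
     dbl (xs ! 0),
     encode_bool (xs ! 0 = xs ! 1),
     bball (xs ! 0) (xs ! 1) (xs ! 2) (xs ! 3) (xs ! 4),
     encode_bool (blen (xs ! 2) \<le> count_list (children (xs ! 1)) (xs ! 0)),
     kern (blen (xs ! 1)) (xs ! 0),
     (if blen (xs ! 2) \<le> count_list (children (xs ! 1)) (xs ! 0) then xs ! 1 else Node (xs ! 0) (xs ! 1)),
     binit (xs ! 0),
     mklist (children (xs ! 0) @ children (xs ! 1)),
     mklist (map (\<lambda>c. Node (Node (xs ! 0) c) (xs ! 1)) (children (xs ! 2))),
     mklist (map (Node (xs ! 0)) (children (xs ! 1))),
     mklist (moves (xs ! 0) (xs ! 1)),
     encode_bool (emb (xs ! 0) (xs ! 1)),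
     encode_bool (occ (xs ! 0) (xs ! 1)),
     encode_bool (\<exists>h\<in>set (children (xs ! 0)). occ h (xs ! 1)),
     encode_bool (bwin (set hs) (blen (xs ! 0)) (xs ! 1)),
     encode_bool (\<exists>p\<in>set (children (xs ! 0)). \<forall>p'\<in>set (p # moves breaker_mark p). bwin (set hs) (blen (xs ! 1)) p'),
     encode_bool (\<forall>p\<in>set (children (xs ! 0)). bwin (set hs) (blen (xs ! 1)) p)] ! j"

lemma Phi_simps [simp]:
  "Phi hs D 0 [x] = (let n = left x; E = left (right x); k = right (right x) in
     encode_bool (bloop hs n n E (radius D k) (dbl k) k))"
  "Phi hs D (Suc 0) [i, n, E, d, q, k] = encode_bool (bloop hs i n E d q k)"
  "Phi hs D 2 [k] = radius D k"
  "Phi hs D 3 [k] = dbl k"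
  "Phi hs D 4 [a, b] = encode_bool (a = b)"
  "Phi hs D 5 [d, u, p, E, L] = bball d u p E L"
  "Phi hs D 6 [c, r, q] = encode_bool (blen q \<le> count_list (children r) c)"
  "Phi hs D 7 [t, q] = kern (blen q) t"
  "Phi hs D 8 [c, r, q] = (if blen q \<le> count_list (children r) c then r else Node c r)"
  "Phi hs D 9 [t] = binit t"
  "Phi hs D 10 [a, b] = mklist (children a @ children b)"
  "Phi hs D 11 [l, r, ps] = mklist (map (\<lambda>c. Node (Node l c) r) (children ps))"
  "Phi hs D 12 [x, ps] = mklist (map (Node x) (children ps))"
  "Phi hs D 13 [l, p] = mklist (moves l p)"
  "Phi hs D 14 [h, p] = encode_bool (emb h p)"
  "Phi hs D 15 [h, p] = encode_bool (occ h p)"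
  "Phi hs D 16 [S, p] = encode_bool (\<exists>h\<in>set (children S). occ h p)"
  "Phi hs D 17 [j, p] = encode_bool (bwin (set hs) (blen j) p)"
  "Phi hs D 18 [ps, j] = encode_bool (\<exists>p\<in>set (children ps). \<forall>p'\<in>set (p # moves breaker_mark p). bwin (set hs) (blen j) p')"
  "Phi hs D 19 [ps, j] = encode_bool (\<forall>p\<in>set (children ps). bwin (set hs) (blen j) p)"
  by (simp_all add: Phi_def)

section \<open>Running times\<close>

text \<open>Follows the recursion of \<open>bball\<close>. Each endpoint of the scanned edge takes
  part in at most two equality tests, which gives the factor 80; the other constants are
  generous.\<close>

fun tball :: "bintree \<Rightarrow> bintree \<Rightarrow> bintree \<Rightarrow> bintree \<Rightarrow> bintree \<Rightarrow> nat" where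
  "tball Leaf u p E L = 10"
| "tball (Node x d) u p E Leaf = 20"
| "tball (Node x d) u p E (Node e L) = 200 + 80 * (size (left e) + size (right e)) +
    (if left e = u then
       if right e = p then tball (Node x d) u p E L
       else tball d (right e) u E E + tball (Node x d) u p E L
     else if right e = u then
       if left e = p then tball (Node x d) u p E L
       else tball d (left e) u E E + tball (Node x d) u p E L
     else tball (Node x d) u p E L)"

definition tcount :: "bintree \<Rightarrow> bintree \<Rightarrow> nat" where
  "tcount c r = (blen r + 1) * (40 * size c + 60)"

fun tkern :: "nat \<Rightarrow> bintree \<Rightarrow> nat" where
  "tkern q Leaf = 10"
| "tkern q (Node a b) = tkern q a + tkern q b + tcount (kern q a) (kern q b) + 60"

definition tocc :: "bintree list \<Rightarrow> nat \<Rightarrow> nat" where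
  "tocc hs s = (length hs + 1) * (200 * 4 ^ s + 40) + 2 * size (mklist hs) + 40"

text \<open>\<open>s\<close> is the height of the position. \<open>2 ^ s\<close> bounds the number
  of Maker's moves as well as that of Breaker's replies including the pass, and
  \<open>200 * 4 ^ s\<close> bounds the time for listing either.\<close>

fun twin :: "bintree list \<Rightarrow> nat \<Rightarrow> nat \<Rightarrow> nat" where
  "twin hs 0 s = tocc hs s"
| "twin hs (Suc j) s = tocc hs s + 200 * 4 ^ s +
     2 ^ s * (200 * 4 ^ s + 2 ^ s * (twin hs j s + 20) + 60) + 60"

fun tloop :: "bintree list \<Rightarrow> bintree \<Rightarrow> bintree \<Rightarrow> bintree \<Rightarrow> bintree \<Rightarrow> bintree \<Rightarrow> bintree \<Rightarrow> nat" where
  "tloop hs Leaf n E d q k = 10"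
| "tloop hs (Node a i) n E d q k = 100 + tball d i n E E + tkern (blen q) (bball d i n E E) +
     40 * size (kern (blen q) (bball d i n E E)) + 
     twin hs (blen k) (bheight (kern (blen q) (bball d i n E E))) + tloop hs i n E d q k"

definition tau :: "bintree list \<Rightarrow> nat \<Rightarrow> nat \<Rightarrow> bintree list \<Rightarrow> nat" where
  "tau hs D j xs = [
     (let n = left (xs ! 0); E = left (right (xs ! 0)); k = right (right (xs ! 0)) in
       100 + tloop hs n n E (radius D k) (dbl k) k + 40 * (D + 1) * 2 ^ blen k + 20 * blen k),
     tloop hs (xs ! 0) (xs ! 1) (xs ! 2) (xs ! 3) (xs ! 4) (xs ! 5),
     40 * (D + 1) * 2 ^ blen (xs ! 0),
     20 * blen (xs ! 0) + 20,
     40 * size (xs ! 0) + 10,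
     tball (xs ! 0) (xs ! 1) (xs ! 2) (xs ! 3) (xs ! 4),
     tcount (xs ! 0) (xs ! 1),
     tkern (blen (xs ! 1)) (xs ! 0),
     tcount (xs ! 0) (xs ! 1) + 20,
     40 * size (xs ! 0) + 10,
     20 * blen (xs ! 0) + 20,
     20 * blen (xs ! 2) + 20,
     20 * blen (xs ! 1) + 20,
     200 * 4 ^ pheight (xs ! 1),
     40 * 4 ^ pheight (xs ! 1),
     200 * 4 ^ pheight (xs ! 1),
     (blen (xs ! 0) + 1) * (200 * 4 ^ pheight (xs ! 1) + 40),
     twin hs (blen (xs ! 0)) (pheight (xs ! 1)),
     (\<Sum>p\<leftarrow>children (xs ! 0). 200 * 4 ^ pheight p + 2 ^ pheight p * (twin hs (blen (xs ! 1)) (pheight p) + 20) + 60) + 10,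
     (\<Sum>p\<leftarrow>children (xs ! 0). twin hs (blen (xs ! 1)) (pheight p) + 20) + 10] ! j"

lemma tau_simps [simp]:
  "tau hs D 0 [x] = (let n = left x; E = left (right x); k = right (right x) in
     100 + tloop hs n n E (radius D k) (dbl k) k + 40 * (D + 1) * 2 ^ blen k + 20 * blen k)"
  "tau hs D (Suc 0) [i, n, E, d, q, k] = tloop hs i n E d q k"
  "tau hs D 2 [k] = 40 * (D + 1) * 2 ^ blen k"
  "tau hs D 3 [k] = 20 * blen k + 20"
  "tau hs D 4 [a, b] = 40 * size a + 10"
  "tau hs D 5 [d, u, p, E, L] = tball d u p E L"
  "tau hs D 6 [c, r, q] = tcount c r"
  "tau hs D 7 [t, q] = tkern (blen q) t"
  "tau hs D 8 [c, r, q] = tcount c r + 20"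
  "tau hs D 9 [t] = 40 * size t + 10"
  "tau hs D 10 [a, b] = 20 * blen a + 20"
  "tau hs D 11 [l, r, ps] = 20 * blen ps + 20"
  "tau hs D 12 [x, ps] = 20 * blen ps + 20"
  "tau hs D 13 [l, p] = 200 * 4 ^ pheight p"
  "tau hs D 14 [h, p] = 40 * 4 ^ pheight p"
  "tau hs D 15 [h, p] = 200 * 4 ^ pheight p"
  "tau hs D 16 [S, p] = (blen S + 1) * (200 * 4 ^ pheight p + 40)"
  "tau hs D 17 [j, p] = twin hs (blen j) (pheight p)"
  "tau hs D 18 [ps, j] = (\<Sum>p\<leftarrow>children ps. 200 * 4 ^ pheight p + 2 ^ pheight p * (twin hs (blen j) (pheight p) + 20) + 60) + 10"
  "tau hs D 19 [ps, j] = (\<Sum>p\<leftarrow>children ps. twin hs (blen j) (pheight p) + 20) + 10"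
  by (simp_all add: tau_def)

lemmas prog_runsI = runs_withinI[where \<Phi> = "Phi hs D" and \<tau> = "tau hs D" and P = "prog hs D" for hs D]

lemma dbl_simps [simp]: "dbl Leaf = Leaf" "dbl (Node a b) = Node Leaf (Node Leaf (dbl b))"
  by (simp_all add: dbl_def)

lemma run_dbl: "runs_within (prog hs D) [k] dblE (dbl k) (20 * blen k + 20)"
proof (induction k)
  case Leaf
  show ?case by (rule prog_runsI[OF dblE_def]) (simp_all add: Let_def)
next
  case (Node a k)
  then show ?case by (intro prog_runsI[OF dblE_def]) (simp_all add: Let_def)
qed

text \<open>With value and time left open, the simplifier can discharge the obligation that
  \<open>safe\<close> imposes on a call of this function; the later primed rules serve the same
  purpose.\<close>

lemmas run_dbl' [simp] = runs_within_mono[OF run_dbl]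

lemma run_eq: "runs_within (prog hs D) [a, b] eqE (encode_bool (a = b)) (40 * size a + 10)"
proof (induction a arbitrary: b)
  case Leaf
  show ?case by (rule prog_runsI[OF eqE_def]) (auto simp: Let_def)
next
  case (Node a1 a2)
  show ?case
  proof (cases b)
    case Leaf
    then show ?thesis by (intro prog_runsI[OF eqE_def]) (auto simp: Let_def)
  next
    case (Node b1 b2)
    then show ?thesis
      by (intro prog_runsI[OF eqE_def]) (auto simp: Let_def runs_within_mono[OF Node.IH(1)] runs_within_mono[OF Node.IH(2)])
  qed
qed

lemmas run_eq' [simp] = runs_within_mono[OF run_eq]

lemma run_ball: "runs_within (prog hs D) [d, u, p, E, L] ballE (bball d u p E L) (tball d u p E L)"
proof (induction d arbitrary: u p L)
  case Leaf
  show ?case by (rule prog_runsI[OF ballE_def]) (simp_all add: Let_def)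
next
  case (Node x d)
  note child = runs_within_mono[OF Node.IH(2)]
  show ?case
  proof (induction L)
    case Leaf
    show ?case by (rule prog_runsI[OF ballE_def]) (simp_all add: Let_def)
  next
    case (Node e L)
    show ?case
      by (cases "left e = u"; cases "right e = p"; cases "right e = u"; cases "left e = p";
          insert Node.IH(2); intro prog_runsI[OF ballE_def]; simp add: Let_def child)
  qed
qed

lemmas run_ball' [simp] = runs_within_mono[OF run_ball]

lemma run_count:
  "runs_within (prog hs D) [c, r, q] countE (encode_bool (blen q \<le> count_list (children r) c)) (tcount c r)"
proof (induction r arbitrary: q)
  case Leaf
  show ?case
    by (cases q; rule prog_runsI[OF countE_def]) (auto simp: Let_def tcount_def)
next
  case (Node a r)
  show ?case
    by (cases q; insert Node.IH(2)[of q] Node.IH(2)[of "right q"]; intro prog_runsI[OF countE_def])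
      (auto simp: Let_def tcount_def)
qed

lemmas run_count' [simp] = runs_within_mono[OF run_count]

lemma run_add:
  "runs_within (prog hs D) [c, r, q] addE (if blen q \<le> count_list (children r) c then r else Node c r) (tcount c r + 20)"
  by (rule prog_runsI[OF addE_def]) (auto simp: Let_def)

lemmas run_add' [simp] = runs_within_mono[OF run_add]

lemma run_kern: "runs_within (prog hs D) [t, q] kernE (kern (blen q) t) (tkern (blen q) t)"
proof (induction t)
  case Leaf
  show ?case by (rule prog_runsI[OF kernE_def]) (simp_all add: Let_def)
next
  case (Node a b)
  then show ?case by (intro prog_runsI[OF kernE_def]) (simp_all add: Let_def)
qed

lemmas run_kern' [simp] = runs_within_mono[OF run_kern]

lemma run_init: "runs_within (prog hs D) [t] initE (binit t) (40 * size t + 10)"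
proof (induction t)
  case Leaf
  show ?case by (rule prog_runsI[OF initE_def]) (simp_all add: Let_def)
next
  case (Node a b)
  then show ?case by (intro prog_runsI[OF initE_def]) (simp_all add: Let_def)
qed

lemmas run_init' [simp] = runs_within_mono[OF run_init]

lemma run_append:
  "runs_within (prog hs D) [a, b] appendE (mklist (children a @ children b)) (20 * blen a + 20)"
proof (induction a)
  case Leaf
  show ?case by (rule prog_runsI[OF appendE_def]) (simp_all add: Let_def)
next
  case (Node x a)
  then show ?case by (intro prog_runsI[OF appendE_def]) (simp_all add: Let_def)
qed

lemmas run_append' [simp] = runs_within_mono[OF run_append]

lemma run_map_child:
  "runs_within (prog hs D) [l, r, ps] map_childE (mklist (map (\<lambda>c. Node (Node l c) r) (children ps))) (20 * blen ps + 20)"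
proof (induction ps)
  case Leaf
  show ?case by (rule prog_runsI[OF map_childE_def]) (simp_all add: Let_def)
next
  case (Node x a)
  then show ?case by (intro prog_runsI[OF map_childE_def]) (simp_all add: Let_def)
qed

lemmas run_map_child' [simp] = runs_within_mono[OF run_map_child]

lemma run_map_rest:
  "runs_within (prog hs D) [x, ps] map_restE (mklist (map (Node x) (children ps))) (20 * blen ps + 20)"
proof (induction ps)
  case Leaf
  show ?case by (rule prog_runsI[OF map_restE_def]) (simp_all add: Let_def)
next
  case (Node x a)
  then show ?case by (intro prog_runsI[OF map_restE_def]) (simp_all add: Let_def)
qed

lemmas run_map_rest' [simp] = runs_within_mono[OF run_map_rest]

text \<open>The base is 4 rather than 2 to leave slack: recursive calls on the two subtrees use
  \<open>2 * X\<close> out of \<open>4 * X\<close>, and the rest pays for the remaining work,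
  including passes over lists of length at most \<open>X\<close>. Naming \<open>X\<close> makes the
  estimates linear.\<close>

lemma pheight_pow:
  fixes x r :: bintree
  obtains X where "(4::nat) ^ pheight (Node x r) = 4 * X" "4 ^ pheight (right x) \<le> X"
    "4 ^ pheight r \<le> X" "1 \<le> X" "length (moves l (right x)) \<le> X" "length (moves l r) \<le> X"
proof
  let ?m = "max (pheight (right x)) (pheight r)"
  show "(4::nat) ^ pheight (Node x r) = 4 * 4 ^ ?m" by simp
  show 1: "(4::nat) ^ pheight (right x) \<le> 4 ^ ?m" "(4::nat) ^ pheight r \<le> 4 ^ ?m" "1 \<le> (4::nat) ^ ?m"
    by simp_all
  have "(2::nat) ^ s \<le> 4 ^ s" for s by (rule power_mono) simp_all
  then have "length (moves l p) \<le> 4 ^ pheight p" for p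
    using length_moves[of l p] by (meson Suc_leD le_trans)
  then show "length (moves l (right x)) \<le> 4 ^ ?m" "length (moves l r) \<le> 4 ^ ?m"
    using 1 by (meson le_trans)+
qed

lemma run_moves: "runs_within (prog hs D) [l, p] movesE (mklist (moves l p)) (200 * 4 ^ pheight p)"
proof (induction l p rule: moves.induct)
  case (1 l)
  show ?case by (rule prog_runsI[OF movesE_def]) (simp_all add: Let_def)
next
  case (2 l x r)
  obtain X where X: "(4::nat) ^ pheight (Node x r) = 4 * X" "4 ^ pheight (right x) \<le> X"
    "4 ^ pheight r \<le> X" "1 \<le> X" "length (moves l (right x)) \<le> X" "length (moves l r) \<le> X"
    by (rule pheight_pow)
  have le: "200 * 4 ^ pheight (right x) \<le> 200 * X" "200 * 4 ^ pheight r \<le> 200 * X" using X by simp_all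
  show ?case
    unfolding X(1) using 2 le X(4-6) by (intro prog_runsI[OF movesE_def]) (auto simp: Let_def)
qed

lemmas run_moves' [simp] = runs_within_mono[OF run_moves]

lemma run_emb: "runs_within (prog hs D) [h, p] embE (encode_bool (emb h p)) (40 * 4 ^ pheight p)"
proof (induction h p rule: emb.induct)
  case (1 p)
  obtain X where "(4::nat) ^ pheight p = X" "1 \<le> X" by simp
  then show ?case by (intro prog_runsI[OF embE_def]) (simp_all add: Let_def)
next
  case (2 a b)
  show ?case by (rule prog_runsI[OF embE_def]) (simp_all add: Let_def)
next
  case (3 a b x r)
  obtain X where X: "(4::nat) ^ pheight (Node x r) = 4 * X" "4 ^ pheight (right x) \<le> X"
    "4 ^ pheight r \<le> X" "1 \<le> X" by (rule pheight_pow)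
  show ?case
    unfolding X(1) using 3 X(2-4)
    by (intro prog_runsI[OF embE_def]) (auto simp: Let_def is_maker_def)
qed

lemmas run_emb' [simp] = runs_within_mono[OF run_emb]

lemma run_occ: "runs_within (prog hs D) [h, p] occE (encode_bool (occ h p)) (200 * 4 ^ pheight p)"
proof (induction h p rule: occ.induct)
  case (1 h)
  show ?case by (rule prog_runsI[OF occE_def]) (simp_all add: Let_def)
next
  case (2 h x r)
  obtain X where X: "(4::nat) ^ pheight (Node x r) = 4 * X" "4 ^ pheight (right x) \<le> X"
    "4 ^ pheight r \<le> X" "1 \<le> X" by (rule pheight_pow)
  have e: "runs_within (prog hs D) [h, Node x r] embE (encode_bool (emb h (Node x r))) (40 * (4 * X))"
    using run_emb[of hs D h "Node x r"] unfolding X(1) .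
  show ?case
    unfolding X(1) using 2 X(2-4) e
    by (intro prog_runsI[OF occE_def]) (auto simp: Let_def X(1) simp del: pheight.simps(2))
qed

lemmas run_occ' [simp] = runs_within_mono[OF run_occ]

lemma run_occ_any:
  "runs_within (prog hs D) [S, p] occ_anyE (encode_bool (\<exists>h\<in>set (children S). occ h p))
     ((blen S + 1) * (200 * 4 ^ pheight p + 40))"
proof (induction S)
  case Leaf
  show ?case by (rule prog_runsI[OF occ_anyE_def]) (simp_all add: Let_def)
next
  case (Node h S)
  then show ?case by (intro prog_runsI[OF occ_anyE_def]) (auto simp: Let_def)
qed

lemmas run_occ_any' [simp] = runs_within_mono[OF run_occ_any]

text \<open>\<open>winE\<close>, \<open>exE\<close> and \<open>allE'\<close> call each other in a
  circle. Assuming the claim for \<open>winE\<close> at \<open>j\<close> breaks it; the induction on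
  \<open>j\<close> in \<open>run_win\<close> supplies the assumption.\<close>

lemma run_all:
  assumes "\<And>p. runs_within (prog hs D) [j, p] (winE hs) (encode_bool (bwin (set hs) (blen j) p))
      (twin hs (blen j) (pheight p))"
  shows "runs_within (prog hs D) [ps, j] allE' (encode_bool (\<forall>p\<in>set (children ps). bwin (set hs) (blen j) p))
     ((\<Sum>p\<leftarrow>children ps. twin hs (blen j) (pheight p) + 20) + 10)"
proof (induction ps)
  case Leaf
  show ?case by (rule prog_runsI[OF allE'_def]) (simp_all add: Let_def)
next
  case (Node p ps)
  then show ?case using assms by (intro prog_runsI[OF allE'_def]) (auto simp: Let_def)
qed

lemma sum_moves:
  "(\<Sum>p'\<leftarrow>p # moves l p. f (pheight p') + c) \<le> 2 ^ pheight p * (f (pheight p) + c)"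
  for f :: "nat \<Rightarrow> nat"
proof -
  have "(\<Sum>p'\<leftarrow>p # moves l p. f (pheight p') + c) = (\<Sum>p'\<leftarrow>p # moves l p. f (pheight p) + c)"
    by (intro arg_cong[where f = sum_list] map_cong) (auto simp: pheight_moves)
  also have "\<dots> = Suc (length (moves l p)) * (f (pheight p) + c)"
    by (simp add: sum_list_triv del: length_greater_0_conv)
  also have "\<dots> \<le> 2 ^ pheight p * (f (pheight p) + c)"
    by (rule mult_le_mono1[OF length_moves])
  finally show ?thesis .
qed

lemma run_ex:
  assumes "\<And>p. runs_within (prog hs D) [j, p] (winE hs) (encode_bool (bwin (set hs) (blen j) p))
      (twin hs (blen j) (pheight p))"
  shows "runs_within (prog hs D) [ps, j] exE
     (encode_bool (\<exists>p\<in>set (children ps). \<forall>p'\<in>set (p # moves breaker_mark p). bwin (set hs) (blen j) p'))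
     ((\<Sum>p\<leftarrow>children ps. 200 * 4 ^ pheight p + 2 ^ pheight p * (twin hs (blen j) (pheight p) + 20) + 60) + 10)"
proof (induction ps)
  case Leaf
  show ?case by (rule prog_runsI[OF exE_def]) (simp_all add: Let_def)
next
  case (Node p ps)
  have "size breaker_mark = 2" by (simp add: Let_def breaker_mark_def)
  then show ?case
    using Node.IH(2) run_all[OF assms, of "Node p (mklist (moves breaker_mark p))"]
      sum_moves[of "twin hs (blen j)" 20 p breaker_mark]
    by (intro prog_runsI[OF exE_def]) (auto simp: Let_def)
qed

lemma run_win:
  "runs_within (prog hs D) [j, p] (winE hs) (encode_bool (bwin (set hs) (blen j) p))
     (twin hs (blen j) (pheight p))"
proof (induction j arbitrary: p)
  case Leaf
  show ?case by (rule prog_runsI[OF winE_def]) (auto simp: Let_def tocc_def)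
next
  case (Node a j)
  let ?T = "\<lambda>s. 200 * 4 ^ s + 2 ^ s * (twin hs (blen j) s + 20)"
  have s: "size maker_mark = 1" by (simp add: Let_def maker_mark_def)
  have "(\<Sum>p'\<leftarrow>moves maker_mark p. ?T (pheight p') + 60) \<le> 2 ^ pheight p * (?T (pheight p) + 60)"
    using sum_moves[of ?T 60 p maker_mark] by simp
  then show ?case
    using Node.IH(2) run_ex[OF Node.IH(2), of "mklist (moves maker_mark p)"] s
    by (intro prog_runsI[OF winE_def]) (auto simp: Let_def tocc_def)
qed

lemmas run_win' [simp] = runs_within_mono[OF run_win]

lemma run_radius: "runs_within (prog hs D) [k] (radiusE D) (radius D k) (40 * (D + 1) * 2 ^ blen k)"
proof (induction k)
  case Leaf
  show ?case by (rule prog_runsI[OF radiusE_def]) (auto simp: Let_def radius_def)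
next
  case (Node a k)
  obtain Y where "(2::nat) ^ blen k = Y" "1 \<le> Y" by simp
  then show ?case
    using Node by (intro prog_runsI[OF radiusE_def]) (auto simp: radius_def dbl_def algebra_simps)
qed

lemmas run_radius' [simp] = runs_within_mono[OF run_radius]

lemma run_loop:
  "runs_within (prog hs D) [i, n, E, d, q, k] loopE (encode_bool (bloop hs i n E d q k)) (tloop hs i n E d q k)"
proof (induction i)
  case Leaf
  show ?case by (rule prog_runsI[OF loopE_def]) (simp_all add: Let_def)
next
  case (Node a i)
  then show ?case
    by (intro prog_runsI[OF loopE_def]) (auto simp: Let_def check_def pheight_binit)
qed

lemmas run_loop' [simp] = runs_within_mono[OF run_loop]

lemma run_main:
  "runs_within (prog hs D) [Node n (Node E k)] mainE
     (encode_bool (bloop hs n n E (radius D k) (dbl k) k))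
     (200 + tloop hs n n E (radius D k) (dbl k) k + 40 * (D + 1) * 2 ^ blen k + 20 * blen k)"
  by (rule prog_runsI[OF mainE_def]) (auto simp: Let_def)

section \<open>The size of the kernel\<close>

text \<open>The depth of the rooted tree, in contrast to \<open>bheight\<close>, which also grows
  along a list of siblings. Only the depth is bounded by the radius of the ball.\<close>

fun depth :: "bintree \<Rightarrow> nat" where
  "depth Leaf = 0"
| "depth (Node a b) = max (Suc (depth a)) (depth b)"

fun reduced :: "nat \<Rightarrow> bintree \<Rightarrow> bool" where
  "reduced q Leaf \<longleftrightarrow> True"
| "reduced q (Node a b) \<longleftrightarrow> reduced q a \<and> reduced q b \<and> count_list (children b) a < q"

text \<open>
  A vertex of the kernel has at most \<open>q\<close> children of each shape, and fewer than \<open>2 ^ 2 ^ s\<close> shapes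
  have height at most \<open>s\<close>.
\<close>

fun kernel_height :: "nat \<Rightarrow> nat \<Rightarrow> nat" where
  "kernel_height q 0 = 0"
| "kernel_height q (Suc d) = q * 2 ^ 2 ^ kernel_height q d + kernel_height q d"

lemma reduced_kern: "reduced q (kern q t)"
  by (induction t) auto

lemma depth_kern: "depth (kern q t) \<le> depth t"
  by (induction t) auto

lemma size_kern: "size (kern q t) \<le> size t"
  by (induction t) auto

lemma depth_ball_tree: "depth (shape (ball_tree d u p E L)) \<le> d"
  by (induction d u p E L rule: ball_tree.induct) auto

lemma reduced_children:
  "reduced q t \<Longrightarrow> c \<in> set (children t) \<Longrightarrow> reduced q c \<and> Suc (depth c) \<le> depth t"
  by (induction t) auto

lemma reduced_count: "reduced q t \<Longrightarrow> count_list (children t) c \<le> q"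
  by (induction t) auto

text \<open>Passing to the next sibling costs one level, after which a path may descend into a
  child. Together with the bound on the number of children this yields the recurrence of
  \<open>kernel_height\<close>.\<close>

lemma bheight_children:
  "(\<And>c. c \<in> set (children t) \<Longrightarrow> bheight c \<le> s) \<Longrightarrow> bheight t \<le> length (children t) + s"
proof (induction t)
  case (Node a b)
  have "bheight a \<le> s" "bheight b \<le> length (children b) + s" using Node by auto
  then show ?case by simp
qed simp

lemma bheight_reduced: "reduced q t \<Longrightarrow> depth t \<le> d \<Longrightarrow> bheight t \<le> kernel_height q d"
proof (induction d arbitrary: t)
  case 0
  then show ?case by (cases t) auto
next
  case (Suc d)
  let ?s = "kernel_height q d"
  have small: "bheight c \<le> ?s" if "c \<in> set (children t)" for c
    using Suc.IH reduced_children[OF Suc.prems(1) that] Suc.prems(2) by simp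
  have "length (children t) = (\<Sum>c\<in>set (children t). count_list (children t) c)"
    by (simp add: sum_count_set)
  also have "\<dots> \<le> (\<Sum>c\<in>set (children t). q)"
    by (rule sum_mono) (rule reduced_count[OF Suc.prems(1)])
  also have "\<dots> = q * card (set (children t))" by simp
  also have "card (set (children t)) \<le> card {c. bheight c \<le> ?s}"
    using small card_trees_bheight[of ?s] by (intro card_mono) auto
  also have "\<dots> \<le> 2 ^ 2 ^ ?s" using card_trees_bheight[of ?s] by simp
  finally have "length (children t) \<le> q * 2 ^ 2 ^ ?s" by simp
  moreover have "bheight t \<le> length (children t) + ?s" by (rule bheight_children[OF small])
  ultimately show ?case by simp
qed

section \<open>Bounds on the running time\<close>

lemma blen_le_size: "blen t \<le> size t"
  by (induction t) auto

text \<open>\<open>N\<close> stays fixed during the induction. Every node pays for one scan of a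
  list of at most \<open>N\<close> children with comparisons against a tree of size at most
  \<open>N\<close>.\<close>

lemma tkern_bound:
  "size t \<le> N \<Longrightarrow> tkern q t \<le> size t * ((N + 1) * (40 * N + 60) + 70) + 10"
proof (induction t)
  case (Node a b)
  let ?K = "(N + 1) * (40 * N + 60) + 70"
  have "blen (kern q b) + 1 \<le> N + 1" "40 * size (kern q a) + 60 \<le> 40 * N + 60"
    using Node.prems size_kern[of q a] size_kern[of q b] blen_le_size[of "kern q b"] by auto
  then have "tcount (kern q a) (kern q b) \<le> (N + 1) * (40 * N + 60)"
    unfolding tcount_def by (rule mult_le_mono)
  moreover have "tkern q a \<le> size a * ?K + 10" "tkern q b \<le> size b * ?K + 10"
    using Node by auto
  moreover have "size (Node a b) * ?K = size a * ?K + size b * ?K + ?K"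
    by (simp add: algebra_simps)
  ultimately show ?case by simp
qed simp

text \<open>Every vertex of the resulting ball causes one scan of the full edge list, hence the
  product of \<open>size\<close> and \<open>blen E + 1\<close>; the current scan of \<open>L\<close>
  is counted separately.\<close>

lemma tball_bound:
  assumes "\<And>e. e \<in> set (children E) \<Longrightarrow> size (left e) + size (right e) \<le> N"
  shows "(\<And>e. e \<in> set (children L) \<Longrightarrow> size (left e) + size (right e) \<le> N) \<Longrightarrow>
    tball d u p E L \<le> (200 + 80 * N) * (blen L + 1 + size (bball d u p E L) * (blen E + 1))"
proof (induction d arbitrary: u p L)
  case (Node x d)
  let ?K = "200 + 80 * N"
  note IH = Node.IH(2)
  from Node.prems show ?case
  proof (induction L)
    case (Node e L)
    let ?r = "size (bball (Node x d) u p E L) * (blen E + 1)"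
    have rest: "tball (Node x d) u p E L \<le> ?K * (blen L + 1 + ?r)"
      using Node.IH(2) Node.prems by simp
    have step: "200 + 80 * (size (left e) + size (right e)) \<le> ?K"
      using Node.prems[of e] by simp
    have skip: "200 + 80 * (size (left e) + size (right e)) + tball (Node x d) u p E L
        \<le> ?K * (blen (Node e L) + 1 + ?r)"
      using rest step by (simp add: algebra_simps)
    have child: "200 + 80 * (size (left e) + size (right e)) + (tball d y u E E + tball (Node x d) u p E L)
        \<le> ?K * (blen (Node e L) + 1 + size (Node (bball d y u E E) (bball (Node x d) u p E L)) * (blen E + 1))"
      for y
    proof -
      have "tball d y u E E \<le> ?K * (blen E + 1 + size (bball d y u E E) * (blen E + 1))"
        by (rule IH[OF assms])
      then show ?thesis using rest step by (simp add: algebra_simps)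
    qed
    show ?case
      unfolding tball.simps bball.simps
      using skip child[of "left e"] child[of "right e"] by (simp only: split: if_split) blast
  qed simp
qed simp

definition time_base :: "bintree list \<Rightarrow> nat" where
  "time_base hs = 240 * (length hs + 1) + 2 * size (mklist hs) + 640"

text \<open>Every move of Maker multiplies the time by at most \<open>time_base hs * 16 ^ s\<close>:
  move and reply together have at most \<open>4 ^ s\<close> choices, and another factor
  \<open>4 ^ s\<close> covers the work per position.\<close>

lemma twin_bound: "twin hs j s \<le> (time_base hs * 16 ^ s) ^ Suc j"
proof -
  define c where "c = 240 * (length hs + 1) + 2 * size (mklist hs) + 40"
  define Y where "Y = (2::nat) ^ s"
  have Y: "1 \<le> Y" "(4::nat) ^ s = Y * Y" "(16::nat) ^ s = (Y * Y) * (Y * Y)"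
    by (simp_all add: Y_def power_mult_distrib[symmetric])
  define X where "X = Y * Y"
  have X: "1 \<le> X" "Y \<le> X" using Y(1) by (simp_all add: X_def)
  have XX: "X \<le> X * X" "1 \<le> X * X" using X(1) by (simp_all add: Suc_le_eq)
  have "tocc hs s = (length hs + 1) * (200 * X + 40) + 2 * size (mklist hs) + 40"
    by (simp add: tocc_def Y(2) X_def)
  also have "\<dots> \<le> (length hs + 1) * (200 * X + 40 * X) + 2 * size (mklist hs) * X + 40 * X"
  proof -
    have "a \<le> a * X" for a using X(1) by simp
    then show ?thesis by (intro add_mono mult_le_mono2) auto
  qed
  also have "\<dots> = c * X" by (simp add: c_def algebra_simps)
  finally have tocc: "tocc hs s \<le> c * X" .
  define Z where "Z = time_base hs * 16 ^ s"
  have Z: "Z = (c + 600) * (X * X)" by (simp add: Z_def time_base_def c_def Y(3) X_def)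
  have Z1: "1 \<le> Z" unfolding Z using XX(2) by (simp add: Suc_le_eq)
  have "twin hs j s \<le> Z ^ Suc j"
  proof (induction j)
    case 0
    have "c * X \<le> (c + 600) * (X * X)" using XX(1) by (intro mult_le_mono) auto
    with tocc have "tocc hs s \<le> Z" unfolding Z by (rule le_trans)
    then show ?case by simp
  next
    case (Suc j)
    let ?w = "twin hs j s" and ?V = "Z ^ Suc j"
    have V: "?w \<le> ?V" "1 \<le> ?V" using Suc Z1 by auto
    have t1: "a \<le> a * (X * X) * ?V" for a
      using XX(2) V(2) by (simp add: Suc_le_eq)
    have t2: "X \<le> X * X * ?V" using XX(1) V(2) by (metis mult_le_mono mult.right_neutral)
    have t3: "Y * X \<le> X * X * ?V" using X(2) V(2) by (metis mult_le_mono mult.right_neutral order_refl)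
    have t4: "Y * Y * (?w + 20) \<le> X * X * ?V * 21"
    proof -
      have "?w + 20 \<le> 21 * ?V" using V by linarith
      then have "Y * Y * (?w + 20) \<le> (X * X) * (21 * ?V)"
        using XX(1) unfolding X_def[symmetric] by (rule mult_le_mono[rotated])
      then show ?thesis by (simp add: algebra_simps)
    qed
    have t5: "Y \<le> X * X * ?V" using X(2) t2 by (meson le_trans)
    have "twin hs (Suc j) s = tocc hs s + 200 * X + 200 * (Y * X) + Y * Y * (?w + 20) + 60 * Y + 60"
      by (simp add: Y(2) X_def Y_def[symmetric] algebra_simps)
    \<comment> \<open>Besides \<open>c\<close> the coefficients add up to 541, which the summand 600
      in \<open>Z\<close> covers.\<close>
    also have "\<dots> \<le> c * (X * X * ?V) + 200 * (X * X * ?V) + 200 * (X * X * ?V) + 21 * (X * X * ?V) + 60 * (X * X * ?V) + 60 * (X * X * ?V)"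
    proof -
      have "tocc hs s \<le> c * (X * X * ?V)" using tocc t2 by (meson le_trans mult_le_mono2)
      then show ?thesis using t2 t3 t4 t5 t1[of 60] by linarith
    qed
    also have "\<dots> \<le> (c + 600) * (X * X * ?V)" by (simp add: algebra_simps)
    also have "\<dots> = Z ^ Suc (Suc j)" unfolding Z by (simp add: algebra_simps)
    finally show ?case .
  qed
  then show ?thesis by (simp only: Z_def)
qed

text \<open>2070 is 1860 + 210: the former collects 1440 for the ball, 280 for the kernel, 40 for
  setting up the position and 100 for overhead per centre, the latter the overhead of the whole
  run.\<close>

definition time_factor :: "bintree list \<Rightarrow> nat \<Rightarrow> nat \<Rightarrow> nat" where
  "time_factor hs D k =
     2070 + ((time_base hs * 16 ^ kernel_height (2 * k) (D * 2 ^ k)) ^ Suc k +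
       (40 * (D + 1) * 2 ^ k + 20 * k))"

lemma length_edges_input:
  assumes "tree_input (n, es, k)"
  shows "length es \<le> n * n"
proof -
  note D = tree_inputD[OF assms]
  have im: "(\<lambda>(u, v). {u, v}) ` set es = edge_set es" by (auto simp: edge_set_def)
  have "length es = card (edge_set es)"
    using distinct_card[OF D(5)] im by simp
  also have "\<dots> \<le> card ((\<lambda>(u, v). {u, v}) ` ({..<n} \<times> {..<n}))"
  proof (rule card_mono)
    show "edge_set es \<subseteq> (\<lambda>(u, v). {u, v}) ` ({..<n} \<times> {..<n})"
    proof
      fix e assume e: "e \<in> edge_set es"
      then obtain u v where uv: "e = {u, v}" by (auto simp: edge_set_def)
      then have "(u, v) \<in> {..<n} \<times> {..<n}" using D(3) e by auto
      then show "e \<in> (\<lambda>(u, v). {u, v}) ` ({..<n} \<times> {..<n})" using uv by force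
    qed
  qed simp
  also have "\<dots> \<le> card ({..<n} \<times> {..<n})" by (rule card_image_le) simp
  finally show ?thesis by simp
qed

text \<open>Building the ball dominates the polynomial part: up to \<open>n\<close> vertices, each
  with a scan of up to \<open>n * n\<close> edges whose endpoints are unary numbers below
  \<open>n\<close>, give \<open>n ^ 4\<close> per centre.\<close>

lemma tloop_bound:
  assumes t: "tree_input (n, es, k)"
  shows "tloop hs (encode_nat m) (encode_nat n) (encode_edges es) (encode_nat (D * 2 ^ k))
      (encode_nat (2 * k)) (encode_nat k) \<le>
    10 + m * ((1860 + (time_base hs * 16 ^ kernel_height (2 * k) (D * 2 ^ k)) ^ Suc k) * n ^ 4)"
proof (induction m)
  case (Suc m)
  let ?d = "D * 2 ^ k"
  let ?V = "(time_base hs * 16 ^ kernel_height (2 * k) ?d) ^ Suc k"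
  let ?E = "encode_edges es"
  let ?b = "bball (encode_nat ?d) (encode_nat m) (encode_nat n) ?E ?E"
  let ?t = "ball_tree ?d m n es es"
  note D = tree_inputD[OF t]
  have n: "1 \<le> n" by (rule D(6))
  have p: "n \<le> n ^ 4" "n ^ 2 \<le> n ^ 4" "n ^ 3 \<le> n ^ 4" "1 \<le> n ^ 4"
    using n power_increasing[of 1 4 n] power_increasing[of 2 4 n] power_increasing[of 3 4 n] by auto
  have b: "?b = shape ?t" by (rule bball_encode)
  have size_b: "size ?b \<le> n" unfolding b by (rule size_ball_tree_input[OF t])
  have "bheight (kern (2 * k) ?b) \<le> kernel_height (2 * k) ?d"
    unfolding b using bheight_reduced[OF reduced_kern] depth_kern depth_ball_tree by (meson le_trans)
  then have "(time_base hs * 16 ^ bheight (kern (2 * k) ?b)) ^ Suc k \<le> ?V"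
    by (intro power_mono mult_le_mono power_increasing) auto
  then have win: "twin hs k (bheight (kern (2 * k) ?b)) \<le> ?V"
    using twin_bound[of hs k "bheight (kern (2 * k) ?b)"] by (meson le_trans)
  have blen: "blen ?E \<le> n * n"
    using length_edges_input[OF t] by (simp add: encode_edges_def)
  have ball: "tball (encode_nat ?d) (encode_nat m) (encode_nat n) ?E ?E \<le> 1440 * n ^ 4"
  proof -
    have small: "size (left e) + size (right e) \<le> 2 * n" if "e \<in> set (children ?E)" for e
    proof -
      obtain u v where uv: "e = Node (encode_nat u) (encode_nat v)" "(u, v) \<in> set es"
        using \<open>e \<in> _\<close> by (auto simp: encode_edges_def)
      then have "{u, v} \<in> edge_set es" by (auto simp: edge_set_def)
      then have "u < n" "v < n" using D(3) by auto
      then show ?thesis using uv(1) by simp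
    qed
    have "tball (encode_nat ?d) (encode_nat m) (encode_nat n) ?E ?E \<le>
        (200 + 80 * (2 * n)) * (blen ?E + 1 + size ?b * (blen ?E + 1))"
      by (rule tball_bound[OF small small])
    also have "\<dots> = (200 + 160 * n) * ((blen ?E + 1) * (size ?b + 1))" by (simp add: algebra_simps)
    also have "\<dots> \<le> (360 * n) * ((2 * (n * n)) * (2 * n))"
    proof (intro mult_le_mono[of "200 + 160 * n"] mult_le_mono[of "blen ?E + 1"])
      have "1 \<le> n * n" using n by (simp add: Suc_le_eq)
      then show "blen ?E + 1 \<le> 2 * (n * n)" using blen by linarith
    qed (use n size_b in linarith)+
    also have "\<dots> = 1440 * n ^ 4" by (simp add: power4_eq_xxxx)
    finally show ?thesis .
  qed
  have kern: "tkern (2 * k) ?b \<le> 280 * n ^ 4"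
  proof -
    have "tkern (2 * k) ?b \<le> size ?b * ((n + 1) * (40 * n + 60) + 70) + 10"
      by (rule tkern_bound[OF size_b])
    also have "\<dots> \<le> n * ((2 * n) * (100 * n) + 70 * (n * n)) + 10 * (n * n * n)"
      using n size_b by (intro add_mono mult_le_mono) (auto simp: Suc_le_eq)
    also have "\<dots> = 280 * n ^ 3" by (simp add: power3_eq_cube algebra_simps)
    finally show ?thesis using p(3) by linarith
  qed
  have "40 * size (kern (2 * k) ?b) \<le> 40 * n ^ 4"
    using size_kern[of "2 * k" ?b] size_b p(1) by linarith
  moreover have "?V \<le> ?V * n ^ 4" using p(4) by simp
  moreover have "100 \<le> 100 * n ^ 4" using p(4) by simp
  ultimately have "100 + tball (encode_nat ?d) (encode_nat m) (encode_nat n) ?E ?E + tkern (2 * k) ?b +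
      40 * size (kern (2 * k) ?b) + twin hs k (bheight (kern (2 * k) ?b)) \<le> (1860 + ?V) * n ^ 4"
    using ball kern win unfolding add_mult_distrib by linarith
  then show ?case using Suc by simp
qed simp

section \<open>Computability of the time bound\<close>

text \<open>With this choice of \<open>\<tau>\<close>, \<open>safe\<close> only demands that the calls terminate with the right value.\<close>

definition some_time :: "program \<Rightarrow> (nat \<Rightarrow> bintree list \<Rightarrow> bintree) \<Rightarrow> nat \<Rightarrow> bintree list \<Rightarrow> nat" where
  "some_time P \<Phi> j xs = (SOME t. eval P xs (P ! j) (\<Phi> j xs) t)"

lemma some_timeI:
  "\<exists>t. eval P xs b v t \<Longrightarrow> b = P ! j \<Longrightarrow> v = \<Phi> j xs \<Longrightarrow> runs_within P xs b v (some_time P \<Phi> j xs)"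
  unfolding runs_within_def some_time_def by (metis order_refl someI)

lemma evalI:
  assumes "b = e" "safe P \<Phi> (some_time P \<Phi>) env e" "den \<Phi> env e = v"
  shows "\<exists>t. eval P env b v t"
  using safe_runs_within[OF assms(2)] assms(1,3) unfolding runs_within_def by blast

section \<open>Unary arithmetic for the time bound\<close>

definition "plusE = IfE v0 (NodeE LeafE (CallE 1 [RightE v0, v1])) v1"
definition "timesE = IfE v0 (CallE 1 [v1, CallE 2 [RightE v0, v1]]) LeafE"
definition "powE = IfE v1 (CallE 2 [v0, CallE 3 [v0, RightE v1]]) trueE"
text \<open>\<open>s\<close> is evaluated twice for want of local bindings. The resulting blow-up is
  harmless, since computability asks only for termination.\<close>

definition "heightE =
  (let s = CallE 4 [v0, RightE v1]; two = quote (encode_nat 2) in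
   IfE v1 (CallE 1 [CallE 2 [v0, CallE 3 [two, CallE 3 [two, s]]], s]) LeafE)"
definition "factorE c D =
  (let q = (\<lambda>n. quote (encode_nat n)); two_k = CallE 3 [q 2, v0] in
   CallE 1 [q 2070, CallE 1 [
     CallE 3 [CallE 2 [q c, CallE 3 [q 16, CallE 4 [CallE 2 [q 2, v0], CallE 2 [q D, two_k]]]],
       NodeE LeafE v0],
     CallE 1 [CallE 2 [q (40 * (D + 1)), two_k], CallE 2 [q 20, v0]]]])"

definition time_prog :: "nat \<Rightarrow> nat \<Rightarrow> program" where
  "time_prog c D = [factorE c D, plusE, timesE, powE, heightE]"

definition Psi :: "nat \<Rightarrow> bintree list \<Rightarrow> bintree" where
  "Psi j xs = encode_nat ([0, blen (xs ! 0) + blen (xs ! 1), blen (xs ! 0) * blen (xs ! 1),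
     blen (xs ! 0) ^ blen (xs ! 1), kernel_height (blen (xs ! 0)) (blen (xs ! 1))] ! j)"

lemma Psi_simps [simp]:
  "Psi (Suc 0) [a, b] = encode_nat (blen a + blen b)"
  "Psi 2 [a, b] = encode_nat (blen a * blen b)"
  "Psi 3 [a, b] = encode_nat (blen a ^ blen b)"
  "Psi 4 [a, b] = encode_nat (kernel_height (blen a) (blen b))"
  by (simp_all add: Psi_def)

lemma time_prog_nth [simp]:
  "length (time_prog c D) = 5" "time_prog c D ! 0 = factorE c D" "time_prog c D ! Suc 0 = plusE"
  "time_prog c D ! 2 = timesE" "time_prog c D ! 3 = powE" "time_prog c D ! 4 = heightE"
  by (simp_all add: time_prog_def)

lemmas time_evalI = evalI[where \<Phi> = Psi and P = "time_prog c D" for c D]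

lemma eval_plus: "\<exists>t. eval (time_prog c D) [encode_nat a, encode_nat b] plusE (encode_nat (a + b)) t"
proof (induction a)
  case (Suc a)
  then show ?case by (intro time_evalI[OF plusE_def]) (simp_all add: some_timeI)
qed (rule time_evalI[OF plusE_def], simp_all)

lemma eval_times: "\<exists>t. eval (time_prog c D) [encode_nat a, encode_nat b] timesE (encode_nat (a * b)) t"
proof (induction a)
  case (Suc a)
  then show ?case by (intro time_evalI[OF timesE_def]) (simp_all add: some_timeI eval_plus)
qed (rule time_evalI[OF timesE_def], simp_all)

lemma eval_pow: "\<exists>t. eval (time_prog c D) [encode_nat a, encode_nat b] powE (encode_nat (a ^ b)) t"
proof (induction b)
  case (Suc b)
  then show ?case by (intro time_evalI[OF powE_def]) (simp_all add: some_timeI eval_times)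
qed (rule time_evalI[OF powE_def], simp_all)

lemma eval_height:
  "\<exists>t. eval (time_prog c D) [encode_nat q, encode_nat d] heightE (encode_nat (kernel_height q d)) t"
proof (induction d)
  case (Suc d)
  then show ?case
    by (intro time_evalI[OF heightE_def]) (simp_all add: Let_def some_timeI eval_plus eval_times eval_pow)
qed (rule time_evalI[OF heightE_def], simp_all add: Let_def)

lemma eval_factor:
  "\<exists>t. eval (time_prog (time_base hs) D) [encode_nat k] (factorE (time_base hs) D) (encode_nat (time_factor hs D k)) t"
proof (rule time_evalI[OF factorE_def])
  \<comment> \<open>The exponent \<open>Suc k\<close> enters the program as a cell put in front of
    \<open>k\<close>; it has to be recognised as a numeral before \<open>eval_pow\<close>
    applies.\<close>
  have s: "Node Leaf (encode_nat k) = encode_nat (Suc k)" by simp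
  show "safe (time_prog (time_base hs) D) Psi (some_time (time_prog (time_base hs) D) Psi) [encode_nat k]
    (let q = \<lambda>n. quote (encode_nat n); two_k = CallE 3 [q 2, v0] in
      CallE 1 [q 2070, CallE 1 [
        CallE 3 [CallE 2 [q (time_base hs), CallE 3 [q 16, CallE 4 [CallE 2 [q 2, v0], CallE 2 [q D, two_k]]]],
          NodeE LeafE v0],
        CallE 1 [CallE 2 [q (40 * (D + 1)), two_k], CallE 2 [q 20, v0]]]])"
    by (simp add: Let_def some_timeI eval_plus eval_times eval_pow eval_height s
        del: encode_nat_simps power_Suc)
qed (simp add: Let_def time_factor_def)

lemma computable_time_factor: "computable (time_factor hs D)"
  unfolding computable_def runs_def
  by (intro exI[of _ "time_prog (time_base hs) D"] allI)
    (use eval_factor in \<open>simp add: time_prog_def\<close>)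

section \<open>Correctness\<close>

lemma bloop_iff:
  "bloop hs (encode_nat m) n E d q k \<longleftrightarrow> (\<exists>x<m. check hs (encode_nat x) n E d q k)"
  by (induction m) (auto simp: less_Suc_eq)

theorem theorem19:
  fixes H :: "'a graph"
  assumes "connected_graph H"
  shows "fixed_parameter_tractable encode_input
           (\<lambda>x. card (verts (input_graph x))) input_moves tree_input
           (\<lambda>x. maker_wins_H_game H (input_graph x) (input_moves x))"
proof -
  \<comment> \<open>\<open>D\<close> and \<open>hs\<close> depend on \<open>H\<close> alone and may
    therefore be built into the program.\<close>
  define D where "D = Suc (card (adj (edges H)))"
  obtain hs where hs: "set hs = shapes H"
    using finite_list[OF finite_shapes[OF assms]] by blast
  \<comment> \<open>The exponent 5 arises from \<open>n\<close> centres at a cost of order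
    \<open>n ^ 4\<close> each.\<close>
  have "\<exists>t. runs (prog hs D) (encode_input x)
      (encode_bool (maker_wins_H_game H (input_graph x) (input_moves x))) t \<and>
      t \<le> time_factor hs D (input_moves x) * card (verts (input_graph x)) ^ 5"
    if "tree_input x" for x
  proof -
    obtain n es k where x: "x = (n, es, k)" by (cases x)
    have t: "tree_input (n, es, k)" using that x by simp
    let ?n = "encode_nat n" and ?E = "encode_edges es" and ?k = "encode_nat k"
    let ?d = "encode_nat (D * 2 ^ k)" and ?q = "encode_nat (2 * k)"
    let ?V = "(time_base hs * 16 ^ kernel_height (2 * k) (D * 2 ^ k)) ^ Suc k"
    have "check hs (encode_nat v) ?n ?E ?d ?q ?k \<longleftrightarrow>
        bwin (shapes H) k (pos v (prune (2 * k) (ball_tree (D * 2 ^ k) v n es es)) (\<lambda>_. Leaf))" for v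
      by (simp add: check_def hs bball_encode pos_free shape_prune)
    then have correct: "bloop hs ?n ?n ?E ?d ?q ?k \<longleftrightarrow> maker_wins_H_game H (input_graph x) k"
      unfolding x bloop_iff maker_wins_iff_bwin[OF assms t] D_def by simp
    have "runs_within (prog hs D) [encode_input x] mainE (encode_bool (bloop hs ?n ?n ?E ?d ?q ?k))
        (200 + tloop hs ?n ?n ?E ?d ?q ?k + 40 * (D + 1) * 2 ^ k + 20 * k)"
      using run_main[of hs D ?n ?E ?k] by (simp add: x radius_def dbl_def encode_edges_def)
    then obtain s where s: "eval (prog hs D) [encode_input x] mainE
        (encode_bool (maker_wins_H_game H (input_graph x) k)) s"
      "s \<le> 200 + tloop hs ?n ?n ?E ?d ?q ?k + 40 * (D + 1) * 2 ^ k + 20 * k"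
      unfolding correct runs_within_def by blast
    have "1 \<le> n" using tree_inputD(6)[OF t] .
    then have n5: "1 \<le> n ^ 5" by simp
    note s(2)
    also have "200 + tloop hs ?n ?n ?E ?d ?q ?k + 40 * (D + 1) * 2 ^ k + 20 * k \<le>
        210 + (1860 + ?V) * n ^ 5 + (40 * (D + 1) * 2 ^ k + 20 * k)"
    proof -
      have "n * (A * n ^ 4) = A * n ^ 5" for A by (simp add: eval_nat_numeral)
      then have "tloop hs ?n ?n ?E ?d ?q ?k \<le> 10 + (1860 + ?V) * n ^ 5"
        using tloop_bound[OF t, of hs n D] by (simp only:)
      then show ?thesis by linarith
    qed
    also have "\<dots> \<le> 210 * n ^ 5 + (1860 + ?V) * n ^ 5 + (40 * (D + 1) * 2 ^ k + 20 * k) * n ^ 5"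
      using n5 by (intro add_mono) auto
    also have "\<dots> = time_factor hs D k * n ^ 5"
      by (simp add: time_factor_def algebra_simps)
    finally have "s \<le> time_factor hs D k * n ^ 5" .
    moreover have "prog hs D \<noteq> []" by (simp add: prog_def)
    ultimately show ?thesis
      using s(1) by (intro exI[of _ s]) (simp add: runs_def x)
  qed
  then show ?thesis
    unfolding fixed_parameter_tractable_def
    by (intro exI[of _ "prog hs D"] exI[of _ "time_factor hs D"] exI[of _ "5 :: nat"] conjI
        computable_time_factor) blast
qed

end
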